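(* Let $p\in(0,1)$ and let $\mathtt{Z}$ be a random variable with values in $\mathbb{N}=\{1,2,\dots\}$ such that $\mathbb{E}(\log\mathtt{Z})<\infty$. Let $\psi,\xi,\Psi$, $I=(-\psi'(\xi)\xi,\infty)$ and the free energy $F_{\mathsf{LF}}$ be as defined in the context. (a) There exists a unique nonincreasing, Lipschitz continuous function $h:I\to[0,\infty)$, vanishing on $[0,\infty)$, which satisfies $$h(x+h(x))=\Psi(x+h(x))\,h(x)\quad\text{for all }x\in(-\psi'(\xi)\xi,0]$$ and $h(x)\sim x^2/2$ as $x\uparrow0$. Furthermore, for any $\alpha,\beta>0$ with $\alpha+\beta\ge1$, $$h\Big(\psi'(\xi)\Big(\frac\beta\alpha-\xi\Big)\Big)<\psi'(\xi)\frac{1-p}{p\alpha}\iff F_{\mathsf{LF}}(\alpha,\beta)>0.$$ (b) For $\alpha,\beta>0$ with $\alpha+\beta\ge1$ and $\beta/\alpha\le\xi$, let $$\gamma_*:=\inf\{\gamma\in(0,\alpha+\beta]:F_{\mathsf{LF}}(\alpha/\gamma,\beta/\gamma)>0\}.$$ If $$h\Big(\psi'(\xi)\Big(\frac\beta\alpha-\xi\Big)\Big)<\psi'(\xi)\frac{1-p}{p\alpha}(\alpha+\beta),$$ then $$\gamma_*=\frac{p\,\alpha\,h\big(\psi'(\xi)(\frac\beta\alpha-\xi)\big)}{\psi'(\xi)(1-p)}\in[0,\alpha+\beta),$$ and there exists $C_{\alpha,\beta}>0$ such that $$\lim_{\gamma\downarrow\gamma_*}(\gamma-\gamma_* )^{1/2}\log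 F_{\mathsf{LF}}(\alpha/\gamma,\beta/\gamma)=-C_{\alpha,\beta}.$$
   Context: Linear fractional distribution: for $\alpha,\beta>0$ with $\alpha+\beta\ge1$, $\mathsf{LF}(\alpha,\beta)$ is the law on $\{0,1,2,\dots\}$ of a random variable $Y$ with $\mathbb{E}(s^Y)=1-\frac{1-s}{\alpha+\beta(1-s)}$ for $0\le s\le1$; its mean is $1/\alpha$. Generalized Derrida--Retaux model: let $\mathtt{R}$ be geometric, $\mathbb{P}(\mathtt{R}=k)=p(1-p)^{k-1}$, $k\ge1$, independent of $\mathtt{Z}$. Given a law $\nu_n$ on $[0,\infty)$, let $(X_n^{(k)})_{k\ge1}$ be i.i.d. with law $\nu_n$, independent of $(\mathtt{R},\mathtt{Z})$, and let $\nu_{n+1}$ be the law of $\big(\sum_{k=1}^{\mathtt{R}}X_n^{(k)}-\mathtt{Z}\big)_+$. The free energy is $F_{\mathsf{LF}}(\alpha,\beta):=\lim_{n\to\infty}p^n\int x\,\nu_n(\mathrm{d}x)$ for the model started from $\nu_0=\mathsf{LF}(\alpha,\beta)$ (the sequence is nonincreasing, so the limit exists). Functions: $\varphi(s)=\mathbb{E}(s^{\mathtt{Z}})$, $0\le s\le1$; $\psi(x)=\frac1p\varphi\big(\frac{x}{x+1}\big)$, $x\ge0$, which increases from $0$ to $1/p$; $\xi>0$ is the unique number with $\psi(\xi)=1$; $\Psi(x)=\psi\big(\frac{x}{\psi'(\xi)}+\xi\big)$ for $x\in I:=(-\psi'(\xi)\xi,\infty)$. *)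

theory Defs
  imports "HOL-Probability.Probability"
begin

definition LF :: "real \<Rightarrow> real \<Rightarrow> nat pmf" where
  "LF \<alpha> \<beta> = (THE q. \<forall>s\<in>{0..1}.
     measure_pmf.expectation q (\<lambda>k. s ^ k) = 1 - (1 - s) / (\<alpha> + \<beta> * (1 - s)))"

text \<open>The library's \<^const>\<open>geometric_pmf\<close> counts failures, hence has support
  \<open>{0, 1, \<dots>}\<close>; \<open>Suc\<close> shifts it to \<open>{1, 2, \<dots>}\<close>.\<close>

definition DR_R :: "real \<Rightarrow> nat pmf" where
  "DR_R p = map_pmf Suc (geometric_pmf p)"

text \<open>The argument \<open>Z\<close> is the law of the random variable subtracted at each step.\<close>

definition DR_step :: "real \<Rightarrow> nat pmf \<Rightarrow> real measure \<Rightarrow> real measure" where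
  "DR_step p Z \<nu> =
     distr (measure_pmf (DR_R p) \<Otimes>\<^sub>M ((\<Pi>\<^sub>M k\<in>{1::nat..}. \<nu>) \<Otimes>\<^sub>M measure_pmf Z)) borel
       (\<lambda>(r, x, z). max 0 ((\<Sum>k=1..r. x k) - real z))"

definition DR_law :: "real \<Rightarrow> nat pmf \<Rightarrow> real measure \<Rightarrow> nat \<Rightarrow> real measure" where
  "DR_law p Z \<nu>0 n = (DR_step p Z ^^ n) \<nu>0"

definition F_LF :: "real \<Rightarrow> nat pmf \<Rightarrow> real \<Rightarrow> real \<Rightarrow> real" where
  "F_LF p Z \<alpha> \<beta> =
     lim (\<lambda>n. p ^ n * (\<integral>x. x \<partial>DR_law p Z (distr (measure_pmf (LF \<alpha> \<beta>)) borel real) n))"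

definition DR_phi :: "nat pmf \<Rightarrow> real \<Rightarrow> real" where
  "DR_phi Z s = measure_pmf.expectation Z (\<lambda>k. s ^ k)"

definition DR_psi :: "real \<Rightarrow> nat pmf \<Rightarrow> real \<Rightarrow> real" where
  "DR_psi p Z x = 1 / p * DR_phi Z (x / (x + 1))"

definition DR_xi :: "real \<Rightarrow> nat pmf \<Rightarrow> real" where
  "DR_xi p Z = (THE x. x > 0 \<and> DR_psi p Z x = 1)"

definition DR_dpsi_xi :: "real \<Rightarrow> nat pmf \<Rightarrow> real" where
  "DR_dpsi_xi p Z = deriv (DR_psi p Z) (DR_xi p Z)"

definition DR_Psi :: "real \<Rightarrow> nat pmf \<Rightarrow> real \<Rightarrow> real" where
  "DR_Psi p Z x = DR_psi p Z (x / DR_dpsi_xi p Z + DR_xi p Z)"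

definition DR_I :: "real \<Rightarrow> nat pmf \<Rightarrow> real set" where
  "DR_I p Z = {- DR_dpsi_xi p Z * DR_xi p Z <..}"

text \<open>Only the values of \<open>h\<close> on \<open>DR_I p Z\<close> matter here, so uniqueness of such an \<open>h\<close> is to be
  read as uniqueness on that interval.\<close>

definition DR_h :: "real \<Rightarrow> nat pmf \<Rightarrow> (real \<Rightarrow> real) \<Rightarrow> bool" where
  "DR_h p Z h \<longleftrightarrow>
     h \<in> DR_I p Z \<rightarrow> {0..} \<and>
     antimono_on (DR_I p Z) h \<and>
     (\<exists>L. L-lipschitz_on (DR_I p Z) h) \<and>
     (\<forall>x\<ge>0. h x = 0) \<and>
     (\<forall>x\<in>DR_I p Z. x \<le> 0 \<longrightarrow> h (x + h x) = DR_Psi p Z (x + h x) * h x) \<and>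
     h \<sim>[at_left 0] (\<lambda>x. x\<^sup>2 / 2)"

definition gamma_star :: "real \<Rightarrow> nat pmf \<Rightarrow> real \<Rightarrow> real \<Rightarrow> real" where
  "gamma_star p Z \<alpha> \<beta> = Inf {\<gamma>\<in>{0<..\<alpha> + \<beta>}. F_LF p Z (\<alpha> / \<gamma>) (\<beta> / \<gamma>) > 0}"

end

theory Submission
  imports Defs
begin

text \<open>Linear fractional laws are preserved by the recursion, and this reduces the theorem to a planar map.
  If \<open>\<nu>\<^sub>n = LF \<alpha>\<^sub>n \<beta>\<^sub>n\<close>, a geometric sum of independent copies is again linear fractional, and subtracting
  \<open>Z\<close> only rescales both parameters, because the tail of a linear fractional law is geometric.
  With \<open>x = \<beta> / \<alpha>\<close> and \<open>y = (1 - p) / (p \<alpha>)\<close> the parameters evolve by \<open>x' = x + y\<close> and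
  \<open>y' = y \<psi>(x')\<close>, and the free energy is a multiple of \<open>lim p\<^sup>n y\<^sub>n\<close>. Centring \<open>x\<close> at \<open>\<xi>\<close> and scaling both
  coordinates by \<open>\<psi>'(\<xi>)\<close> turns \<open>\<psi>\<close> into \<open>\<Psi>\<close>, which satisfies \<open>\<Psi>(u) = 1 + u + O(u\<^sup>2)\<close>.

  If \<open>X\<close> never becomes positive, \<open>Y\<close> does not increase and \<open>p\<^sup>n Y\<^sub>n \<rightarrow> 0\<close>. Once \<open>X\<close> is positive, \<open>X\<close> and \<open>Y\<close> grow
  geometrically, and \<open>p\<^sup>n Y\<^sub>n\<close> is a product of factors \<open>\<phi>(s\<^sub>n)\<close> with \<open>1 - s\<^sub>n\<close> geometrically small; this product is
  positive because \<open>ln Z\<close> is integrable. Hence the free energy is positive iff the orbit crosses the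
  line \<open>X = 0\<close>. The map preserves the product order, so the starting points that never cross are those below the
  graph of a function \<open>h\<close>. Monotonicity alone shows that \<open>h\<close> is nonincreasing, that \<open>x + h x\<close> is nondecreasing
  (so \<open>h\<close> is 1-Lipschitz), and that the graph is invariant, which is the functional equation. Comparison with
  the parabolas \<open>(1 \<plusminus> \<epsilon>) x\<^sup>2 / 2\<close> gives the asymptotics at 0. For uniqueness, the orbits on any invariant
  curve with these asymptotics end in the origin, while the horizontal distance between two ordered orbits never
  decreases.

  For the exponent, start at height \<open>d\<close> above the critical curve. The quantity \<open>E = Y - X\<^sup>2 / 2\<close> is almost
  conserved: as long as \<open>X \<le> 0\<close>, the difference of \<open>E\<close> between the perturbed and the critical orbit changes at each
  step by a factor \<open>1 + O(Y)\<close>, and the steps \<open>Y\<close> add up to the distance travelled. It is therefore equal to \<open>c d\<close>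
  up to a factor close to 1 when the orbit is near the origin, where \<open>c > 0\<close> is a limit point
  of the derivatives of \<open>E\<close>, after finitely many steps, with respect to \<open>d\<close>. So near the origin the orbit follows the flow
  \<open>dX = (X\<^sup>2 / 2 + c d) ds\<close>, which needs about time \<open>\<pi> / sqrt (c d / 2)\<close> to pass the bottleneck (half of that when
  it starts at \<open>X = 0\<close>). Each unit of time costs a factor \<open>p\<close> in the free energy, and everything after the passage
  contributes a bounded factor.

  The estimates for the planar map are carried out in the locale \<open>parabolic_map\<close>; \<open>near_parabola\<close> and
  \<open>passage_time\<close> carry the asymptotics, \<open>DR_law_LF\<close> the reduction, and \<open>DR_psi_growth\<close> the use of the moment
  condition.\<close>

section \<open>Orbits of the planar recursion\<close>

primrec orbit :: "(real \<Rightarrow> real) \<Rightarrow> real \<Rightarrow> real \<Rightarrow> nat \<Rightarrow> real \<times> real" where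
  "orbit f x y 0 = (x, y)"
| "orbit f x y (Suc n) = (let (a, b) = orbit f x y n in (a + b, b * f (a + b)))"

definition orbX :: "(real \<Rightarrow> real) \<Rightarrow> real \<Rightarrow> real \<Rightarrow> nat \<Rightarrow> real" where
  "orbX f x y n = fst (orbit f x y n)"

definition orbY :: "(real \<Rightarrow> real) \<Rightarrow> real \<Rightarrow> real \<Rightarrow> nat \<Rightarrow> real" where
  "orbY f x y n = snd (orbit f x y n)"

lemma orb_0 [simp]: "orbX f x y 0 = x" "orbY f x y 0 = y"
  by (simp_all add: orbX_def orbY_def)

lemma orb_Suc:
  "orbX f x y (Suc n) = orbX f x y n + orbY f x y n"
  "orbY f x y (Suc n) = orbY f x y n * f (orbX f x y n + orbY f x y n)"
  by (simp_all add: orbX_def orbY_def case_prod_unfold Let_def)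

lemma orb_add:
  "orbX f x y (m + n) = orbX f (orbX f x y m) (orbY f x y m) n"
  "orbY f x y (m + n) = orbY f (orbX f x y m) (orbY f x y m) n"
  by (induction n) (simp_all add: orb_Suc)

lemma orb_Suc_shift:
  "orbX f x y (Suc n) = orbX f (x + y) (y * f (x + y)) n"
  using orb_add(1)[of f x y 1 n] by (simp add: orb_Suc)

lemma orb_zero: "orbX f x 0 n = x" "orbY f x 0 n = 0"
proof -
  have "orbX f x 0 n = x \<and> orbY f x 0 n = 0"
    by (induction n) (simp_all add: orb_Suc)
  then show "orbX f x 0 n = x" "orbY f x 0 n = 0" by auto
qed

text \<open>The normalized map \<open>(X, Y) \<mapsto> (X + Y, Y f(X + Y))\<close>. Every point of the axis \<open>Y = 0\<close> is fixed, and the origin is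
  the parabolic one, where the multiplier \<open>f\<close> passes through 1. The last assumption says that \<open>f u - u\<close> is
  Lipschitz near 0 with a constant that shrinks linearly with the distance to 0.\<close>

locale parabolic_map =
  fixes f :: "real \<Rightarrow> real" and A :: real
  assumes A_pos: "A > 0"
    and f_mono: "strict_mono_on {-A<..} f"
    and f_pos: "x > -A \<Longrightarrow> f x > 0"
    and f_0: "f 0 = 1"
    and f_diff: "x > -A \<Longrightarrow> \<exists>D. (f has_real_derivative D) (at x)"
    and f_quad: "\<exists>C r. r > 0 \<and> (\<forall>x y. \<bar>x\<bar> \<le> r \<longrightarrow> \<bar>y\<bar> \<le> r \<longrightarrow>
                    \<bar>f x - f y - (x - y)\<bar> \<le> C * max \<bar>x\<bar> \<bar>y\<bar> * \<bar>x - y\<bar>)"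
begin

abbreviation "X \<equiv> orbX f"
abbreviation "Y \<equiv> orbY f"

lemma f_le: "-A < x \<Longrightarrow> x \<le> y \<Longrightarrow> f x \<le> f y"
  using f_mono by (cases "x = y") (auto simp: strict_mono_on_def intro: less_imp_le)

lemma f_cont: "continuous_on {-A<..} f"
  using f_diff DERIV_isCont continuous_at_imp_continuous_on by (metis greaterThan_iff)

lemma f_quad_obtain:
  obtains C r where "C \<ge> 1" "r > 0" "r < 1" "r < A"
    "\<And>x y. \<bar>x\<bar> \<le> r \<Longrightarrow> \<bar>y\<bar> \<le> r \<Longrightarrow> \<bar>f x - f y - (x - y)\<bar> \<le> C * max \<bar>x\<bar> \<bar>y\<bar> * \<bar>x - y\<bar>"
    "\<And>x. \<bar>x\<bar> \<le> r \<Longrightarrow> \<bar>f x - 1 - x\<bar> \<le> C * x\<^sup>2"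
proof -
  obtain C r where r: "r > 0" and q: "\<And>x y. \<bar>x\<bar> \<le> r \<Longrightarrow> \<bar>y\<bar> \<le> r \<Longrightarrow>
      \<bar>f x - f y - (x - y)\<bar> \<le> C * max \<bar>x\<bar> \<bar>y\<bar> * \<bar>x - y\<bar>"
    using f_quad by auto
  define C' r' where "C' = max C 1" and "r' = min r (min (1/2) (A/2))"
  have q': "\<bar>f x - f y - (x - y)\<bar> \<le> C' * max \<bar>x\<bar> \<bar>y\<bar> * \<bar>x - y\<bar>"
    if "\<bar>x\<bar> \<le> r'" "\<bar>y\<bar> \<le> r'" for x y
  proof -
    have "\<bar>f x - f y - (x - y)\<bar> \<le> C * max \<bar>x\<bar> \<bar>y\<bar> * \<bar>x - y\<bar>" using that q by (simp add: r'_def)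
    also have "\<dots> \<le> C' * max \<bar>x\<bar> \<bar>y\<bar> * \<bar>x - y\<bar>"
      by (intro mult_right_mono) (auto simp: C'_def)
    finally show ?thesis .
  qed
  have "\<bar>f x - 1 - x\<bar> \<le> C' * x\<^sup>2" if "\<bar>x\<bar> \<le> r'" for x
    using q'[of x 0] that by (simp add: f_0 power2_eq_square mult.assoc)
  with q' show thesis using r A_pos by (intro that[of C' r']) (auto simp: C'_def r'_def)
qed

lemma orb_nonneg:
  assumes "-A < x" "0 \<le> y"
  shows "x \<le> X x y n" "0 \<le> Y x y n"
proof -
  have "x \<le> X x y n \<and> 0 \<le> Y x y n"
    by (induction n) (use assms in \<open>auto simp: orb_Suc intro!: mult_nonneg_nonneg less_imp_le[OF f_pos]\<close>)
  then show "x \<le> X x y n" "0 \<le> Y x y n" by auto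
qed

lemma orbY_pos:
  assumes "-A < x" "0 < y"
  shows "0 < Y x y n"
proof (induction n)
  case (Suc n)
  have "-A < X x y n + Y x y n" using orb_nonneg[of x y n] assms by auto
  then show ?case using Suc f_pos by (simp add: orb_Suc)
qed (use assms in auto)

lemma orbX_incr:
  assumes "-A < x" "0 \<le> y" "m \<le> n"
  shows "X x y m \<le> X x y n"
  using assms(3) by (induction n rule: dec_induct)
    (use orb_nonneg[OF assms(1,2)] in \<open>auto simp: orb_Suc add_increasing2\<close>)

text \<open>Both components of the map are nondecreasing in \<open>X\<close> and \<open>Y\<close> where \<open>Y \<ge> 0\<close>. This order is behind most of
  what follows.\<close>

lemma orb_mono:
  assumes "-A < x" "0 \<le> y" "x \<le> x'" "y \<le> y'"
  shows "X x y n \<le> X x' y' n" "Y x y n \<le> Y x' y' n"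
proof -
  have "X x y n \<le> X x' y' n \<and> Y x y n \<le> Y x' y' n"
  proof (induction n)
    case (Suc n)
    have 1: "x \<le> X x y n" "0 \<le> Y x y n" using orb_nonneg[of x y n] assms by auto
    have "f (X x y n + Y x y n) \<le> f (X x' y' n + Y x' y' n)"
      using 1 Suc assms by (intro f_le) auto
    moreover have "0 < f (X x y n + Y x y n)" using 1 assms by (intro f_pos) auto
    ultimately show ?case using Suc 1 by (auto simp: orb_Suc intro!: mult_mono)
  qed (use assms in auto)
  then show "X x y n \<le> X x' y' n" "Y x y n \<le> Y x' y' n" by auto
qed

text \<open>The gap in \<open>X\<close> increases by the gap in \<open>Y\<close>, which is nonnegative by \<open>orb_mono\<close>.\<close>

lemma orbX_gap_incr:
  assumes "-A < x" "0 \<le> y" "y \<le> y'"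
  shows "y' - y \<le> X x y' (Suc n) - X x y (Suc n)"
proof (induction n)
  case (Suc n)
  have "Y x y (Suc n) \<le> Y x y' (Suc n)" using orb_mono(2)[of x y x y'] assms by auto
  then show ?case using Suc orb_Suc(1)[of f x y "Suc n"] orb_Suc(1)[of f x y' "Suc n"] by linarith
qed (use assms in \<open>auto simp: orb_Suc\<close>)

lemma orb_cont:
  assumes "-A < x"
  shows "continuous_on {0..} (\<lambda>y. X x y n)" "continuous_on {0..} (\<lambda>y. Y x y n)"
proof -
  have "continuous_on {0..} (\<lambda>y. X x y n) \<and> continuous_on {0..} (\<lambda>y. Y x y n)"
  proof (induction n)
    case (Suc n)
    have "-A < X x y n + Y x y n" if "0 \<le> y" for y
      using orb_nonneg[OF assms that, of n] assms by auto
    then have "continuous_on {0..} (\<lambda>y. f (X x y n + Y x y n))"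
      using Suc by (intro continuous_on_compose2[OF f_cont] continuous_intros) auto
    then show ?case using Suc by (auto simp: orb_Suc intro!: continuous_intros)
  qed auto
  then show "continuous_on {0..} (\<lambda>y. X x y n)" "continuous_on {0..} (\<lambda>y. Y x y n)" by auto
qed

text \<open>\<open>Y\<close> is the increment of \<open>X\<close>, and a bounded nondecreasing sequence has vanishing increments.\<close>

lemma trapped_orbit_converges:
  assumes "-A < x" "0 \<le> y" "\<And>n. X x y n \<le> 0"
  obtains l where "X x y \<longlonglongrightarrow> l" "x \<le> l" "l \<le> 0" "Y x y \<longlonglongrightarrow> 0" "\<And>n. X x y n \<le> l"
proof -
  have inc: "incseq (X x y)" using orbX_incr[OF assms(1,2)] by (auto simp: incseq_def)
  obtain l where l: "X x y \<longlonglongrightarrow> l" "\<And>n. X x y n \<le> l"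
    using incseq_convergent[OF inc] assms(3) by metis
  have "(\<lambda>n. X x y (Suc n) - X x y n) \<longlonglongrightarrow> l - l"
    using l(1) by (intro tendsto_intros LIMSEQ_Suc) auto
  then have "Y x y \<longlonglongrightarrow> 0" by (simp add: orb_Suc)
  moreover have "l \<le> 0" using l(1) assms(3) by (intro LIMSEQ_le_const2) auto
  moreover have "x \<le> l" using l(2)[of 0] by simp
  ultimately show thesis using l that by auto
qed

section \<open>The critical curve\<close>

text \<open>The largest starting height from which \<open>X\<close> never becomes positive. The value 0 for \<open>x \<ge> 0\<close> is part of the
  characterization of the curve; at \<open>x = 0\<close> it agrees with the supremum.\<close>

definition h :: "real \<Rightarrow> real" where
  "h x = (if x \<ge> 0 then 0 else Sup {y. 0 \<le> y \<and> (\<forall>n. X x y n \<le> 0)})"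

text \<open>The trapped heights form a down-set by monotonicity, and a closed one because each \<open>X\<^sub>n\<close> is continuous in
  the starting height; so the supremum is itself trapped.\<close>

lemma le_h_iff:
  assumes x: "-A < x" "x \<le> 0" and y: "0 \<le> y"
  shows "y \<le> h x \<longleftrightarrow> (\<forall>n. X x y n \<le> 0)"
proof (cases "x = 0")
  case True
  have "y \<le> 0" if "\<forall>n. X x y n \<le> 0"
    using that[rule_format, of 1] True by (simp add: orb_Suc)
  moreover have "X x y n \<le> 0" if "y \<le> 0" for n
    using that y True by (simp add: orb_zero)
  ultimately show ?thesis using True by (auto simp: h_def)
next
  case False
  define S where "S = {y. 0 \<le> y \<and> (\<forall>n. X x y n \<le> 0)}"
  have hS: "h x = Sup S" using False x by (simp add: h_def S_def)
  have S0: "0 \<in> S" using x by (simp add: S_def orb_zero)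
  have bdd: "bdd_above S"
  proof (rule bdd_aboveI)
    fix y assume "y \<in> S"
    then have "X x y 1 \<le> 0" by (simp add: S_def)
    then show "y \<le> - x" by (simp add: orb_Suc)
  qed
  have "S = (\<Inter>n. {y\<in>{0..}. X x y n \<le> 0})" by (auto simp: S_def)
  moreover have "closed {y\<in>{0..}. X x y n \<le> 0}" for n
    using continuous_closed_preimage[OF orb_cont(1)[OF x(1), of n], of "{..0}"]
    by (simp add: vimage_def Int_def)
  ultimately have "closed S" by auto
  then have hmem: "Sup S \<in> S" using closed_contains_Sup[OF _ bdd] S0 by auto
  show ?thesis
  proof
    assume "y \<le> h x"
    then have "X x y n \<le> X x (Sup S) n" for n using hS x y by (intro orb_mono) auto
    then show "\<forall>n. X x y n \<le> 0" using hmem unfolding S_def by (metis (mono_tags, lifting) mem_Collect_eq order_trans)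
  next
    assume "\<forall>n. X x y n \<le> 0"
    then show "y \<le> h x" using hS bdd y by (auto simp: S_def intro: cSup_upper)
  qed
qed

lemma h_0: "x \<ge> 0 \<Longrightarrow> h x = 0" by (simp add: h_def)

lemma h_nonneg: assumes "-A < x" shows "0 \<le> h x"
  using le_h_iff[of x 0] assms by (cases "x \<ge> 0") (auto simp: h_0 orb_zero)

lemma h_trapped: "-A < x \<Longrightarrow> x \<le> 0 \<Longrightarrow> X x (h x) n \<le> 0"
  using le_h_iff h_nonneg by blast

lemma h_le: "-A < x \<Longrightarrow> x \<le> 0 \<Longrightarrow> x + h x \<le> 0"
  using h_trapped[of x 1] by (simp add: orb_Suc)

lemma h_antimono: assumes "-A < x" "x \<le> x'" shows "h x' \<le> h x"
proof (cases "x' \<ge> 0")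
  case True then show ?thesis using h_nonneg assms by (simp add: h_0)
next
  case False
  have "X x (h x') n \<le> 0" for n
    using orb_mono(1)[of x "h x'" x' "h x'" n] h_trapped[of x' n] h_nonneg[of x'] False assms by force
  then show ?thesis using le_h_iff[of x "h x'"] h_nonneg[of x'] assms False by auto
qed

text \<open>A point is trapped iff its image is. The shape of \<open>h\<close> is read off from this one-step form.\<close>

lemma h_step_iff:
  assumes x: "-A < x" "x \<le> 0" and y: "0 \<le> y"
  shows "y \<le> h x \<longleftrightarrow> x + y \<le> 0 \<and> y * f (x + y) \<le> h (x + y)"
proof (cases "x + y \<le> 0")
  case True
  have "0 \<le> y * f (x + y)" using x y f_pos[of "x + y"] by auto
  then have "y * f (x + y) \<le> h (x + y) \<longleftrightarrow> (\<forall>n. X x y (Suc n) \<le> 0)"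
    using le_h_iff[of "x + y" "y * f (x + y)"] x y True by (auto simp: orb_Suc_shift)
  also have "\<dots> \<longleftrightarrow> (\<forall>n. X x y n \<le> 0)"
    using x by (metis not0_implies_Suc orb_0(1))
  finally show ?thesis using le_h_iff[OF x y] True by simp
next
  case False
  then show ?thesis using h_le[OF x] by auto
qed

text \<open>If \<open>x < x'\<close>, the point above \<open>x'\<close> on the antidiagonal through \<open>(x, h x)\<close> has the same first coordinate after
  one step and a smaller second one, so it is trapped as well.\<close>

lemma h_plus_mono: assumes "-A < x" "x \<le> x'" shows "x + h x \<le> x' + h x'"
proof -
  consider "x' \<ge> 0" | "x' < 0" "x + h x \<le> x'" | "x' < 0" "x' < x + h x" by linarith
  then show ?thesis
  proof cases
    case 1
    then show ?thesis using h_le[of x] assms by (cases "x \<le> 0") (auto simp: h_0)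
  next
    case 2
    then show ?thesis using h_nonneg[of x'] assms by auto
  next
    case 3
    define y where "y = x + h x - x'"
    have y: "0 \<le> y" "y \<le> h x" "x' + y = x + h x" using 3 assms by (auto simp: y_def)
    have 1: "x + h x \<le> 0 \<and> h x * f (x + h x) \<le> h (x + h x)"
      using h_step_iff[of x "h x"] 3 assms h_nonneg[of x] by auto
    have "y * f (x' + y) \<le> h x * f (x + h x)"
      unfolding y using y f_pos[of "x + h x"] h_nonneg[of x] assms by (intro mult_right_mono) auto
    then have "y * f (x' + y) \<le> h (x' + y)" using 1 y by auto
    then have "y \<le> h x'" using h_step_iff[of x' y] 1 y 3 assms by auto
    then show ?thesis by (simp add: y_def)
  qed
qed

text \<open>\<open>h\<close> is nonincreasing and \<open>x + h x\<close> is nondecreasing, so all difference quotients of \<open>h\<close> lie in \<open>[-1, 0]\<close>.\<close>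

lemma h_lipschitz: "1-lipschitz_on {-A<..} h"
proof (rule lipschitz_onI)
  have *: "\<bar>h x - h x'\<bar> \<le> x' - x" if "-A < x" "x \<le> x'" for x x'
    using h_antimono[OF that] h_plus_mono[OF that] by auto
  fix x y assume "x \<in> {-A<..}" "y \<in> {-A<..}"
  then show "dist (h x) (h y) \<le> 1 * dist x y"
    using *[of x y] *[of y x] by (cases "x \<le> y") (auto simp: dist_real_def abs_minus_commute)
qed auto

lemma h_cont: "continuous_on {-A<..} h"
  using h_lipschitz lipschitz_on_continuous_on by blast

text \<open>Trapping of \<open>(x, h x)\<close> gives one inequality. If it were strict, the intermediate value theorem would produce a
  higher point above \<open>x\<close> whose image lies on the curve, contradicting the maximality of \<open>h x\<close>.\<close>

lemma h_functional:
  assumes x: "-A < x" "x \<le> 0"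
  shows "h (x + h x) = f (x + h x) * h x"
proof -
  \<comment> \<open>\<open>k\<close> measures how far the image of \<open>(x, y)\<close> lies below the curve\<close>
  define k where "k y = h (x + y) - y * f (x + y)" for y
  have le: "0 \<le> k (h x)" using h_step_iff[of x "h x"] h_nonneg[of x] x by (auto simp: k_def)
  have "continuous_on {h x..-x} k"
    unfolding k_def using h_nonneg[OF x(1)] x
    by (intro continuous_intros continuous_on_compose2[OF h_cont] continuous_on_compose2[OF f_cont]) auto
  moreover have "k (-x) \<le> 0" using x by (simp add: k_def h_0 f_0)
  moreover have "h x \<le> -x" using h_le[OF x] by simp
  ultimately obtain y where y: "h x \<le> y" "y \<le> -x" "k y = 0"
    using IVT2'[of k "-x" 0 "h x"] le by auto
  then have "y \<le> h x" using h_step_iff[of x y] h_nonneg[of x] x by (auto simp: k_def)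
  then show ?thesis using y by (simp add: k_def mult.commute)
qed

lemma h_orbit:
  assumes x: "-A < x" "x \<le> 0"
  shows "Y x (h x) n = h (X x (h x) n)"
proof (induction n)
  case (Suc n)
  have "-A < X x (h x) n" using orb_nonneg(1)[of x "h x" n] h_nonneg x by auto
  then have "h (X x (h x) n + h (X x (h x) n)) = f (X x (h x) n + h (X x (h x) n)) * h (X x (h x) n)"
    using h_trapped x by (intro h_functional) auto
  then show ?case using Suc by (simp add: orb_Suc)
qed auto

section \<open>Shape of the critical curve at the fixed point\<close>

text \<open>The region below \<open>(1 - \<epsilon>) x\<^sup>2 / 2\<close> is mapped into itself near the origin: moving by \<open>y\<close> lowers the parabola by
  about \<open>(1 - \<epsilon>) \<bar>x\<bar> y\<close>, whereas \<open>Y\<close> drops by about \<open>\<bar>x\<bar> y\<close>. Points in it are therefore trapped.\<close>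

lemma h_lower:
  assumes "0 < \<epsilon>" "\<epsilon> < 1"
  obtains r where "r > 0" "r < A" "\<And>x. -r < x \<Longrightarrow> x \<le> 0 \<Longrightarrow> (1 - \<epsilon>) * x\<^sup>2 / 2 \<le> h x"
proof -
  obtain C r0 where C: "C \<ge> 1" "r0 > 0" "r0 < 1" "r0 < A"
    and q: "\<And>x. \<bar>x\<bar> \<le> r0 \<Longrightarrow> \<bar>f x - 1 - x\<bar> \<le> C * x\<^sup>2"
    using f_quad_obtain by metis
  define r where "r = min r0 (\<epsilon> / (C + 1/2))"
  have r: "r > 0" "r \<le> r0" "r * (C + 1/2) \<le> \<epsilon>"
  proof -
    have "r * (C + 1/2) \<le> \<epsilon> / (C + 1/2) * (C + 1/2)" using C by (intro mult_right_mono) (auto simp: r_def)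
    then show "r * (C + 1/2) \<le> \<epsilon>" using C by simp
  qed (use C assms in \<open>auto simp: r_def\<close>)
  have step: "-r < u + y \<and> u + y \<le> 0 \<and> y * f (u + y) \<le> (1 - \<epsilon>) * (u + y)\<^sup>2 / 2"
    if u: "-r < u" "u \<le> 0" and y: "0 \<le> y" "y \<le> (1 - \<epsilon>) * u\<^sup>2 / 2" for u y
  proof -
    have "(1 - \<epsilon>) * u\<^sup>2 \<le> 1 * u\<^sup>2" using assms by (intro mult_right_mono) auto
    then have y2: "y \<le> u\<^sup>2 / 2" using y by simp
    have u2: "u\<^sup>2 \<le> r * (-u)" using u 
      using mult_right_mono[of "-u" r "-u"] by (simp add: power2_eq_square)
    have "r * (-u) \<le> -u" using u r C by (intro mult_left_le_one_le) auto
    then have uy: "u + y \<le> 0" using y2 u2 u by linarith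
    have "\<bar>f (u + y) - 1 - (u + y)\<bar> \<le> C * (u + y)\<^sup>2" using u y uy r by (intro q) auto
    moreover have "C * (u + y)\<^sup>2 \<le> C * u\<^sup>2"
      using C uy y u by (intro mult_left_mono abs_le_square_iff[THEN iffD1]) auto
    ultimately have f1: "f (u + y) \<le> 1 + (u + y) + C * u\<^sup>2" by linarith
    have "C * u\<^sup>2 + u\<^sup>2 / 2 = (C + 1/2) * u\<^sup>2" by (simp add: algebra_simps)
    also have "\<dots> \<le> (C + 1/2) * (r * (-u))" using u2 C by (intro mult_left_mono) auto
    also have "\<dots> = (r * (C + 1/2)) * (-u)" by simp
    also have "\<dots> \<le> \<epsilon> * (-u)" using r u by (intro mult_right_mono) auto
    finally have "y + C * u\<^sup>2 \<le> - \<epsilon> * u" using y2 by simp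
    then have "f (u + y) \<le> 1 + (1 - \<epsilon>) * u" using f1 by (simp add: algebra_simps)
    then have "y * f (u + y) \<le> y * (1 + (1 - \<epsilon>) * u)" using y by (intro mult_left_mono) auto
    also have "\<dots> \<le> (1 - \<epsilon>) * u\<^sup>2 / 2 + (1 - \<epsilon>) * u * y" using y by (simp add: algebra_simps)
    also have "\<dots> = (1 - \<epsilon>) * ((u + y)\<^sup>2 - y\<^sup>2) / 2"
      by (simp add: power2_eq_square field_simps)
    also have "\<dots> \<le> (1 - \<epsilon>) * (u + y)\<^sup>2 / 2" using assms by (intro divide_right_mono mult_left_mono) auto
    finally show ?thesis using uy u y by auto
  qed
  show thesis
  proof (rule that[of r])
    fix x assume x: "-r < x" "x \<le> 0"
    define y where "y = (1 - \<epsilon>) * x\<^sup>2 / 2"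
    have y0: "0 \<le> y" using assms by (auto simp: y_def)
    have xA: "-A < x" using x r C by auto
    have "-r < X x y n \<and> X x y n \<le> 0 \<and> Y x y n \<le> (1 - \<epsilon>) * (X x y n)\<^sup>2 / 2" for n
    proof (induction n)
      case (Suc n)
      then show ?case using step[of "X x y n" "Y x y n"] orb_nonneg[OF xA y0] by (auto simp: orb_Suc)
    qed (use x y_def in auto)
    then show "(1 - \<epsilon>) * x\<^sup>2 / 2 \<le> h x"
      using le_h_iff[OF xA x(2) y0] by (auto simp: y_def)
  qed (use r C in auto)
qed

text \<open>Along a trapped orbit the quantity \<open>Y - (1 + \<epsilon>) X\<^sup>2 / 2\<close> is nondecreasing, and \<open>Y\<close> tends to 0; so the initial
  value of this quantity is not positive.\<close>

lemma h_upper: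
  assumes "0 < \<epsilon>"
  obtains r where "r > 0" "r < A" "\<And>x. -r < x \<Longrightarrow> x \<le> 0 \<Longrightarrow> h x \<le> (1 + \<epsilon>) * x\<^sup>2 / 2"
proof -
  obtain C r0 where C: "C \<ge> 1" "r0 > 0" "r0 < 1" "r0 < A"
    and q: "\<And>x. \<bar>x\<bar> \<le> r0 \<Longrightarrow> \<bar>f x - 1 - x\<bar> \<le> C * x\<^sup>2"
    using f_quad_obtain by metis
  define r where "r = min r0 (\<epsilon> / C)"
  have r: "r > 0" "r \<le> r0" "C * r \<le> \<epsilon>" using C assms by (auto simp: r_def min_def field_simps)
  have step: "y - (1 + \<epsilon>) * u\<^sup>2 / 2 \<le> y * f (u + y) - (1 + \<epsilon>) * (u + y)\<^sup>2 / 2"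
    if u: "-r < u" "u + y \<le> 0" "0 \<le> y" for u y
  proof -
    define v where "v = u + y"
    have v: "-r < v" "v \<le> 0" "u \<le> v" "y = v - u" using u by (auto simp: v_def)
    have "\<bar>f v - 1 - v\<bar> \<le> C * v\<^sup>2" using v r by (intro q) auto
    moreover have "C * v\<^sup>2 \<le> \<epsilon> * (-v)"
    proof -
      have "C * v\<^sup>2 = (C * (-v)) * (-v)" by (simp add: power2_eq_square)
      also have "\<dots> \<le> (C * r) * (-v)" using v C by (intro mult_right_mono mult_left_mono) auto
      also have "\<dots> \<le> \<epsilon> * (-v)" using r v by (intro mult_right_mono) auto
      finally show ?thesis .
    qed
    ultimately have f1: "f v \<ge> 1 + (1 + \<epsilon>) * v" by (simp add: algebra_simps)
    have "y * f v \<ge> y * (1 + (1 + \<epsilon>) * v)" using f1 u by (intro mult_left_mono) auto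
    moreover have "y * v = (v\<^sup>2 - u\<^sup>2 + y\<^sup>2) / 2" by (simp add: v(4) power2_eq_square algebra_simps)
    then have "y * v \<ge> (v\<^sup>2 - u\<^sup>2) / 2" by simp
    then have "(1 + \<epsilon>) * (y * v) \<ge> (1 + \<epsilon>) * ((v\<^sup>2 - u\<^sup>2) / 2)" using assms by (intro mult_left_mono) auto
    ultimately show ?thesis unfolding v_def[symmetric] by (simp add: field_simps)
  qed
  show thesis
  proof (rule that[of r])
    fix x assume x: "-r < x" "x \<le> 0"
    define y where "y = h x"
    have xA: "-A < x" using x r C by auto
    have y0: "0 \<le> y" using h_nonneg[OF xA] by (simp add: y_def)
    have tr: "X x y n \<le> 0" for n using h_trapped[OF xA x(2)] by (simp add: y_def)
    obtain l where l: "Y x y \<longlonglongrightarrow> 0" using trapped_orbit_converges[OF xA y0 tr] by auto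
    have *: "y - (1 + \<epsilon>) * x\<^sup>2 / 2 \<le> Y x y n - (1 + \<epsilon>) * (X x y n)\<^sup>2 / 2" for n
    proof (induction n)
      case (Suc n)
      have "X x y n + Y x y n \<le> 0" using tr[of "Suc n"] by (simp add: orb_Suc)
      then show ?case using step[of "X x y n" "Y x y n"] orb_nonneg[OF xA y0, of n] Suc x
        by (simp add: orb_Suc)
    qed auto
    have "y - (1 + \<epsilon>) * x\<^sup>2 / 2 \<le> Y x y n" for n
    proof -
      have "0 \<le> (1 + \<epsilon>) * (X x y n)\<^sup>2 / 2" using assms by auto
      then show ?thesis using *[of n] by linarith
    qed
    then have "y - (1 + \<epsilon>) * x\<^sup>2 / 2 \<le> 0" using LIMSEQ_le_const[OF l] by blast
    then show "h x \<le> (1 + \<epsilon>) * x\<^sup>2 / 2" by (simp add: y_def)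
  qed (use r C in auto)
qed

lemma h_near_0:
  assumes "0 < \<epsilon>" "\<epsilon> < 1"
  obtains r where "r > 0" "r < A" "\<And>x. -r < x \<Longrightarrow> x \<le> 0 \<Longrightarrow> \<bar>h x - x\<^sup>2 / 2\<bar> \<le> \<epsilon> * x\<^sup>2 / 2"
proof -
  obtain r where r: "r > 0" "r < A" "\<And>x. -r < x \<Longrightarrow> x \<le> 0 \<Longrightarrow> (1 - \<epsilon>) * x\<^sup>2 / 2 \<le> h x"
    using h_lower[OF assms] by auto
  obtain r' where r': "r' > 0" "r' < A" "\<And>x. -r' < x \<Longrightarrow> x \<le> 0 \<Longrightarrow> h x \<le> (1 + \<epsilon>) * x\<^sup>2 / 2"
    using h_upper[OF assms(1)] by auto
  show thesis
  proof (rule that[of "min r r'"])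
    fix x assume "- min r r' < x" "x \<le> 0"
    then have "(1 - \<epsilon>) * x\<^sup>2 / 2 \<le> h x" "h x \<le> (1 + \<epsilon>) * x\<^sup>2 / 2" using r(3) r'(3) by auto
    then show "\<bar>h x - x\<^sup>2 / 2\<bar> \<le> \<epsilon> * x\<^sup>2 / 2" by (auto simp: field_simps abs_if)
  qed (use r r' in auto)
qed

lemma h_asymp: "h \<sim>[at_left 0] (\<lambda>x. x\<^sup>2 / 2)"
proof (rule asymp_equivI')
  show "((\<lambda>x. h x / (x\<^sup>2 / 2)) \<longlongrightarrow> 1) (at_left 0)"
  proof (rule tendstoI)
    fix e :: real assume e: "0 < e"
    define \<epsilon> where "\<epsilon> = min (e / 2) (1 / 2)"
    have \<epsilon>: "0 < \<epsilon>" "\<epsilon> < 1" using e by (auto simp: \<epsilon>_def)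
    obtain r where r: "r > 0" "\<And>x. -r < x \<Longrightarrow> x \<le> 0 \<Longrightarrow> \<bar>h x - x\<^sup>2 / 2\<bar> \<le> \<epsilon> * x\<^sup>2 / 2"
      using h_near_0[OF \<epsilon>] by blast
    have "\<forall>\<^sub>F x in at_left 0. x \<in> {-r<..<0}" using r by (intro eventually_at_leftI[of "-r"]) auto
    then show "\<forall>\<^sub>F x in at_left 0. dist (h x / (x\<^sup>2 / 2)) 1 < e"
    proof eventually_elim
      case (elim x)
      have p: "x\<^sup>2 / 2 > 0" using elim by auto
      have "\<bar>h x / (x\<^sup>2 / 2) - 1\<bar> = \<bar>h x - x\<^sup>2 / 2\<bar> / (x\<^sup>2 / 2)"
      proof -
        have "h x / (x\<^sup>2 / 2) - 1 = (h x - x\<^sup>2 / 2) / (x\<^sup>2 / 2)" using p by (simp add: diff_divide_distrib)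
        then show ?thesis using abs_of_pos[OF p] by (simp only: abs_divide)
      qed
      also have "\<dots> \<le> \<epsilon>" using r(2)[of x] elim p by (simp add: field_simps)
      also have "\<dots> < e" using e by (auto simp: \<epsilon>_def)
      finally show ?case by (simp add: dist_real_def)
    qed
  qed
qed

text \<open>Monotonicity propagates the positivity that \<open>h_lower\<close> gives near the origin.\<close>

lemma h_pos: assumes "-A < x" "x < 0" shows "0 < h x"
proof -
  obtain r where r: "r > 0" "r < A" "\<And>x. -r < x \<Longrightarrow> x \<le> 0 \<Longrightarrow> (1 - 1/2) * x\<^sup>2 / 2 \<le> h x"
    using h_lower[of "1/2"] by auto
  define u where "u = max x (-r/2)"
  have u: "u < 0" "-r < u" "x \<le> u" using assms r by (auto simp: u_def)
  have "0 < (1 - 1/2) * u\<^sup>2 / 2" using u by simp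
  also have "\<dots> \<le> h u" using r(3)[of u] u by auto
  also have "\<dots> \<le> h x" using h_antimono[of x u] u assms by auto
  finally show ?thesis .
qed

section \<open>Uniqueness of the critical curve\<close>

text \<open>The limit of an orbit on a continuous invariant curve is a zero of the curve. A nonnegative nonincreasing
  curve that is nonzero just to the left of the origin has no zero there except the origin itself.\<close>

lemma invariant_curve_orbit:
  assumes x: "-A < x" "x \<le> 0"
    and g0: "\<And>x. -A < x \<Longrightarrow> 0 \<le> g x"
    and anti: "\<And>x x'. -A < x \<Longrightarrow> x \<le> x' \<Longrightarrow> g x' \<le> g x"
    and cont: "continuous_on {-A<..} g"
    and van: "\<And>x. x \<ge> 0 \<Longrightarrow> g x = 0"
    and func: "\<And>x. -A < x \<Longrightarrow> x \<le> 0 \<Longrightarrow> g (x + g x) = f (x + g x) * g x"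
    and pos: "\<forall>\<^sub>F x in at_left 0. g x \<noteq> 0"
  shows "X x (g x) n \<le> 0" "X x (g x) \<longlonglongrightarrow> 0"
proof -
  have gle: "u + g u \<le> 0" if u: "-A < u" "u \<le> 0" for u
  proof (rule ccontr)
    assume "\<not> u + g u \<le> 0"
    then have p: "u + g u > 0" by simp
    then have "f (u + g u) * g u = 0" using func[OF u] van[of "u + g u"] by auto
    moreover have "f (u + g u) > 0" using f_pos p A_pos by auto
    ultimately show False using p u by auto
  qed
  have y0: "0 \<le> g x" using g0 x by auto
  have *: "X x (g x) n \<le> 0 \<and> Y x (g x) n = g (X x (g x) n)" for n
  proof (induction n)
    case (Suc n)
    have "-A < X x (g x) n" using orb_nonneg(1)[OF x(1) y0, of n] x by auto
    then show ?case using Suc gle[of "X x (g x) n"] func[of "X x (g x) n"] by (auto simp: orb_Suc)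
  qed (use x in auto)
  then show tr: "X x (g x) n \<le> 0" for n by auto
  obtain l where l: "X x (g x) \<longlonglongrightarrow> l" "x \<le> l" "l \<le> 0" "Y x (g x) \<longlonglongrightarrow> 0"
    using trapped_orbit_converges[OF x(1) y0 tr] by metis
  have "isCont g l" using cont l x by (auto simp: continuous_on_eq_continuous_at)
  then have "(\<lambda>n. g (X x (g x) n)) \<longlonglongrightarrow> g l" using l(1) isCont_tendsto_compose by blast
  moreover have "(\<lambda>n. g (X x (g x) n)) = Y x (g x)" using * by auto
  then have "(\<lambda>n. g (X x (g x) n)) \<longlonglongrightarrow> 0" using l(4) by simp
  ultimately have gl: "g l = 0" using LIMSEQ_unique by blast
  have "l = 0"
  proof (rule ccontr)
    assume "l \<noteq> 0"
    then have "\<forall>\<^sub>F u in at_left 0. u \<in> {l<..<0}" using l by (intro eventually_at_leftI[of l]) auto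
    then have "\<forall>\<^sub>F u :: real in at_left 0. False"
      using pos
    proof eventually_elim
      case (elim u)
      have "g u \<le> g l" using elim l x by (intro anti) auto
      moreover have "0 \<le> g u" using elim l x by (intro g0) auto
      ultimately show False using gl elim by auto
    qed
    then show False by simp
  qed
  then show "X x (g x) \<longlonglongrightarrow> 0" using l(1) by simp
qed

lemma h_orbit_tendsto:
  assumes "-A < x" "x \<le> 0" shows "X x (h x) \<longlonglongrightarrow> 0"
proof (rule invariant_curve_orbit(2)[OF assms])
  have "\<forall>\<^sub>F x in at_left 0. x \<in> {-A<..<0}" using A_pos by (intro eventually_at_leftI[of "-A"]) auto
  then show "\<forall>\<^sub>F x in at_left 0. h x \<noteq> 0" by eventually_elim (use h_pos in force)
qed (use h_nonneg h_antimono h_cont h_0 h_functional in auto)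

text \<open>Any such curve lies below \<open>h\<close>, its orbits being trapped. The orbits of \<open>(x, g x)\<close> and \<open>(x, h x)\<close> stay on the
  left of 0 at horizontal distance at least \<open>h x - g x\<close>, while the first of them tends to 0.\<close>

lemma invariant_curve_unique:
  assumes x: "-A < x" "x \<le> 0"
    and g0: "\<And>x. -A < x \<Longrightarrow> 0 \<le> g x"
    and anti: "\<And>x x'. -A < x \<Longrightarrow> x \<le> x' \<Longrightarrow> g x' \<le> g x"
    and cont: "continuous_on {-A<..} g"
    and van: "\<And>x. x \<ge> 0 \<Longrightarrow> g x = 0"
    and func: "\<And>x. -A < x \<Longrightarrow> x \<le> 0 \<Longrightarrow> g (x + g x) = f (x + g x) * g x"
    and pos: "\<forall>\<^sub>F x in at_left 0. g x \<noteq> 0"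
  shows "g x = h x"
proof -
  note 1 = invariant_curve_orbit[OF assms]
  have le: "g x \<le> h x" using le_h_iff[of x "g x"] x g0 1(1) by auto
  have "h x - g x \<le> - X x (g x) (Suc n)" for n
    using orbX_gap_incr[of x "g x" "h x" n] h_trapped[OF x, of "Suc n"] le x g0 by force
  moreover have "(\<lambda>n. - X x (g x) (Suc n)) \<longlonglongrightarrow> 0"
    using tendsto_minus[OF LIMSEQ_Suc[OF 1(2)]] by simp
  ultimately have "h x - g x \<le> 0" using LIMSEQ_le_const by blast
  then show ?thesis using le by simp
qed

end

context parabolic_map begin

section \<open>Energy of slightly supercritical orbits\<close>

text \<open>The first integral of the flow \<open>dX = Y ds\<close>, \<open>dY = X Y ds\<close>, which approximates the map near the origin.\<close>

definition energy :: "real \<Rightarrow> real \<Rightarrow> nat \<Rightarrow> real" where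
  "energy x y n = Y x y n - (X x y n)\<^sup>2 / 2"

lemma f_deriv_nonneg:
  assumes "-A < x" "(f has_real_derivative D) (at x)" shows "0 \<le> D"
proof (rule mono_on_imp_deriv_nonneg)
  show "mono_on {-A<..} f" using f_mono by (rule strict_mono_on_imp_mono_on)
qed (use assms in \<open>auto simp: interior_open\<close>)

text \<open>The signs come from monotonicity: raising the starting point raises the whole orbit.\<close>

lemma orbit_has_derivative:
  assumes "-A < x" "0 < y"
  shows "\<exists>a b. ((\<lambda>y. X x y n) has_real_derivative a) (at y) \<and>
               ((\<lambda>y. Y x y n) has_real_derivative b) (at y) \<and> 0 \<le> a \<and> 0 < b"
proof (induction n)
  case 0
  have "((\<lambda>y. X x y 0) has_real_derivative 0) (at y)" "((\<lambda>y. Y x y 0) has_real_derivative 1) (at y)"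
    by (auto intro!: derivative_eq_intros)
  then show ?case by (intro exI[of _ 0] exI[of _ 1]) simp
next
  case (Suc n)
  then obtain a b where ab: "((\<lambda>y. X x y n) has_real_derivative a) (at y)"
    "((\<lambda>y. Y x y n) has_real_derivative b) (at y)" "0 \<le> a" "0 < b" by auto
  define u where "u = X x y n + Y x y n"
  have u: "-A < u" using orb_nonneg[of x y n] assms by (auto simp: u_def)
  obtain D where D: "(f has_real_derivative D) (at u)" using f_diff u by auto
  have D0: "0 \<le> D" using f_deriv_nonneg[OF u D] .
  have 1: "((\<lambda>y. X x y n + Y x y n) has_real_derivative a + b) (at y)"
    using ab by (auto intro!: derivative_eq_intros)
  have 2: "((\<lambda>y. f (X x y n + Y x y n)) has_real_derivative D * (a + b)) (at y)"
    using DERIV_chain2[OF _ 1, of f D] D by (simp add: u_def)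
  have 3: "((\<lambda>y. Y x y n * f (X x y n + Y x y n)) has_real_derivative
      b * f u + D * (a + b) * Y x y n) (at y)"
    using DERIV_mult[OF ab(2) 2] by (simp add: u_def)
  have "0 < b * f u + D * (a + b) * Y x y n"
    using ab D0 f_pos[OF u] orb_nonneg(2)[of x y n] assms by (intro add_pos_nonneg) auto
  then show ?case using 1 3 ab(3,4) by (intro exI[of _ "a + b"] exI[of _ "b * f u + D * (a + b) * Y x y n"])
      (auto simp: orb_Suc)
qed

lemma energy_has_derivative:
  assumes "-A < x" "0 < y" "X x y n \<le> 0"
  shows "\<exists>c>0. ((\<lambda>y. energy x y n) has_real_derivative c) (at y)"
proof -
  obtain a b where ab: "((\<lambda>y. X x y n) has_real_derivative a) (at y)"
    "((\<lambda>y. Y x y n) has_real_derivative b) (at y)" "0 \<le> a" "0 < b"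
    using orbit_has_derivative[OF assms(1,2)] by blast
  have "((\<lambda>y. energy x y n) has_real_derivative (b - X x y n * a)) (at y)"
    unfolding energy_def using ab by (auto intro!: derivative_eq_intros)
  moreover have "X x y n * a \<le> 0" using ab assms by (intro mult_nonpos_nonneg) auto
  then have "0 < b - X x y n * a" using ab by linarith
  ultimately show ?thesis by blast
qed

text \<open>For ordered points on the left of 0 both contributions to the energy gap are nonnegative, so it controls the
  gap in \<open>Y\<close> as well as the product of the gap in \<open>X\<close> with the distance of the lower point from 0.\<close>

lemma energy_gap_ge:
  fixes X1 X2 Y1 Y2 :: real
  assumes "X2 \<le> X1" "X1 \<le> 0" "Y2 \<le> Y1"
  defines "e \<equiv> (Y1 - X1\<^sup>2 / 2) - (Y2 - X2\<^sup>2 / 2)"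
  shows "Y1 - Y2 \<le> e" "(X1 - X2) * (-X2) \<le> 2 * e"
proof -
  have eq: "e = (Y1 - Y2) + (X1 - X2) * (- X1 - X2) / 2"
    by (simp add: e_def power2_eq_square field_simps)
  have "0 \<le> (X1 - X2) * (- X1 - X2)" using assms by (intro mult_nonneg_nonneg) auto
  then show "Y1 - Y2 \<le> e" using eq by simp
  have "(X1 - X2) * (-X2) \<le> (X1 - X2) * (- X1 - X2)" using assms by (intro mult_left_mono) auto
  then show "(X1 - X2) * (-X2) \<le> 2 * e" using eq assms by linarith
qed

text \<open>Writing \<open>f u = 1 + u + r u\<close>, one step changes the energy by \<open>Y\<^sup>2 / 2 + Y r(X + Y)\<close>. Comparing this for two
  points, each term contains the energy gap as a factor by \<open>energy_gap_ge\<close>, and \<open>Y\<^sub>1\<close> as a further factor,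
  because \<open>X\<^sub>2\<^sup>2 \<le> 4 Y\<^sub>2\<close> turns the squares of \<open>X\<^sub>2\<close> into multiples of \<open>Y\<^sub>1\<close>.\<close>

lemma energy_gap_step:
  fixes X1 X2 Y1 Y2 :: real
  assumes C: "C \<ge> 1" and r: "r < 1"
    and q: "\<And>x y. \<bar>x\<bar> \<le> r \<Longrightarrow> \<bar>y\<bar> \<le> r \<Longrightarrow> \<bar>f x - f y - (x - y)\<bar> \<le> C * max \<bar>x\<bar> \<bar>y\<bar> * \<bar>x - y\<bar>"
    and q2: "\<And>x. \<bar>x\<bar> \<le> r \<Longrightarrow> \<bar>f x - 1 - x\<bar> \<le> C * x\<^sup>2"
    and X: "-r < X2" "X2 \<le> X1" "X1 + Y1 \<le> 0" and Y: "0 \<le> Y2" "Y2 \<le> Y1" "X2\<^sup>2 \<le> 4 * Y2"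
  defines "e \<equiv> (Y1 - X1\<^sup>2 / 2) - (Y2 - X2\<^sup>2 / 2)"
  defines "e' \<equiv> (Y1 * f (X1 + Y1) - (X1 + Y1)\<^sup>2 / 2) - (Y2 * f (X2 + Y2) - (X2 + Y2)\<^sup>2 / 2)"
  shows "\<bar>e' - e\<bar> \<le> (1 + 7 * C) * Y1 * e"
proof -
  define a b U1 U2 where "a = X1 - X2" and "b = Y1 - Y2" and "U1 = X1 + Y1" and "U2 = X2 + Y2"
  define r1 r2 where "r1 = f U1 - 1 - U1" and "r2 = f U2 - 1 - U2"
  have nn: "0 \<le> a" "0 \<le> b" "X1 \<le> 0" "X2 \<le> 0" "X2 \<le> U2" "U2 \<le> U1" "U1 \<le> 0" "\<bar>U1\<bar> \<le> r" "\<bar>U2\<bar> \<le> r"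
    using X Y by (auto simp: a_def b_def U1_def U2_def)
  have e1: "b \<le> e" and e2: "a * (-X2) \<le> 2 * e"
    using energy_gap_ge[of X2 X1 Y2 Y1] nn X Y by (auto simp: a_def b_def e_def)
  have fU: "f U1 = r1 + 1 + U1" "f U2 = r2 + 1 + U2" by (auto simp: r1_def r2_def)
  have "e' = (Y1 * (r1 + 1 + U1) - U1\<^sup>2 / 2) - (Y2 * (r2 + 1 + U2) - U2\<^sup>2 / 2)"
    unfolding e'_def U1_def[symmetric] U2_def[symmetric] fU ..
  then have eq: "e' - e = (Y1 + Y2) / 2 * b + b * r1 + Y2 * (r1 - r2)"
    by (simp add: e_def b_def U1_def U2_def power2_eq_square field_simps)
  have "\<bar>r1\<bar> \<le> C * U1\<^sup>2" using q2[of U1] nn by (simp add: r1_def)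
  also have "\<dots> \<le> C * X2\<^sup>2" using nn C by (intro mult_left_mono abs_le_square_iff[THEN iffD1]) auto
  also have "\<dots> \<le> C * (4 * Y1)" using Y C by (intro mult_left_mono) auto
  finally have r1: "\<bar>r1\<bar> \<le> 4 * C * Y1" by simp
  have "\<bar>r1 - r2\<bar> \<le> C * max \<bar>U1\<bar> \<bar>U2\<bar> * \<bar>U1 - U2\<bar>" using q[of U1 U2] nn by (simp add: r1_def r2_def algebra_simps)
  also have "\<dots> \<le> C * (-X2) * \<bar>U1 - U2\<bar>" using nn C by (intro mult_right_mono mult_left_mono) auto
  also have "\<dots> = C * ((a + b) * (-X2))" using nn by (simp add: U1_def U2_def a_def b_def)
  also have "\<dots> \<le> C * (3 * e)"
  proof -
    have "b * (-X2) \<le> b * 1" using nn X r by (intro mult_left_mono) auto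
    then have "(a + b) * (-X2) \<le> 3 * e" using e1 e2 by (simp add: algebra_simps)
    then show ?thesis using C by (intro mult_left_mono) auto
  qed
  finally have r12: "\<bar>r1 - r2\<bar> \<le> 3 * C * e" by simp
  have t1: "\<bar>(Y1 + Y2) / 2 * b\<bar> \<le> Y1 * e"
  proof -
    have "(Y1 + Y2) / 2 * b \<le> Y1 * e" using nn Y e1 by (intro mult_mono) auto
    moreover have "0 \<le> (Y1 + Y2) / 2 * b" using nn Y by (intro mult_nonneg_nonneg) auto
    ultimately show ?thesis by simp
  qed
  have t2: "\<bar>b * r1\<bar> \<le> e * (4 * C * Y1)"
    unfolding abs_mult using nn e1 r1 by (intro mult_mono) auto
  have t3: "\<bar>Y2 * (r1 - r2)\<bar> \<le> Y1 * (3 * C * e)"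
    unfolding abs_mult using Y r12 by (intro mult_mono) auto
  have "\<bar>e' - e\<bar> \<le> Y1 * e + e * (4 * C * Y1) + Y1 * (3 * C * e)" using eq t1 t2 t3 by linarith
  then show ?thesis by (simp add: algebra_simps)
qed

text \<open>Iterating \<open>energy_gap_step\<close>: the factors \<open>1 \<plusminus> K Y\<close> multiply to something between \<open>1 - K s\<close> and
  \<open>1 / (1 - K s)\<close>, where \<open>s\<close> is the sum of the steps \<open>Y\<close>. The orbit stays to the left of 0, so \<open>s\<close> is at most the
  distance of the critical orbit from 0 at time \<open>M\<close>, uniformly in \<open>n\<close> and in the perturbation.\<close>

lemma energy_gap_bounds:
  obtains K \<rho> where "K > 0" "\<rho> > 0" "\<rho> < 1" "K * \<rho> \<le> 1 / 2"
    "\<And>x y M n. \<lbrakk>-A < x; x \<le> 0; h x \<le> y; -\<rho> < X x (h x) M; M \<le> n; X x y n \<le> 0\<rbrakk> \<Longrightarrow>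
       (1 - K * - X x (h x) M) * (energy x y M - energy x (h x) M) \<le> energy x y n - energy x (h x) n \<and>
       (1 - K * - X x (h x) M) * (energy x y n - energy x (h x) n) \<le> energy x y M - energy x (h x) M"
proof -
  obtain C r0 where C: "C \<ge> 1" "r0 > 0" "r0 < 1" "r0 < A"
    and q: "\<And>x y. \<bar>x\<bar> \<le> r0 \<Longrightarrow> \<bar>y\<bar> \<le> r0 \<Longrightarrow> \<bar>f x - f y - (x - y)\<bar> \<le> C * max \<bar>x\<bar> \<bar>y\<bar> * \<bar>x - y\<bar>"
    and q2: "\<And>x. \<bar>x\<bar> \<le> r0 \<Longrightarrow> \<bar>f x - 1 - x\<bar> \<le> C * x\<^sup>2"
    using f_quad_obtain by metis
  obtain r1 where r1: "r1 > 0" "r1 < A" "\<And>x. -r1 < x \<Longrightarrow> x \<le> 0 \<Longrightarrow> (1 - 1/2) * x\<^sup>2 / 2 \<le> h x"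
    using h_lower[of "1/2"] by auto
  define K where "K = 1 + 7 * C"
  define \<rho> where "\<rho> = min (min r0 r1) (1 / (2 * K))"
  have K: "K > 0" using C by (simp add: K_def)
  have \<rho>: "\<rho> > 0" "\<rho> \<le> r0" "\<rho> \<le> r1" using C r1 K by (auto simp: \<rho>_def)
  have K\<rho>: "K * \<rho> \<le> 1 / 2"
  proof -
    have "K * \<rho> \<le> K * (1 / (2 * K))" using K by (intro mult_left_mono) (auto simp: \<rho>_def)
    then show ?thesis using K by simp
  qed
  show thesis
  proof (rule that[OF K \<rho>(1) _ K\<rho>])
    show "\<rho> < 1" using \<rho> C by auto
    fix x y M n
    assume x: "-A < x" "x \<le> 0" and y: "h x \<le> y" and M: "-\<rho> < X x (h x) M" "M \<le> n" and n: "X x y n \<le> 0"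
    define e where "e n = energy x y n - energy x (h x) n" for n
    have y0: "0 \<le> h x" "0 \<le> y" using h_nonneg[OF x(1)] y by auto
    have ord: "X x (h x) k \<le> X x y k" "Y x (h x) k \<le> Y x y k" for k
      using orb_mono[OF x(1) y0(1) _ y] by auto
    have Ynn: "0 \<le> Y x (h x) k" for k using orb_nonneg x y0 by auto
    have epos: "0 \<le> e k" if "X x y k \<le> 0" for k
      using energy_gap_ge(1)[OF ord(1) that ord(2)] ord(2)[of k] by (simp add: e_def energy_def)
    have "(1 - K * (X x y n - X x y M)) * e M \<le> e n \<and> (1 - K * (X x y n - X x y M)) * e n \<le> e M"
      using M(2) n
    proof (induction n rule: dec_induct)
      case (step n)
      define s z where "s = X x y n - X x y M" and "z = Y x y n"
      have z: "0 \<le> z" using orb_nonneg x y0 by (auto simp: z_def)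
      have neg: "X x y n \<le> 0" using step.prems z by (simp add: orb_Suc z_def)
      have s: "0 \<le> s" using orbX_incr[OF x(1) y0(2) step.hyps(1)] by (simp add: s_def)
      have sz: "s + z = X x y (Suc n) - X x y M" by (simp add: s_def z_def orb_Suc)
      have "s + z \<le> \<rho>" using sz step.prems M(1) ord(1)[of M] by linarith
      then have "K * (s + z) \<le> K * \<rho>" using K by (intro mult_left_mono) auto
      then have Ksz: "K * s + K * z \<le> 1 / 2" using K\<rho> by (simp add: algebra_simps)
      have Kz: "0 \<le> K * z" "0 \<le> K * s" using K z s by auto
      have IH: "(1 - K * s) * e M \<le> e n" "(1 - K * s) * e n \<le> e M" using step.IH neg by (auto simp: s_def)
      have X2: "-\<rho> < X x (h x) n" using M(1) orbX_incr[OF x(1) y0(1) step.hyps(1)] by linarith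
      have "\<bar>e (Suc n) - e n\<bar> \<le> (1 + 7 * C) * z * e n"
        unfolding e_def energy_def z_def orb_Suc
      proof (rule energy_gap_step[OF C(1,3) q q2])
        have "(1 - 1/2) * (X x (h x) n)\<^sup>2 / 2 \<le> h (X x (h x) n)"
          using X2 \<rho> h_trapped[OF x] by (intro r1) auto
        then show "(X x (h x) n)\<^sup>2 \<le> 4 * Y x (h x) n" using h_orbit[OF x, of n] by simp
      qed (use X2 \<rho> ord Ynn step.prems in \<open>auto simp: orb_Suc\<close>)
      then have "\<bar>e (Suc n) - e n\<bar> \<le> K * z * e n" by (simp add: K_def)
      then have st: "(1 - K * z) * e n \<le> e (Suc n)" "e (Suc n) \<le> (1 + K * z) * e n"
        by (auto simp: algebra_simps abs_le_iff)
      have eM: "0 \<le> e M" "0 \<le> e n" using epos neg s by (auto simp: s_def)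
      have "(1 - K * (s + z)) * e M \<le> ((1 - K * z) * (1 - K * s)) * e M"
        using mult_nonneg_nonneg[OF Kz] eM by (intro mult_right_mono) (auto simp: algebra_simps)
      also have "\<dots> = (1 - K * z) * ((1 - K * s) * e M)" by simp
      also have "\<dots> \<le> (1 - K * z) * e n" using IH Ksz Kz by (intro mult_left_mono) auto
      also have "\<dots> \<le> e (Suc n)" by (rule st)
      finally have A1: "(1 - K * (s + z)) * e M \<le> e (Suc n)" .
      have "(1 - K * (s + z)) * e (Suc n) \<le> (1 - K * (s + z)) * ((1 + K * z) * e n)"
        using st Ksz by (intro mult_left_mono) (auto simp: algebra_simps)
      also have "\<dots> = ((1 - K * (s + z)) * (1 + K * z)) * e n" by simp
      also have "\<dots> \<le> (1 - K * s) * e n"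
      proof (intro mult_right_mono eM)
        have "(1 - K * (s + z)) * (1 + K * z) = (1 - K * s) - (K * s) * (K * z) - (K * z) * (K * z)"
          by (simp add: algebra_simps)
        moreover have "0 \<le> (K * s) * (K * z)" "0 \<le> (K * z) * (K * z)" using Kz by auto
        ultimately show "(1 - K * (s + z)) * (1 + K * z) \<le> 1 - K * s" by linarith
      qed
      also have "\<dots> \<le> e M" by (rule IH)
      finally show ?case using A1 sz by simp
    qed auto
    moreover have "1 - K * - X x (h x) M \<le> 1 - K * (X x y n - X x y M)"
    proof -
      have "K * (X x y n - X x y M) \<le> K * - X x (h x) M" using K n ord(1)[of M] by (intro mult_left_mono) auto
      then show ?thesis by linarith
    qed
    moreover have "0 \<le> e n" "0 \<le> e M" using epos n orbX_incr[OF x(1) y0(2) M(2)] by force+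
    ultimately show "(1 - K * - X x (h x) M) * (energy x y M - energy x (h x) M) \<le> energy x y n - energy x (h x) n \<and>
       (1 - K * - X x (h x) M) * (energy x y n - energy x (h x) n) \<le> energy x y M - energy x (h x) M"
      unfolding e_def[symmetric] by (meson mult_right_mono order_trans)
  qed
qed

text \<open>If a critical orbit were at \<open>X = 0\<close>, its \<open>Y\<close> would be \<open>h 0 = 0\<close>; but \<open>Y\<close> stays positive.\<close>

lemma h_orbit_neg:
  assumes "-A < x" "x < 0" shows "X x (h x) n < 0"
proof -
  have "0 < Y x (h x) n" using orbY_pos h_pos assms by auto
  then have "X x (h x) n \<noteq> 0" using h_orbit[of x n] assms h_0[of 0] by auto
  then show ?thesis using h_trapped[of x n] assms by auto
qed

text \<open>The energy gap equals \<open>c d\<close> up to factors near 1, at all times after \<open>M\<close> at which the perturbed orbit is still on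
  the left of 0. Each passage to a limit contributes one power of \<open>1 - t\<close> or \<open>1 + t\<close>.\<close>

abbreviation gains_energy :: "real \<Rightarrow> real \<Rightarrow> real \<Rightarrow> nat \<Rightarrow> real \<Rightarrow> bool" where
  "gains_energy t c x M d \<equiv> \<forall>n\<ge>M. X x (h x + d) n \<le> 0 \<longrightarrow>
     (1 - t) ^ 3 * (c * d) \<le> energy x (h x + d) n - energy x (h x) n \<and>
     (1 - t)\<^sup>2 * (energy x (h x + d) n - energy x (h x) n) \<le> (1 + t) * (c * d)"

text \<open>After a fixed number of steps the energy gained is \<open>c\<^sub>n d\<close> to first order, by differentiability. By
  \<open>energy_gap_bounds\<close> the numbers \<open>c\<^sub>n\<close> agree up to factors that tend to 1; a limit point \<open>c\<close> of the sequence
  then serves for all large times simultaneously.\<close>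

lemma energy_gain:
  assumes x: "-A < x" "x < 0"
  obtains c where "c > 0"
    "\<And>t. 0 < t \<Longrightarrow> t < 1 \<Longrightarrow> \<exists>M0. \<forall>M\<ge>M0. \<forall>\<^sub>F d in at_right 0.
        X x (h x + d) M \<le> X x (h x) M / 2 \<and>
        gains_energy t c x M d"
proof -
  define u where "u n = - X x (h x) n" for n
  have x': "-A < x" "x \<le> 0" using x by auto
  have y0: "0 < h x" using h_pos x by auto
  have u: "0 < u n" for n using h_orbit_neg[OF x] by (simp add: u_def)
  have ulim: "u \<longlonglongrightarrow> 0" using tendsto_minus[OF h_orbit_tendsto[OF x']] by (simp add: u_def[abs_def])
  obtain K \<rho> where K: "K > 0" "\<rho> > 0" "\<rho> < 1" "K * \<rho> \<le> 1 / 2"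
    and B: "\<And>x y M n. \<lbrakk>-A < x; x \<le> 0; h x \<le> y; -\<rho> < X x (h x) M; M \<le> n; X x y n \<le> 0\<rbrakk> \<Longrightarrow>
       (1 - K * - X x (h x) M) * (energy x y M - energy x (h x) M) \<le> energy x y n - energy x (h x) n \<and>
       (1 - K * - X x (h x) M) * (energy x y n - energy x (h x) n) \<le> energy x y M - energy x (h x) M"
    using energy_gap_bounds by blast
  have "\<exists>c. c > 0 \<and> ((\<lambda>y. energy x y n) has_real_derivative c) (at (h x))" for n
    using energy_has_derivative[of x "h x" n] x y0 h_trapped[OF x'] by auto
  then obtain c where c: "\<And>n. c n > 0" "\<And>n. ((\<lambda>y. energy x y n) has_real_derivative c n) (at (h x))"
    by metis
  define e where "e d n = energy x (h x + d) n - energy x (h x) n" for d n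
  have elim: "((\<lambda>d. e d n / d) \<longlongrightarrow> c n) (at_right 0)" for n
    using c(2)[of n] unfolding DERIV_def e_def by (rule filterlim_at_split[THEN iffD1, THEN conjunct2])
  have neg: "\<forall>\<^sub>F d in at_right 0. X x (h x + d) n < X x (h x) n / 2" for n
  proof -
    obtain a where "((\<lambda>y. X x y n) has_real_derivative a) (at (h x))"
      using orbit_has_derivative[OF x(1) y0] by blast
    then have "((\<lambda>d. X x (h x + d) n) \<longlongrightarrow> X x (h x) n) (at 0)"
      using DERIV_isCont[unfolded isCont_def] LIM_offset_zero by blast
    then have "((\<lambda>d. X x (h x + d) n) \<longlongrightarrow> X x (h x) n) (at_right 0)"
      by (rule filterlim_at_split[THEN iffD1, THEN conjunct2])
    moreover have "X x (h x) n < X x (h x) n / 2" using h_orbit_neg[OF x, of n] by simp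
    ultimately show ?thesis by (rule order_tendstoD)
  qed
  have neg0: "\<forall>\<^sub>F d in at_right 0. X x (h x + d) n \<le> 0" for n
    using neg[of n] by eventually_elim (use h_orbit_neg[OF x, of n] in linarith)
  have comp: "(1 - K * u M) * c M \<le> c n \<and> (1 - K * u M) * c n \<le> c M" if M: "u M < \<rho>" "M \<le> n" for M n
  proof
    have ev: "\<forall>\<^sub>F d in at_right 0. (1 - K * u M) * (e d M / d) \<le> e d n / d \<and> (1 - K * u M) * (e d n / d) \<le> e d M / d"
      using neg0[of n] eventually_at_right_less[of 0]
    proof eventually_elim
      case (elim d)
      have "(1 - K * u M) * e d M \<le> e d n \<and> (1 - K * u M) * e d n \<le> e d M"
        using B[OF x', of "h x + d" M n] elim M by (auto simp: e_def u_def)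
      then have "(1 - K * u M) * e d M / d \<le> e d n / d" "(1 - K * u M) * e d n / d \<le> e d M / d"
        using elim by (auto intro!: divide_right_mono)
      then show ?case by simp
    qed
    show "(1 - K * u M) * c M \<le> c n"
      by (rule tendsto_le[OF _ elim tendsto_mult[OF tendsto_const elim]])
        (use ev in \<open>auto elim: eventually_mono\<close>)
    show "(1 - K * u M) * c n \<le> c M"
      by (rule tendsto_le[OF _ elim tendsto_mult[OF tendsto_const elim]])
        (use ev in \<open>auto elim: eventually_mono\<close>)
  qed
  have small: "\<exists>M0. \<forall>M\<ge>M0. u M < s" if "s > 0" for s
    using order_tendstoD(2)[OF ulim that] by (auto simp: eventually_sequentially)
  obtain M0 where M0: "u M0 < \<rho>" using small[OF K(2)] by auto
  have half: "1 / 2 \<le> 1 - K * u M" if "u M < \<rho>" for M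
  proof -
    have "K * u M \<le> K * \<rho>" using that K by (intro mult_left_mono) auto
    then show ?thesis using K(4) by linarith
  qed
  have inI: "c (M0 + k) \<in> {c M0 / 2..2 * c M0}" for k
  proof -
    have "1 / 2 * c M0 \<le> (1 - K * u M0) * c M0" "1 / 2 * c (M0 + k) \<le> (1 - K * u M0) * c (M0 + k)"
      using half[OF M0] c(1) by (auto intro!: mult_right_mono less_imp_le)
    then show ?thesis using comp[OF M0, of "M0 + k"] by auto
  qed
  \<comment> \<open>the numbers \<open>c n\<close> stay in a compact interval, so they have a limit point\<close>
  obtain l s where l: "l \<in> {c M0 / 2..2 * c M0}" "strict_mono s" "((\<lambda>k. c (M0 + k)) \<circ> s) \<longlonglongrightarrow> l"
    using seq_compactE[of "{c M0 / 2..2 * c M0}" "\<lambda>k. c (M0 + k)"] inI compact_imp_seq_compact[OF compact_Icc] by blast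
  have lpos: "l > 0" using l(1) c(1)[of M0] by auto
  have lc: "(1 - K * u M) * c M \<le> l \<and> (1 - K * u M) * l \<le> c M" if M: "u M < \<rho>" for M
  proof
    have ge: "M \<le> M0 + s k" if "M \<le> k" for k using seq_suble[OF l(2), of k] that by linarith
    show "(1 - K * u M) * c M \<le> l"
      by (rule LIMSEQ_le_const[OF l(3)]) (use comp[OF M] ge in auto)
    have "(\<lambda>k. (1 - K * u M) * ((\<lambda>k. c (M0 + k)) \<circ> s) k) \<longlonglongrightarrow> (1 - K * u M) * l"
      by (intro tendsto_intros l(3))
    then show "(1 - K * u M) * l \<le> c M"
      by (rule LIMSEQ_le_const2) (use comp[OF M] ge in auto)
  qed
  show thesis
  proof (rule that[OF lpos])
    fix t :: real assume t: "0 < t" "t < 1"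
    obtain M1 where M1: "\<forall>M\<ge>M1. u M < min \<rho> (t / K)" using small[of "min \<rho> (t / K)"] K t by auto
    have *: "\<forall>\<^sub>F d in at_right 0. X x (h x + d) M \<le> X x (h x) M / 2 \<and>
        (\<forall>n\<ge>M. X x (h x + d) n \<le> 0 \<longrightarrow> (1 - t) ^ 3 * (l * d) \<le> e d n \<and> (1 - t)\<^sup>2 * e d n \<le> (1 + t) * (l * d))"
      if M: "M \<ge> M1" for M
    proof -
      have uM: "u M < \<rho>" "K * u M \<le> t" using M1 M K by (auto simp: field_simps dest!: spec[of _ M])
      have "\<forall>\<^sub>F d in at_right 0. (1 - t) * c M < e d M / d" "\<forall>\<^sub>F d in at_right 0. e d M / d < (1 + t) * c M"
        using order_tendstoD[OF elim[of M]] t c(1)[of M] by auto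
      then show ?thesis using neg[of M] eventually_at_right_less[of 0]
      proof eventually_elim
        case (elim d)
        have e1: "(1 - t) * (c M * d) \<le> e d M" "e d M \<le> (1 + t) * (c M * d)"
          using elim by (simp_all only: pos_less_divide_eq pos_divide_less_eq mult.assoc less_imp_le)
        have tm: "(1 - t) * z \<le> (1 - K * u M) * z" if "0 \<le> z" for z
          using uM that by (intro mult_right_mono) auto
        have l1: "(1 - t) * l \<le> c M" "(1 - t) * c M \<le> l"
          using lc[OF uM(1)] lpos c(1)[of M] by (blast intro: order_trans[OF tm] less_imp_le)+
        have "(1 - t) ^ 3 * (l * d) \<le> e d n \<and> (1 - t)\<^sup>2 * e d n \<le> (1 + t) * (l * d)"
          if n: "n \<ge> M" "X x (h x + d) n \<le> 0" for n
        proof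
          have b: "(1 - K * u M) * e d M \<le> e d n" "(1 - K * u M) * e d n \<le> e d M"
            using B[OF x', of "h x + d" M n] elim n uM by (auto simp: e_def u_def)
          have eM0: "0 \<le> e d M" 
          proof -
            have "0 \<le> (1 - t) * (c M * d)" using t c(1)[of M] elim(4) by (intro mult_nonneg_nonneg) auto
            then show ?thesis using e1(1) by linarith
          qed
          have en0: "0 \<le> e d n"
          proof -
            have "0 \<le> (1 - K * u M) * e d M" using half[OF uM(1)] eM0 by (intro mult_nonneg_nonneg) auto
            then show ?thesis using b(1) by linarith
          qed
          have "(1 - t) ^ 3 * (l * d) = (1 - t) * ((1 - t) * (((1 - t) * l) * d))" by (simp add: power3_eq_cube)
          also have "\<dots> \<le> (1 - t) * ((1 - t) * (c M * d))"
            using t l1 elim(4) by (intro mult_left_mono mult_right_mono) auto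
          also have "\<dots> \<le> (1 - t) * e d M" using t e1 by (intro mult_left_mono) auto
          also have "\<dots> \<le> e d n" using tm[OF eM0] b by linarith
          finally show "(1 - t) ^ 3 * (l * d) \<le> e d n" .
          have "(1 - t)\<^sup>2 * e d n = (1 - t) * ((1 - t) * e d n)" by (simp add: power2_eq_square)
          also have "\<dots> \<le> (1 - t) * e d M" using t tm[OF en0] b by (intro mult_left_mono) auto
          also have "\<dots> \<le> (1 - t) * ((1 + t) * (c M * d))" using t e1 by (intro mult_left_mono) auto
          also have "\<dots> = (1 + t) * (((1 - t) * c M) * d)" by simp
          also have "\<dots> \<le> (1 + t) * (l * d)"
            using t l1 elim(4) by (intro mult_left_mono mult_right_mono) auto
          finally show "(1 - t)\<^sup>2 * e d n \<le> (1 + t) * (l * d)" .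
        qed
        then show ?case using elim by auto
      qed
    qed
    show "\<exists>M0. \<forall>M\<ge>M0. \<forall>\<^sub>F d in at_right 0. X x (h x + d) M \<le> X x (h x) M / 2 \<and>
        gains_energy t l x M d"
      using * unfolding e_def by blast
  qed
qed

abbreviation close_to_parabola :: "real \<Rightarrow> real \<Rightarrow> real \<Rightarrow> real \<Rightarrow> bool" where
  "close_to_parabola t e u y \<equiv> (1 - t) * (u\<^sup>2 / 2 + e) \<le> y \<and> y \<le> (1 + t) * (u\<^sup>2 / 2 + e)"

abbreviation follows_parabola :: "real \<Rightarrow> real \<Rightarrow> real \<Rightarrow> nat \<Rightarrow> real \<Rightarrow> real \<Rightarrow> bool" where
  "follows_parabola t c x M b d \<equiv> \<forall>n\<ge>M. X x (h x + d) n \<le> b \<longrightarrow>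
     close_to_parabola t (c * d) (X x (h x + d) n) (Y x (h x + d) n)"

text \<open>On the left of 0 the energy of the perturbed orbit is \<open>c d\<close> plus that of the critical orbit at the same
  time. The latter is small compared with the square of the position of the critical orbit, by the shape
  of the curve, and this square is controlled by the perturbed orbit itself. When the orbit starts at \<open>X = 0\<close>, only
  time 0 has to be considered, and \<open>c = 1\<close>.\<close>

lemma near_parabola_before:
  assumes x: "-A < x" "x \<le> 0"
  obtains c where "c > 0"
    "\<And>t. 0 < t \<Longrightarrow> t < 1 \<Longrightarrow> \<exists>M. -t < X x (h x) M \<and> (\<forall>\<^sub>F d in at_right 0.
        X x (h x + d) M \<le> X x (h x) M / 2 \<and>
        follows_parabola t c x M 0 d)"
proof (cases "x = 0")
  case True
  show thesis
  proof (rule that[of 1])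
    fix t :: real assume t: "0 < t" "t < 1"
    have "\<forall>\<^sub>F d in at_right 0. X x (h x + d) 0 \<le> X x (h x) 0 / 2 \<and>
        (\<forall>n\<ge>0. X x (h x + d) n \<le> 0 \<longrightarrow>
           (1 - t) * ((X x (h x + d) n)\<^sup>2 / 2 + 1 * d) \<le> Y x (h x + d) n \<and>
           Y x (h x + d) n \<le> (1 + t) * ((X x (h x + d) n)\<^sup>2 / 2 + 1 * d))"
      using eventually_at_right_less[of "0::real"]
    proof eventually_elim
      case (elim d)
      have n0: "n = 0" if "X x (h x + d) n \<le> 0" for n
      proof (rule ccontr)
        assume "n \<noteq> 0"
        then have "X x (h x + d) 1 \<le> X x (h x + d) n"
          using x elim True by (intro orbX_incr) (auto simp: h_0)
        then show False using that elim True by (simp add: orb_Suc h_0)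
      qed
      have "(1 - t) * ((X x (h x + d) n)\<^sup>2 / 2 + 1 * d) \<le> Y x (h x + d) n \<and>
           Y x (h x + d) n \<le> (1 + t) * ((X x (h x + d) n)\<^sup>2 / 2 + 1 * d)"
        if "X x (h x + d) n \<le> 0" for n
        using n0[OF that] elim True t by (simp add: h_0 algebra_simps)
      then show ?case using True by (simp add: h_0)
    qed
    then show "\<exists>M. -t < X x (h x) M \<and> (\<forall>\<^sub>F d in at_right 0.
        X x (h x + d) M \<le> X x (h x) M / 2 \<and>
        (\<forall>n\<ge>M. X x (h x + d) n \<le> 0 \<longrightarrow>
           (1 - t) * ((X x (h x + d) n)\<^sup>2 / 2 + 1 * d) \<le> Y x (h x + d) n \<and>
           Y x (h x + d) n \<le> (1 + t) * ((X x (h x + d) n)\<^sup>2 / 2 + 1 * d)))"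
      using True t by (intro exI[of _ 0]) auto
  qed auto
next
  case False
  then have x0: "x < 0" using x by auto
  obtain c where c: "c > 0" and
    E: "\<And>t. 0 < t \<Longrightarrow> t < 1 \<Longrightarrow> \<exists>M0. \<forall>M\<ge>M0. \<forall>\<^sub>F d in at_right 0.
        X x (h x + d) M \<le> X x (h x) M / 2 \<and>
        gains_energy t c x M d"
    using energy_gain[OF x(1) x0] by blast
  show thesis
  proof (rule that[OF c])
    fix \<epsilon> :: real assume \<epsilon>: "0 < \<epsilon>" "\<epsilon> < 1"
    \<comment> \<open>the relative errors below add up to at most \<open>20 * t\<close>\<close>
    define t where "t = \<epsilon> / 20"
    have t: "0 < t" "t < 1 / 20" "t < 1" using \<epsilon> by (auto simp: t_def)
    obtain M0 where M0: "\<And>M. M \<ge> M0 \<Longrightarrow> \<forall>\<^sub>F d in at_right 0.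
        X x (h x + d) M \<le> X x (h x) M / 2 \<and>
        gains_energy t c x M d"
      using E[OF t(1,3)] by blast
    obtain r where r: "r > 0" "\<And>x. -r < x \<Longrightarrow> x \<le> 0 \<Longrightarrow> \<bar>h x - x\<^sup>2 / 2\<bar> \<le> t * x\<^sup>2 / 2"
      using h_near_0[OF t(1) t(3)] by metis
    have "- min r \<epsilon> < 0" using r \<epsilon> by auto
    then obtain M1 where M1: "\<And>M. M \<ge> M1 \<Longrightarrow> - min r \<epsilon> < X x (h x) M"
      using order_tendstoD(1)[OF h_orbit_tendsto[OF x], of "- min r \<epsilon>"] by (auto simp: eventually_sequentially)
    define M where "M = max M0 M1"
    have M: "- r < X x (h x) M" "-\<epsilon> < X x (h x) M" using M1[of M] by (auto simp: M_def)
    have "\<forall>\<^sub>F d in at_right 0.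
        X x (h x + d) M \<le> X x (h x) M / 2 \<and>
        follows_parabola \<epsilon> c x M 0 d"
      using M0[of M, unfolded M_def, OF max.cobounded1, folded M_def] eventually_at_right_less[of 0]
    proof eventually_elim
      case (elim d)
      have "close_to_parabola \<epsilon> (c * d) (X x (h x + d) n) (Y x (h x + d) n)"
        if n: "n \<ge> M" "X x (h x + d) n \<le> 0" for n
      proof -
        define X1 Y1 X2 Y2 where "X1 = X x (h x + d) n" and "Y1 = Y x (h x + d) n"
          and "X2 = X x (h x) n" and "Y2 = Y x (h x) n"
        define e where "e = (Y1 - X1\<^sup>2 / 2) - (Y2 - X2\<^sup>2 / 2)"
        define w where "w = c * d"
        have w: "0 < w" using c elim by (simp add: w_def)
        have e: "(1 - t) ^ 3 * w \<le> e" "(1 - t)\<^sup>2 * e \<le> (1 + t) * w"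
          using elim n by (auto simp: e_def w_def energy_def X1_def X2_def Y1_def Y2_def)
        have h0: "0 \<le> h x" using h_nonneg x by auto
        have ord: "X2 \<le> X1" "Y2 \<le> Y1" using orb_mono[of x "h x" x "h x + d" n] x h0 elim
          by (auto simp: X1_def X2_def Y1_def Y2_def)
        have X1: "X1 \<le> 0" using n by (simp add: X1_def)
        have "-r < X2" using M(1) orbX_incr[OF x(1) h0 n(1)] by (simp add: X2_def)
        then have h2: "\<bar>Y2 - X2\<^sup>2 / 2\<bar> \<le> t * X2\<^sup>2 / 2"
          using r(2)[of X2] h_trapped[OF x] h_orbit[OF x, of n] by (simp add: X2_def Y2_def)
        have g: "(X1 - X2) * (-X2) \<le> 2 * e"
          using energy_gap_ge(2)[OF ord(1) X1 ord(2)] by (simp add: e_def)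
        have e0: "0 \<le> e" using energy_gap_ge(1)[OF ord(1) X1 ord(2)] ord by (simp add: e_def)
        \<comment> \<open>even where the two orbits are far apart, the perturbed one controls the critical one\<close>
        have sq: "X2\<^sup>2 \<le> X1\<^sup>2 + 4 * e"
        proof -
          have "0 \<le> (X1 - X2)\<^sup>2" by simp
          then show ?thesis using g by (simp add: power2_eq_square algebra_simps)
        qed
        have "t * X2\<^sup>2 \<le> t * (X1\<^sup>2 + 4 * e)" using sq t by (intro mult_left_mono) auto
        then have "t * X2\<^sup>2 / 2 \<le> t * X1\<^sup>2 / 2 + 2 * (t * e)" by (simp add: algebra_simps)
        then have s1: "X1\<^sup>2 / 2 + t * X2\<^sup>2 / 2 + e \<le> X1\<^sup>2 / 2 + (t * X1\<^sup>2 / 2 + 2 * (t * e)) + e"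
          and s2: "X1\<^sup>2 / 2 - (t * X1\<^sup>2 / 2 + 2 * (t * e)) + e \<le> X1\<^sup>2 / 2 - t * X2\<^sup>2 / 2 + e" by auto
        have "Y1 = X1\<^sup>2 / 2 + (Y2 - X2\<^sup>2 / 2) + e" by (simp add: e_def)
        then have "Y1 \<le> X1\<^sup>2 / 2 + t * X2\<^sup>2 / 2 + e" "X1\<^sup>2 / 2 - t * X2\<^sup>2 / 2 + e \<le> Y1"
          using h2[unfolded abs_le_iff] by auto
        note yb = order_trans[OF this(1) s1] order_trans[OF s2 this(2)]
        have "(1 + t) * (X1\<^sup>2 / 2) + (1 + 2 * t) * e = X1\<^sup>2 / 2 + (t * X1\<^sup>2 / 2 + 2 * (t * e)) + e"
          "(1 - t) * (X1\<^sup>2 / 2) + (1 - 2 * t) * e = X1\<^sup>2 / 2 - (t * X1\<^sup>2 / 2 + 2 * (t * e)) + e"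
          by (simp_all add: algebra_simps add_divide_distrib diff_divide_distrib)
        with yb have up: "Y1 \<le> (1 + t) * (X1\<^sup>2 / 2) + (1 + 2 * t) * e"
          and lo: "(1 - t) * (X1\<^sup>2 / 2) + (1 - 2 * t) * e \<le> Y1"
          by simp_all
        have "1 - 3 * t \<le> (1 - t) ^ 3"
        proof -
          have "(1 - t) ^ 3 = 1 - 3 * t + t * t * (3 - t)" by (simp add: power3_eq_cube algebra_simps)
          then show ?thesis using t by simp
        qed
        then have elo: "(1 - 3 * t) * w \<le> e" using order_trans[OF mult_right_mono e(1)] w by simp
        have "1 + t \<le> (1 - t)\<^sup>2 * (1 + 4 * t)"
        proof -
          have "(1 - t)\<^sup>2 * (1 + 4 * t) = 1 + t + t * (1 - 7 * t) + 4 * (t * t * t)"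
            by (simp add: power2_eq_square algebra_simps)
          moreover have "0 \<le> t * (1 - 7 * t)" "0 \<le> t * t * t" using t by auto
          ultimately show ?thesis by linarith
        qed
        then have "(1 - t)\<^sup>2 * e \<le> ((1 - t)\<^sup>2 * (1 + 4 * t)) * w"
          using order_trans[OF e(2) mult_right_mono] w by simp
        then have "(1 - t)\<^sup>2 * e \<le> (1 - t)\<^sup>2 * ((1 + 4 * t) * w)" by simp
        then have eup: "e \<le> (1 + 4 * t) * w" using t by (subst (asm) mult_le_cancel_left_pos) auto
        have "(1 + 2 * t) * e \<le> (1 + 2 * t) * ((1 + 4 * t) * w)" using eup t by (intro mult_left_mono) auto
        also have "\<dots> \<le> (1 + 20 * t) * w"
        proof -
          have "(1 + 2 * t) * (1 + 4 * t) = 1 + t * (6 + 8 * t)" by (simp add: algebra_simps)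
          also have "\<dots> \<le> 1 + t * 20" using t by (intro add_left_mono mult_left_mono) auto
          finally have "((1 + 2 * t) * (1 + 4 * t)) * w \<le> (1 + t * 20) * w" using w by (intro mult_right_mono) auto
          then show ?thesis by (simp only: mult.assoc mult.commute[of t 20])
        qed
        finally have u1: "(1 + 2 * t) * e \<le> (1 + 20 * t) * w" .
        have "(1 - 20 * t) * w \<le> ((1 - 2 * t) * (1 - 3 * t)) * w"
          using w t by (intro mult_right_mono) (auto simp: algebra_simps)
        also have "\<dots> = (1 - 2 * t) * ((1 - 3 * t) * w)" by simp
        also have "\<dots> \<le> (1 - 2 * t) * e" using elo t by (intro mult_left_mono) auto
        finally have l1: "(1 - 20 * t) * w \<le> (1 - 2 * t) * e" .
        have "(1 + t) * (X1\<^sup>2 / 2) \<le> (1 + 20 * t) * (X1\<^sup>2 / 2)"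
          "(1 - 20 * t) * (X1\<^sup>2 / 2) \<le> (1 - t) * (X1\<^sup>2 / 2)" using t by (auto intro!: mult_right_mono)
        then have "(1 - 20 * t) * (X1\<^sup>2 / 2 + w) \<le> Y1 \<and> Y1 \<le> (1 + 20 * t) * (X1\<^sup>2 / 2 + w)"
          using up lo u1 l1 by (simp add: distrib_left)
        then show ?thesis by (simp add: t_def X1_def Y1_def w_def)
      qed
      then show ?case using elim by blast
    qed
    then show "\<exists>M. -\<epsilon> < X x (h x) M \<and> (\<forall>\<^sub>F d in at_right 0.
        X x (h x + d) M \<le> X x (h x) M / 2 \<and>
        follows_parabola \<epsilon> c x M 0 d)"
      using M(2) by blast
  qed
qed

end

section \<open>Passage through the bottleneck\<close>

text \<open>On the right of 0 the region below \<open>(1 + t) u\<^sup>2 / 2 + (1 + 4 t) e (1 + 4 u)\<close> is preserved. The term \<open>4 u\<close> pays for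
  the multiplier being evaluated at the end point \<open>u + y\<close>, an effect of order \<open>e y\<close> when \<open>u\<close> is small.\<close>

lemma parabola_step_upper:
  fixes u y e t :: real
  assumes t: "0 < t" "t \<le> 1 / 20" and u: "0 \<le> u" "u \<le> t / 10" and y: "0 \<le> y" and e: "0 < e"
    and B: "y \<le> (1 + t) * u\<^sup>2 / 2 + (1 + 4 * t) * e * (1 + 4 * u)"
    and F: "F \<le> 1 + (1 + t / 2) * (u + y)"
  shows "y * F \<le> (1 + t) * (u + y)\<^sup>2 / 2 + (1 + 4 * t) * e * (1 + 4 * (u + y))"
proof -
  define w where "w = (1 + 4 * t) * e"
  have w: "0 < w" using t e by (simp add: w_def)
  have "u * u \<le> (t / 10) * u" using u by (intro mult_right_mono) auto
  then have uu: "u\<^sup>2 \<le> t * u / 10" by (simp add: power2_eq_square)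
  have "(1 + t) * u\<^sup>2 / 2 \<le> 2 * u\<^sup>2 / 2" using t by (intro divide_right_mono mult_right_mono) auto
  then have b1: "(1 + t) * u\<^sup>2 / 2 \<le> t * u / 10" using uu by simp
  have b2: "w * (1 + 4 * u) \<le> w * 2" using w u t by (intro mult_left_mono) auto
  have y2: "y \<le> t * u / 10 + 2 * w" using B b1 b2 by (simp add: w_def)
  have "t * y \<le> (1 / 20) * y" using t y by (intro mult_right_mono) auto
  moreover have "0 \<le> t * u" using t u by auto
  ultimately have "y + t * y / 2 \<le> t * u / 2 + 4 * w" using y2 w by linarith
  then have "(1 + t / 2) * y \<le> t * u / 2 + 4 * w" by (simp add: algebra_simps)
  then have "(1 + t / 2) * (u + y) \<le> (1 + t) * u + 4 * w" by (simp add: algebra_simps add_divide_distrib)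
  then have "y * ((1 + t / 2) * (u + y)) \<le> y * ((1 + t) * u + 4 * w)" using y by (intro mult_left_mono) auto
  moreover have "y * F \<le> y * (1 + (1 + t / 2) * (u + y))" using F y by (intro mult_left_mono) auto
  moreover have "y + y * ((1 + t) * u + 4 * w) \<le> (1 + t) * (u + y)\<^sup>2 / 2 + w * (1 + 4 * (u + y))"
  proof -
    have "(1 + t) * (u + y)\<^sup>2 / 2 + w * (1 + 4 * (u + y)) =
        ((1 + t) * u\<^sup>2 / 2 + w * (1 + 4 * u)) + y * ((1 + t) * u + 4 * w) + (1 + t) * y\<^sup>2 / 2"
      by (simp add: power2_eq_square field_simps)
    moreover have "0 \<le> (1 + t) * y\<^sup>2 / 2" using t by auto
    ultimately show ?thesis using B by (simp add: w_def)
  qed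
  ultimately show ?thesis by (simp add: w_def algebra_simps)
qed

text \<open>In the step that crosses 0 the point \<open>u\<close> is at distance less than \<open>y\<close> from 0, so \<open>u\<^sup>2\<close> is negligible and \<open>y\<close> is
  essentially \<open>e\<close>.\<close>

lemma parabola_step_cross:
  fixes u y e t :: real
  assumes t: "0 < t" "t \<le> 1 / 20" and u: "-t \<le> u" "u \<le> 0" "0 < u + y" and y: "0 \<le> y"
    and e: "0 < e" "e \<le> t / 10"
    and B: "y \<le> (1 + t) * (u\<^sup>2 / 2 + e)" and F: "F \<le> 1 + 2 * (u + y)"
  shows "y * F \<le> (1 + 4 * t) * e"
proof -
  have "(-u) * (-u) \<le> t * y" using u by (intro mult_mono) auto
  then have "u\<^sup>2 \<le> t * y" by (simp add: power2_eq_square)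
  then have "(1 + t) * (u\<^sup>2 / 2) \<le> 2 * (t * y / 2)" using t by (intro mult_mono) auto
  then have "y \<le> t * y + (1 + t) * e" using B unfolding distrib_left by simp
  then have y1: "(1 - t) * y \<le> (1 + t) * e" by (simp add: algebra_simps)
  have "(1 + t) \<le> (1 - t) * (1 + 5 / 2 * t)"
  proof -
    have "(1 - t) * (1 + 5 / 2 * t) = 1 + t + t * (1 / 2 - 5 / 2 * t)" by (simp add: field_simps)
    moreover have "0 \<le> t * (1 / 2 - 5 / 2 * t)" using t by auto
    ultimately show ?thesis by linarith
  qed
  then have "(1 + t) * e \<le> (1 - t) * (1 + 5 / 2 * t) * e" using e by (intro mult_right_mono) auto
  then have "(1 - t) * y \<le> (1 - t) * ((1 + 5 / 2 * t) * e)" using y1 by (simp add: mult.assoc)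
  then have y2: "y \<le> (1 + 5 / 2 * t) * e" using t by (subst (asm) mult_le_cancel_left_pos) auto
  have "(1 + 5 / 2 * t) * e \<le> (5 / 4) * (t / 10)" using t e by (intro mult_mono) auto
  then have "y \<le> t / 8" using y2 by simp
  then have "2 * (u + y) \<le> t / 4" using u by simp
  then have "F \<le> 1 + t / 4" using F by simp
  then have "y * F \<le> y * (1 + t / 4)" using y by (intro mult_left_mono) auto
  also have "\<dots> \<le> ((1 + 5 / 2 * t) * e) * (1 + t / 4)" using y2 t by (intro mult_right_mono) auto
  also have "\<dots> = ((1 + 5 / 2 * t) * (1 + t / 4)) * e" by simp
  also have "\<dots> \<le> (1 + 4 * t) * e"
  proof (intro mult_right_mono)
    have "(1 + 5 / 2 * t) * (1 + t / 4) = 1 + 11 / 4 * t + 5 / 8 * (t * t)" by (simp add: field_simps)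
    also have "t * t \<le> 1 * t" using t by (intro mult_right_mono) auto
    finally show "(1 + 5 / 2 * t) * (1 + t / 4) \<le> 1 + 4 * t" using t by simp
  qed (use e in auto)
  finally show ?thesis .
qed

text \<open>The increment of the parabola over a step is at most \<open>y\<close> times its slope at the end point, and that
  is the slope that enters \<open>F\<close>.\<close>

lemma parabola_step_lower:
  fixes u y e t :: real
  assumes t: "0 < t" "t < 1" and y: "0 \<le> y" "0 \<le> u + y"
    and B: "(1 - t) * (u\<^sup>2 / 2 + e) \<le> y" and F: "1 + (1 - t) * (u + y) \<le> F"
  shows "(1 - t) * ((u + y)\<^sup>2 / 2 + e) \<le> y * F"
proof -
  have "(u + y)\<^sup>2 / 2 + e \<le> (u\<^sup>2 / 2 + e) + y * (u + y)" by (simp add: power2_eq_square field_simps)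
  then have "(1 - t) * ((u + y)\<^sup>2 / 2 + e) \<le> (1 - t) * ((u\<^sup>2 / 2 + e) + y * (u + y))"
    using t by (intro mult_left_mono) auto
  also have "\<dots> \<le> y + (1 - t) * (y * (u + y))" using B by (simp add: algebra_simps)
  also have "\<dots> = y * (1 + (1 - t) * (u + y))" by (simp add: algebra_simps)
  also have "\<dots> \<le> y * F" using F y by (intro mult_left_mono) auto
  finally show ?thesis .
qed

text \<open>The time that the flow \<open>dx = (x\<^sup>2 / 2 + e) ds\<close> needs to travel from 0 to \<open>x\<close>.\<close>

definition flow_time :: "real \<Rightarrow> real \<Rightarrow> real" where
  "flow_time e x = sqrt (2 / e) * arctan (x / sqrt (2 * e))"

lemma flow_time_deriv:
  assumes "e > 0"
  shows "(flow_time e has_real_derivative 1 / (x\<^sup>2 / 2 + e)) (at x)"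
proof -
  have "(flow_time e has_real_derivative
      sqrt (2 / e) * (inverse (1 + (x / sqrt (2 * e))\<^sup>2) * (1 / sqrt (2 * e)))) (at x)"
    unfolding flow_time_def by (intro DERIV_cmult DERIV_chain2[OF DERIV_arctan] DERIV_cdivide DERIV_ident)
  moreover have "sqrt (2 / e) * (inverse (1 + (x / sqrt (2 * e))\<^sup>2) * (1 / sqrt (2 * e))) = 1 / (x\<^sup>2 / 2 + e)"
  proof -
    have s: "sqrt (2 / e) * (1 / sqrt (2 * e)) = 1 / e"
    proof -
      have "sqrt (2 / e) * (1 / sqrt (2 * e)) = sqrt ((2 / e) / (2 * e))" 
        by (simp only: real_sqrt_divide times_divide_eq_right mult_1_right)
      also have "(2 / e) / (2 * e) = (1 / e)\<^sup>2" by (simp add: power2_eq_square)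
      finally have "sqrt (2 / e) * (1 / sqrt (2 * e)) = sqrt ((1 / e)\<^sup>2)" .
      also have "\<dots> = 1 / e" using assms by (subst real_sqrt_abs) auto
      finally show ?thesis .
    qed
    have "sqrt (2 / e) * (inverse (1 + (x / sqrt (2 * e))\<^sup>2) * (1 / sqrt (2 * e)))
      = (sqrt (2 / e) * (1 / sqrt (2 * e))) * inverse (1 + (x / sqrt (2 * e))\<^sup>2)" by simp
    also have "\<dots> = 1 / e * inverse (1 + x\<^sup>2 / (2 * e))" using s assms by (simp add: power_divide)
    also have "\<dots> = 1 / (x\<^sup>2 / 2 + e)"
      using assms add_pos_nonneg[of e "x\<^sup>2 / 2"] by (simp add: field_simps)
    finally show ?thesis .
  qed
  ultimately show ?thesis by simp
qed

text \<open>One step of the map takes about one unit of flow time, since the speed hardly varies over a step.\<close>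

lemma flow_time_step:
  assumes e: "0 < e" "e \<le> \<epsilon>" and \<epsilon>: "0 < \<epsilon>" "\<epsilon> \<le> 1 / 20" and u: "\<bar>u\<bar> \<le> \<epsilon>"
    and y: "(1 - \<epsilon>) * (u\<^sup>2 / 2 + e) \<le> y" "y \<le> (1 + \<epsilon>) * (u\<^sup>2 / 2 + e)"
  shows "1 - 4 * \<epsilon> \<le> flow_time e (u + y) - flow_time e u"
    "flow_time e (u + y) - flow_time e u \<le> 1 + 4 * \<epsilon>"
proof -
  have qpos: "0 < v\<^sup>2 / 2 + e" for v using e by (simp add: add_nonneg_pos)
  have "0 < (1 - \<epsilon>) * (u\<^sup>2 / 2 + e)" using qpos[of u] \<epsilon> by auto
  then have ypos: "0 < y" using y by linarith
  obtain z where z: "u < z" "z < u + y"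
    "flow_time e (u + y) - flow_time e u = (u + y - u) * (1 / (z\<^sup>2 / 2 + e))"
    using MVT2[of u "u + y" "flow_time e" "\<lambda>x. 1 / (x\<^sup>2 / 2 + e)"] flow_time_deriv[OF e(1)] ypos by auto
  have "\<bar>u\<bar> * \<bar>u\<bar> \<le> (1 / 20) * \<epsilon>" using u \<epsilon> by (intro mult_mono) auto
  then have uu: "u\<^sup>2 \<le> \<epsilon> / 20" by (simp add: power2_eq_square)
  have "(1 + \<epsilon>) * (u\<^sup>2 / 2 + e) \<le> (21 / 20) * (\<epsilon> / 40 + \<epsilon>)"
    using uu e \<epsilon> by (intro mult_mono) (auto intro!: add_nonneg_nonneg)
  then have y2: "y \<le> 2 * \<epsilon>" using y \<epsilon> by simp
  have "\<bar>z\<^sup>2 - u\<^sup>2\<bar> = (z - u) * \<bar>z + u\<bar>"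
    using z by (simp add: power2_eq_square square_diff_square_factored abs_mult)
  also have "\<dots> \<le> y * (4 * \<epsilon>)" using z u y2 by (intro mult_mono) auto
  finally have "\<bar>z\<^sup>2 - u\<^sup>2\<bar> / 2 \<le> 2 * \<epsilon> * y" by (simp add: algebra_simps)
  moreover have "\<bar>z\<^sup>2 - u\<^sup>2\<bar> / 2 = \<bar>z\<^sup>2 / 2 - u\<^sup>2 / 2\<bar>" unfolding diff_divide_distrib[symmetric] abs_divide by simp
  ultimately have "\<bar>z\<^sup>2 / 2 - u\<^sup>2 / 2\<bar> \<le> 2 * \<epsilon> * y" by simp
  also have "\<dots> \<le> 2 * \<epsilon> * ((21 / 20) * (u\<^sup>2 / 2 + e))"
  proof (intro mult_left_mono)
    have "(1 + \<epsilon>) * (u\<^sup>2 / 2 + e) \<le> (21 / 20) * (u\<^sup>2 / 2 + e)"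
      using \<epsilon> qpos[of u] by (intro mult_right_mono) auto
    then show "y \<le> (21 / 20) * (u\<^sup>2 / 2 + e)" using y(2) by (rule order_trans[rotated])
  qed (use \<epsilon> in auto)
  also have "2 * \<epsilon> * ((21 / 20) * q) = 21 / 10 * \<epsilon> * q" for q by simp
  finally have zq: "\<bar>z\<^sup>2 / 2 - u\<^sup>2 / 2\<bar> \<le> 21 / 10 * \<epsilon> * (u\<^sup>2 / 2 + e)" .
  define Q where "Q = u\<^sup>2 / 2 + e"
  have Q: "0 < Q" using qpos by (simp add: Q_def)
  have zQ: "z\<^sup>2 / 2 + e \<le> (1 + 21 / 10 * \<epsilon>) * Q" "(1 - 21 / 10 * \<epsilon>) * Q \<le> z\<^sup>2 / 2 + e"
  proof -
    have "z\<^sup>2 / 2 + e = Q + (z\<^sup>2 / 2 - u\<^sup>2 / 2)" by (simp add: Q_def)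
    moreover have "z\<^sup>2 / 2 - u\<^sup>2 / 2 \<le> 21 / 10 * \<epsilon> * Q" "- (21 / 10 * \<epsilon> * Q) \<le> z\<^sup>2 / 2 - u\<^sup>2 / 2"
      using zq unfolding Q_def by linarith+
    ultimately show "z\<^sup>2 / 2 + e \<le> (1 + 21 / 10 * \<epsilon>) * Q" "(1 - 21 / 10 * \<epsilon>) * Q \<le> z\<^sup>2 / 2 + e"
      unfolding distrib_right left_diff_distrib by linarith+
  qed
  have ee: "\<epsilon> * \<epsilon> \<le> \<epsilon> / 20" using mult_right_mono[of \<epsilon> "1/20" \<epsilon>] \<epsilon> by simp
  have "(1 - 4 * \<epsilon>) * (z\<^sup>2 / 2 + e) \<le> (1 - 4 * \<epsilon>) * ((1 + 21 / 10 * \<epsilon>) * Q)"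
    using zQ \<epsilon> by (intro mult_left_mono) auto
  also have "\<dots> = ((1 - 4 * \<epsilon>) * (1 + 21 / 10 * \<epsilon>)) * Q" by simp
  also have "\<dots> \<le> (1 - \<epsilon>) * Q" using Q ee \<epsilon> by (intro mult_right_mono) (auto simp: algebra_simps)
  also have "\<dots> \<le> y" using y by (simp add: Q_def)
  finally show "1 - 4 * \<epsilon> \<le> flow_time e (u + y) - flow_time e u"
    using z(3) qpos[of z] by (simp add: pos_le_divide_eq)
  have "y \<le> (1 + \<epsilon>) * Q" using y by (simp add: Q_def)
  also have "\<dots> \<le> ((1 + 4 * \<epsilon>) * (1 - 21 / 10 * \<epsilon>)) * Q"
    using Q ee \<epsilon> by (intro mult_right_mono) (auto simp: algebra_simps)
  also have "\<dots> = (1 + 4 * \<epsilon>) * ((1 - 21 / 10 * \<epsilon>) * Q)" by simp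
  also have "\<dots> \<le> (1 + 4 * \<epsilon>) * (z\<^sup>2 / 2 + e)" using zQ \<epsilon> by (intro mult_left_mono) auto
  finally show "flow_time e (u + y) - flow_time e u \<le> 1 + 4 * \<epsilon>"
    using z(3) qpos[of z] by (simp add: pos_divide_le_eq)
qed

context parabolic_map begin

text \<open>Past 0 the energy is no longer compared with the critical orbit; the two invariant regions given by the step
  lemmas keep \<open>Y\<close> close to the parabola.\<close>

lemma near_parabola_after:
  assumes x: "-A < x" "0 < y"
    and t: "0 < t" "t \<le> 1 / 20" and \<eta>: "0 < \<eta>" "\<eta> \<le> t / 10"
    and fup: "\<And>v. 0 \<le> v \<Longrightarrow> v \<le> \<eta> \<Longrightarrow> f v \<le> 1 + (1 + t / 2) * v"
    and flo: "\<And>v. 0 \<le> v \<Longrightarrow> v \<le> \<eta> \<Longrightarrow> 1 + (1 - t) * v \<le> f v"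
    and e: "0 < e" "e \<le> t / 10"
    and M: "-t \<le> X x y M" "X x y M \<le> 0"
    and before: "\<And>n. n \<ge> M \<Longrightarrow> X x y n \<le> 0 \<Longrightarrow>
       close_to_parabola t e (X x y n) (Y x y n)"
    and n: "n \<ge> M" "X x y n \<le> \<eta>"
  shows "(1 - 20 * t) * ((X x y n)\<^sup>2 / 2 + e) \<le> Y x y n"
    "Y x y n \<le> (1 + 20 * t) * ((X x y n)\<^sup>2 / 2 + e)"
proof -
  have ynn: "0 \<le> Y x y n" for n using orb_nonneg(2)[of x y n] x by auto
  have main: "(1 - t) * ((X x y n)\<^sup>2 / 2 + e) \<le> Y x y n \<and>
     (0 < X x y n \<longrightarrow> Y x y n \<le> (1 + t) * (X x y n)\<^sup>2 / 2 + (1 + 4 * t) * e * (1 + 4 * X x y n))"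
    using n
  proof (induction n rule: nat_induct_at_least)
    case base
    then show ?case using before[of M] M by auto
  next
    case (Suc n)
    define u z where "u = X x y n" and "z = Y x y n"
    have z: "0 \<le> z" using ynn by (simp add: z_def)
    have uz: "X x y (Suc n) = u + z" "Y x y (Suc n) = z * f (u + z)" by (auto simp: orb_Suc u_def z_def)
    have u\<eta>: "u + z \<le> \<eta>" "u \<le> \<eta>" using Suc.prems uz z by auto
    have IH: "(1 - t) * (u\<^sup>2 / 2 + e) \<le> z"
      "0 < u \<Longrightarrow> z \<le> (1 + t) * u\<^sup>2 / 2 + (1 + 4 * t) * e * (1 + 4 * u)"
      using Suc.IH u\<eta> by (auto simp: u_def z_def)
    show ?case
    proof (cases "u + z \<le> 0")
      case True
      then show ?thesis using before[of "Suc n"] Suc.hyps uz by auto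
    next
      case False
      have "(1 - t) * ((u + z)\<^sup>2 / 2 + e) \<le> z * f (u + z)"
        using IH(1) False z t flo[of "u + z"] u\<eta> by (intro parabola_step_lower) auto
      moreover have "z * f (u + z) \<le> (1 + t) * (u + z)\<^sup>2 / 2 + (1 + 4 * t) * e * (1 + 4 * (u + z))"
      proof (cases "0 < u")
        case True
        then show ?thesis using IH(2) z e t \<eta> u\<eta> fup[of "u + z"] by (intro parabola_step_upper) auto
      next
        case u: False
        have fl: "f (u + z) \<le> 1 + 2 * (u + z)"
        proof -
          have "(1 + t / 2) * (u + z) \<le> 2 * (u + z)" using t False by (intro mult_right_mono) auto
          then show ?thesis using fup[of "u + z"] False u\<eta> by auto
        qed
        have "-t \<le> u" using M(1) orbX_incr[OF x(1) _ Suc.hyps, of y] x by (simp add: u_def)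
        then have "z * f (u + z) \<le> (1 + 4 * t) * e"
          using False u t e z before[of n] Suc.hyps fl by (intro parabola_step_cross) (auto simp: u_def z_def)
        also have "\<dots> \<le> (1 + 4 * t) * e * (1 + 4 * (u + z))"
          using False e t mult_left_mono[of 1 "1 + 4 * (u + z)" "(1 + 4 * t) * e"] by simp
        also have "\<dots> \<le> (1 + t) * (u + z)\<^sup>2 / 2 + (1 + 4 * t) * e * (1 + 4 * (u + z))" using t by auto
        finally show ?thesis .
      qed
      ultimately show ?thesis using uz by simp
    qed
  qed
  define u where "u = X x y n"
  define Q where "Q = u\<^sup>2 / 2 + e"
  have Q: "0 < Q" using e by (auto simp: Q_def intro: add_nonneg_pos)
  have "(1 - 20 * t) * Q \<le> (1 - t) * Q" using Q t by (intro mult_right_mono) auto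
  then show "(1 - 20 * t) * ((X x y n)\<^sup>2 / 2 + e) \<le> Y x y n" using main by (simp add: Q_def u_def)
  have up: "(1 + t) * Q \<le> (1 + 20 * t) * Q" using Q t by (intro mult_right_mono) auto
  show "Y x y n \<le> (1 + 20 * t) * ((X x y n)\<^sup>2 / 2 + e)"
  proof (cases "0 < u")
    case True
    have "(1 + 4 * t) * (1 + 4 * u) \<le> (1 + 4 * t) * (1 + t)"
      using n \<eta> t by (intro mult_left_mono) (auto simp: u_def)
    also have "\<dots> = 1 + t * (5 + 4 * t)" by (simp add: algebra_simps)
    also have "\<dots> \<le> 1 + t * 20" using t by (intro add_left_mono mult_left_mono) auto
    finally have "(1 + 4 * t) * (1 + 4 * u) * e \<le> (1 + 20 * t) * e" using e by (intro mult_right_mono) auto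
    moreover have "(1 + t) * (u\<^sup>2 / 2) \<le> (1 + 20 * t) * (u\<^sup>2 / 2)" using t by (intro mult_right_mono) auto
    moreover have "(1 + t) * u\<^sup>2 / 2 + (1 + 4 * t) * e * (1 + 4 * u) =
        (1 + t) * (u\<^sup>2 / 2) + (1 + 4 * t) * (1 + 4 * u) * e" by simp
    ultimately have "Y x y n \<le> (1 + 20 * t) * (u\<^sup>2 / 2) + (1 + 20 * t) * e"
      using main True unfolding u_def by linarith
    then show ?thesis by (simp add: u_def distrib_left)
  next
    case False
    then show ?thesis using before[of n] n up by (auto simp: u_def Q_def)
  qed
qed

lemma near_parabola:
  assumes x: "-A < x" "x \<le> 0"
  obtains c where "c > 0"
    "\<And>t. 0 < t \<Longrightarrow> t < 1 \<Longrightarrow> \<exists>M \<eta>. 0 < \<eta> \<and> \<eta> \<le> t \<and> -t < X x (h x) M \<and> (\<forall>\<^sub>F d in at_right 0.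
        X x (h x + d) M \<le> X x (h x) M / 2 \<and>
        follows_parabola t c x M \<eta> d)"
proof -
  obtain c where c: "c > 0"
    and B: "\<And>t. 0 < t \<Longrightarrow> t < 1 \<Longrightarrow> \<exists>M. -t < X x (h x) M \<and> (\<forall>\<^sub>F d in at_right 0.
        X x (h x + d) M \<le> X x (h x) M / 2 \<and>
        follows_parabola t c x M 0 d)"
    using near_parabola_before[OF x] by blast
  obtain C r where C: "C \<ge> 1" "r > 0" "r < 1" "r < A"
    and q: "\<And>x. \<bar>x\<bar> \<le> r \<Longrightarrow> \<bar>f x - 1 - x\<bar> \<le> C * x\<^sup>2"
    using f_quad_obtain by metis
  have h0: "0 \<le> h x" using h_nonneg x by auto
  show thesis
  proof (rule that[OF c])
    fix \<epsilon> :: real assume \<epsilon>: "0 < \<epsilon>" "\<epsilon> < 1"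
    \<comment> \<open>the relative errors below add up to at most \<open>20 * t\<close>\<close>
    define t where "t = \<epsilon> / 20"
    have t: "0 < t" "t \<le> 1 / 20" "t < 1" using \<epsilon> by (auto simp: t_def)
    define \<eta> where "\<eta> = min (min (t / 10) r) (t / 2 / C)"
    have \<eta>: "0 < \<eta>" "\<eta> \<le> t / 10" "\<eta> \<le> r" using t C by (auto simp: \<eta>_def)
    have "C * \<eta> \<le> C * (t / 2 / C)" using C by (intro mult_left_mono) (auto simp: \<eta>_def)
    then have C\<eta>: "C * \<eta> \<le> t / 2" using C by simp
    have fb: "f v \<le> 1 + (1 + t / 2) * v" "1 + (1 - t) * v \<le> f v" if v: "0 \<le> v" "v \<le> \<eta>" for v
    proof -
      have "C * v\<^sup>2 = (C * v) * v" by (simp add: power2_eq_square)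
      also have "\<dots> \<le> (C * \<eta>) * v" using v C by (intro mult_right_mono mult_left_mono) auto
      also have "\<dots> \<le> t / 2 * v" using C\<eta> v by (intro mult_right_mono) auto
      finally have a: "C * v\<^sup>2 \<le> t / 2 * v" .
      have b: "\<bar>f v - 1 - v\<bar> \<le> C * v\<^sup>2" using q[of v] v \<eta> by auto
      have c: "t / 2 * v \<le> t * v" using v t by (intro mult_right_mono) auto
      show "f v \<le> 1 + (1 + t / 2) * v" "1 + (1 - t) * v \<le> f v" using a b c by (auto simp: algebra_simps)
    qed
    obtain M where M: "-t < X x (h x) M" and ev: "\<forall>\<^sub>F d in at_right 0.
        X x (h x + d) M \<le> X x (h x) M / 2 \<and>
        follows_parabola t c x M 0 d"
      using B[OF t(1,3)] by blast
    have sm: "\<forall>\<^sub>F d in at_right 0. d < t / 10 / c"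
      using t c by (intro order_tendstoD(2)[OF tendsto_ident_at]) auto
    have "\<forall>\<^sub>F d in at_right 0.
        X x (h x + d) M \<le> X x (h x) M / 2 \<and>
        follows_parabola \<epsilon> c x M \<eta> d"
      using ev sm eventually_at_right_less[of 0]
    proof eventually_elim
      case (elim d)
      have "c * d \<le> t / 10" using elim c by (simp add: field_simps)
      moreover have "- t \<le> X x (h x + d) M"
        using orb_mono(1)[of x "h x" x "h x + d" M] M x h0 elim by linarith
      moreover have "X x (h x + d) M \<le> 0" using elim h_trapped[OF x, of M] by linarith
      ultimately have "(1 - 20 * t) * ((X x (h x + d) n)\<^sup>2 / 2 + c * d) \<le> Y x (h x + d) n \<and>
         Y x (h x + d) n \<le> (1 + 20 * t) * ((X x (h x + d) n)\<^sup>2 / 2 + c * d)"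
        if "n \<ge> M" "X x (h x + d) n \<le> \<eta>" for n
        using near_parabola_after[of x "h x + d" t \<eta> "c * d" M n] x h0 elim t \<eta> fb c that by auto
      then show ?case using elim by (simp add: t_def)
    qed
    then show "\<exists>M \<eta>. 0 < \<eta> \<and> \<eta> \<le> \<epsilon> \<and> -\<epsilon> < X x (h x) M \<and> (\<forall>\<^sub>F d in at_right 0.
        X x (h x + d) M \<le> X x (h x) M / 2 \<and>
        follows_parabola \<epsilon> c x M \<eta> d)"
      using \<eta> M \<epsilon> by (intro exI[of _ M] exI[of _ \<eta>]) (auto simp: t_def)
  qed
qed

text \<open>After crossing 0 the multiplier is at least 1, so \<open>X\<close> grows at least linearly.\<close>

lemma orbit_escapes:
  assumes x: "-A < x" and y: "0 < y" "x \<le> 0 \<Longrightarrow> h x < y"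
  shows "\<exists>n. K < X x y n"
proof -
  have "\<exists>n. 0 < X x y n"
  proof (cases "x \<le> 0")
    case True
    then show ?thesis using le_h_iff[of x y] x y by (auto simp: not_le)
  next
    case False
    then show ?thesis by (intro exI[of _ 0]) auto
  qed
  then obtain m where m: "0 < X x y m" by auto
  define u z where "u = X x y m" and "z = Y x y m"
  have uz: "0 < u" "0 < z" using m orbY_pos[OF x y(1)] by (auto simp: u_def z_def)
  have *: "u + real n * z \<le> X u z n \<and> z \<le> Y u z n" for n
  proof (induction n)
    case (Suc n)
    have nn: "u \<le> X u z n" "0 \<le> Y u z n" using orb_nonneg[of u z n] uz A_pos by auto
    have "f 0 \<le> f (X u z n + Y u z n)" using nn uz A_pos by (intro f_le) auto
    then have "Y u z n * 1 \<le> Y u z n * f (X u z n + Y u z n)" using nn f_0 by (intro mult_left_mono) auto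
    then show ?case using Suc by (auto simp: orb_Suc algebra_simps)
  qed (use uz in auto)
  obtain n where "K < real n * z" using reals_Archimedean3[of z] uz by auto
  then have "K < X u z n" using *[of n] uz by linarith
  then show ?thesis by (intro exI[of _ "m + n"]) (simp add: orb_add u_def z_def)
qed

text \<open>Summing \<open>flow_time_step\<close> up to the first time \<open>N\<close> at which \<open>X\<close> exceeds \<open>\<eta>\<close>. The bounds on \<open>X\<close> and \<open>Y\<close> at time
  \<open>N\<close> do not involve \<open>e\<close>, so the orbit leaves the bottleneck in a fixed compact region.\<close>

lemma passage_time:
  assumes x: "-A < x" "0 < y" and \<epsilon>: "0 < \<epsilon>" "\<epsilon> \<le> 1 / 20" and \<eta>: "0 < \<eta>" "\<eta> \<le> \<epsilon>"
    and e: "0 < e" "e \<le> \<epsilon>" "e \<le> \<eta> / 4"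
    and M: "-\<epsilon> \<le> X x y M" "X x y M \<le> 0"
    and near: "\<And>n. n \<ge> M \<Longrightarrow> X x y n \<le> \<eta> \<Longrightarrow>
       close_to_parabola \<epsilon> e (X x y n) (Y x y n)"
    and esc: "\<exists>n. \<eta> < X x y n"
  obtains N where "M < N" "\<eta> < X x y N" "X x y N \<le> 2 * \<eta>" "\<eta>\<^sup>2 / 10 \<le> Y x y N" "Y x y N \<le> 2 * \<eta> * f (2 * \<eta>)"
    "(1 - 4 * \<epsilon>) * real (N - M) \<le> flow_time e (X x y N) - flow_time e (X x y M)"
    "flow_time e (X x y N) - flow_time e (X x y M) \<le> (1 + 4 * \<epsilon>) * real (N - M)"
proof -
  define N where "N = (LEAST n. \<eta> < X x y n)"
  have N: "\<eta> < X x y N" unfolding N_def using esc by (rule LeastI_ex)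
  have before: "X x y n \<le> \<eta>" if "n < N" for n using not_less_Least[of n] that unfolding N_def by (meson not_le)
  have MN: "M < N" using orbX_incr[OF x(1), of y N M] N M \<eta> x by (cases "M < N") auto
  have lower: "-\<epsilon> \<le> X x y n" if "M \<le> n" for n using orbX_incr[OF x(1) _ that, of y] M x by force
  have time: "(1 - 4 * \<epsilon>) * real (n - M) \<le> flow_time e (X x y n) - flow_time e (X x y M) \<and>
     flow_time e (X x y n) - flow_time e (X x y M) \<le> (1 + 4 * \<epsilon>) * real (n - M)"
    if "M \<le> n" "n \<le> N" for n using that
  proof (induction n rule: dec_induct)
    case (step n)
    have a: "1 - 4 * \<epsilon> \<le> flow_time e (X x y n + Y x y n) - flow_time e (X x y n)"
      "flow_time e (X x y n + Y x y n) - flow_time e (X x y n) \<le> 1 + 4 * \<epsilon>"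
      using near[of n] before[of n] lower[of n] step \<epsilon> \<eta> e
      by (auto intro!: flow_time_step[OF e(1,2) \<epsilon>])
    then show ?case using step by (auto simp: orb_Suc Suc_diff_le algebra_simps)
  qed auto
  obtain k where k: "N = Suc k" "M \<le> k" using MN by (cases N) auto
  define u z where "u = X x y k" and "z = Y x y k"
  have uz: "X x y N = u + z" "Y x y N = z * f (u + z)" by (auto simp: k orb_Suc u_def z_def)
  have u: "u \<le> \<eta>" "-\<epsilon> \<le> u" using before[of k] lower[of k] k by (auto simp: u_def)
  have z: "(1 - \<epsilon>) * (u\<^sup>2 / 2 + e) \<le> z" "z \<le> (1 + \<epsilon>) * (u\<^sup>2 / 2 + e)"
    using near[of k] k u by (auto simp: u_def z_def)
  have "(1 + \<epsilon>) * (u\<^sup>2 / 2 + e) \<le> (21 / 20) * (u\<^sup>2 / 2 + e)" using \<epsilon> e by (intro mult_right_mono) auto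
  then have z': "z \<le> (21 / 20) * (u\<^sup>2 / 2 + e)" using z by linarith
  have absu: "\<bar>u\<bar> \<le> 1 / 20" using u \<epsilon> \<eta> by auto
  then have uu: "u\<^sup>2 \<le> \<bar>u\<bar> / 20" using mult_right_mono[of "\<bar>u\<bar>" "1/20" "\<bar>u\<bar>"] by (simp add: power2_eq_square)
  have uN: "\<eta> < u + z" using N uz by simp
  have u2: "\<eta> / 2 < u"
  proof (rule ccontr)
    assume "\<not> \<eta> / 2 < u"
    then have c: "u \<le> \<eta> / 2" by simp
    show False
    proof (cases "0 \<le> u")
      case True
      then have "u\<^sup>2 \<le> \<eta> / 40" using uu c by auto
      then have "u\<^sup>2 / 2 + e \<le> \<eta> / 80 + \<eta> / 4" using e(3) by simp
      then have "z \<le> (21 / 20) * (\<eta> / 80 + \<eta> / 4)" using z' by simp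
      then show False using uN c \<eta> by simp
    next
      case False
      then have "u\<^sup>2 / 2 + e \<le> -u / 40 + \<eta> / 4" using e(3) uu by simp
      then have "z \<le> (21 / 20) * (-u / 40 + \<eta> / 4)" using z' by simp
      then show False using uN False \<eta> by (simp add: field_simps)
    qed
  qed
  have zpos: "0 < z" using orbY_pos[OF x] by (simp add: z_def)
  have "u\<^sup>2 \<le> \<eta> / 20" using uu u u2 \<eta> by auto
  then have "u\<^sup>2 / 2 + e \<le> \<eta> / 40 + \<eta> / 4" using e(3) by simp
  then have "z \<le> (21 / 20) * (\<eta> / 40 + \<eta> / 4)" using z' by simp
  then have z\<eta>: "z \<le> \<eta>" using \<eta> by simp
  have f1: "1 \<le> f (u + z)" using f_le[of 0 "u + z"] u2 zpos \<eta> A_pos f_0 by auto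
  have "z * f (u + z) \<le> (2 * \<eta>) * f (2 * \<eta>)"
    using z\<eta> zpos f1 u u2 \<eta> A_pos by (intro mult_mono f_le) auto
  moreover have "\<eta>\<^sup>2 / 10 \<le> z * f (u + z)"
  proof -
    have "(\<eta> / 2)\<^sup>2 \<le> u\<^sup>2" using u2 \<eta> by (intro power_mono) auto
    then have "\<eta>\<^sup>2 / 8 \<le> u\<^sup>2 / 2 + e" using e by (simp add: power_divide)
    then have "(19 / 20) * (\<eta>\<^sup>2 / 8) \<le> (1 - \<epsilon>) * (u\<^sup>2 / 2 + e)" using \<epsilon> by (intro mult_mono) auto
    then have "\<eta>\<^sup>2 / 10 \<le> z" using z zero_le_power2[of \<eta>] by linarith
    also have "z * 1 \<le> z * f (u + z)" using zpos f1 by (intro mult_left_mono) auto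
    finally show ?thesis by simp
  qed
  ultimately show thesis using that[of N] N MN time[of N] uz u z\<eta> by auto
qed

end

section \<open>Exponential growth rate of orbits\<close>

text \<open>The map together with a bound \<open>1 / p\<close> on its growth that every orbit on the right of 0 attains up to
  a constant factor.\<close>

locale parabolic_growth = parabolic_map +
  fixes p :: real
  assumes p: "0 < p" "p < 1"
    and f_bound: "x > -A \<Longrightarrow> f x \<le> 1 / p"
    and growth: "0 < x \<Longrightarrow> 0 < y \<Longrightarrow> \<exists>g>0. (\<lambda>n. p ^ n * orbY f x y n) \<longlonglongrightarrow> g"
begin

definition free_energy :: "real \<Rightarrow> real \<Rightarrow> real" where
  "free_energy x y = lim (\<lambda>n. p ^ n * Y x y n)"

text \<open>Since \<open>f \<le> 1 / p\<close>, the sequence is nonincreasing.\<close>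

lemma free_energy_tendsto:
  assumes "-A < x" "0 \<le> y"
  shows "(\<lambda>n. p ^ n * Y x y n) \<longlonglongrightarrow> free_energy x y" "free_energy x y \<le> y"
proof -
  have dec: "decseq (\<lambda>n. p ^ n * Y x y n)"
  proof (rule decseq_SucI)
    fix n
    have "-A < X x y n + Y x y n" using orb_nonneg[of x y n] assms by auto
    then have "f (X x y n + Y x y n) \<le> 1 / p" by (rule f_bound)
    then have "Y x y n * f (X x y n + Y x y n) \<le> Y x y n * (1 / p)"
      using orb_nonneg(2)[of x y n] assms by (intro mult_left_mono) auto
    then have "p ^ Suc n * (Y x y n * f (X x y n + Y x y n)) \<le> p ^ Suc n * (Y x y n * (1 / p))"
      using p by (intro mult_left_mono[OF _ zero_le_power]) auto
    then show "p ^ Suc n * Y x y (Suc n) \<le> p ^ n * Y x y n" using p by (simp add: orb_Suc)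
  qed
  have nn: "0 \<le> p ^ n * Y x y n" for n using orb_nonneg(2)[of x y n] assms p by auto
  obtain g where g: "(\<lambda>n. p ^ n * Y x y n) \<longlonglongrightarrow> g" "\<And>n. g \<le> p ^ n * Y x y n"
    using decseq_convergent[OF dec, of 0] nn by metis
  have "free_energy x y = g" unfolding free_energy_def using g(1) by (rule limI)
  then show "(\<lambda>n. p ^ n * Y x y n) \<longlonglongrightarrow> free_energy x y" "free_energy x y \<le> y" using g g(2)[of 0] by auto
qed

lemma free_energy_mono:
  assumes "-A < x" "0 \<le> y" "x \<le> x'" "y \<le> y'" shows "free_energy x y \<le> free_energy x' y'"
proof (rule tendsto_le[OF _ free_energy_tendsto(1) free_energy_tendsto(1)])
  show "\<forall>\<^sub>F n in sequentially. p ^ n * Y x y n \<le> p ^ n * Y x' y' n"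
    using orb_mono(2)[OF assms] p by (intro always_eventually) (auto intro!: mult_left_mono)
qed (use assms in auto)

lemma free_energy_pos: assumes "0 < x" "0 < y" shows "0 < free_energy x y"
proof -
  obtain g where "g > 0" "(\<lambda>n. p ^ n * Y x y n) \<longlonglongrightarrow> g" using growth[OF assms] by auto
  then show ?thesis unfolding free_energy_def by (simp add: limI)
qed

lemma free_energy_shift:
  assumes "-A < x" "0 \<le> y" shows "free_energy x y = p ^ m * free_energy (X x y m) (Y x y m)"
proof (rule LIMSEQ_unique)
  show "(\<lambda>n. p ^ (n + m) * Y x y (n + m)) \<longlonglongrightarrow> free_energy x y"
    using LIMSEQ_ignore_initial_segment[OF free_energy_tendsto(1)[OF assms]] .
  have "(\<lambda>n. p ^ n * Y (X x y m) (Y x y m) n) \<longlonglongrightarrow> free_energy (X x y m) (Y x y m)"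
    using orb_nonneg[OF assms, of m] assms by (intro free_energy_tendsto) auto
  then have "(\<lambda>n. p ^ m * (p ^ n * Y (X x y m) (Y x y m) n)) \<longlonglongrightarrow> p ^ m * free_energy (X x y m) (Y x y m)"
    by (intro tendsto_intros)
  then show "(\<lambda>n. p ^ (n + m) * Y x y (n + m)) \<longlonglongrightarrow> p ^ m * free_energy (X x y m) (Y x y m)"
    by (simp add: add.commute[of _ m] orb_add(2) power_add mult.assoc)
qed

text \<open>Along a trapped orbit \<open>Y\<close> is bounded, so \<open>p\<^sup>n Y\<^sub>n\<close> tends to 0; all other orbits reach the region of the growth
  assumption.\<close>

lemma free_energy_pos_iff:
  assumes x: "-A < x" and y: "0 < y"
  shows "0 < free_energy x y \<longleftrightarrow> h x < y"
proof (cases "x \<le> 0 \<and> y \<le> h x")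
  case True
  have tr: "X x y n \<le> 0" for n using le_h_iff[of x y] True x y by auto
  obtain l where "Y x y \<longlonglongrightarrow> 0" using trapped_orbit_converges[of x y] tr x y by (metis less_imp_le)
  moreover have "(\<lambda>n. p ^ n) \<longlonglongrightarrow> 0" using p by (intro LIMSEQ_realpow_zero) auto
  ultimately have "(\<lambda>n. p ^ n * Y x y n) \<longlonglongrightarrow> 0 * 0" by (intro tendsto_mult)
  then have "free_energy x y = 0" unfolding free_energy_def by (simp add: limI)
  then show ?thesis using True by auto
next
  case False
  then have hy: "h x < y" using y by (cases "x \<le> 0") (auto simp: h_0)
  obtain n where n: "0 < X x y n" using orbit_escapes[OF x y] hy by blast
  have "0 < free_energy (X x y n) (Y x y n)" using n orbY_pos[OF x y] by (intro free_energy_pos) auto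
  then show ?thesis using free_energy_shift[of x y n] x y p hy by auto
qed

text \<open>The free energy is \<open>p\<^sup>N\<close> times its value at the exit point of the bottleneck, which is bounded
  above and away from 0. The number \<open>N\<close> of steps is the flow time across the bottleneck at \<open>e = c d\<close>, and
  \<open>sqrt d\<close> times it tends to \<open>sqrt (2 / c) \<theta>\<close>; the angle \<open>\<theta>\<close> is \<open>\<pi>\<close> for a start on the left of 0 and \<open>\<pi> / 2\<close> for a
  start at 0.\<close>

lemma log_free_energy_asymp:
  assumes x: "-A < x" "x \<le> 0"
  obtains C where "C > 0" "((\<lambda>d. sqrt d * ln (free_energy x (h x + d))) \<longlongrightarrow> - C) (at_right 0)"
proof -
  obtain c where c: "c > 0" and near:
    "\<And>t. 0 < t \<Longrightarrow> t < 1 \<Longrightarrow> \<exists>M \<eta>. 0 < \<eta> \<and> \<eta> \<le> t \<and> -t < X x (h x) M \<and> (\<forall>\<^sub>F d in at_right 0.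
        X x (h x + d) M \<le> X x (h x) M / 2 \<and>
        follows_parabola t c x M \<eta> d)"
    using near_parabola[OF x] by blast
  \<comment> \<open>for \<open>x < 0\<close> the whole bottleneck is crossed, for \<open>x = 0\<close> only its right half\<close>
  define \<theta> where "\<theta> = (if x < 0 then pi else pi / 2)"
  define \<Theta> where "\<Theta> = sqrt (2 / c) * \<theta>"
  define \<kappa> where "\<kappa> = - ln p"
  have \<kappa>: "\<kappa> > 0" using p by (simp add: \<kappa>_def)
  have \<Theta>: "\<Theta> > 0" using c by (simp add: \<Theta>_def \<theta>_def)
  have h0: "0 \<le> h x" using h_nonneg x by auto
  have key: "\<exists>lo up. (lo \<longlongrightarrow> \<kappa> * \<Theta> / (1 + 4 * \<epsilon>)) (at_right 0) \<and> (up \<longlongrightarrow> \<kappa> * \<Theta> / (1 - 4 * \<epsilon>)) (at_right 0) \<and>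
      (\<forall>\<^sub>F d in at_right 0. lo d \<le> - (sqrt d * ln (free_energy x (h x + d))) \<and> - (sqrt d * ln (free_energy x (h x + d))) \<le> up d)"
    if \<epsilon>: "0 < \<epsilon>" "\<epsilon> \<le> 1 / 20" for \<epsilon>
  proof -
    obtain M \<eta> where M\<eta>: "0 < \<eta>" "\<eta> \<le> \<epsilon>" "-\<epsilon> < X x (h x) M" and ev: "\<forall>\<^sub>F d in at_right 0.
        X x (h x + d) M \<le> X x (h x) M / 2 \<and>
        follows_parabola \<epsilon> c x M \<eta> d"
      using near[of \<epsilon>] \<epsilon> by auto
    \<comment> \<open>for small \<open>d\<close> the perturbed orbit is at most at \<open>- v\<close> at time \<open>M\<close>\<close>
    define v where "v = - X x (h x) M / 2"
    define g where "g = free_energy \<eta> (\<eta>\<^sup>2 / 10)"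
    have g: "0 < g" using M\<eta> by (auto simp: g_def intro!: free_energy_pos)
    define g' where "g' = 2 * \<eta> * f (2 * \<eta>)"
    \<comment> \<open>bound for the logarithm of the free energy at the exit point\<close>
    define B where "B = \<bar>ln g\<bar> + \<bar>ln g'\<bar>"
    define L where "L d = sqrt (2 / c) * (arctan (\<eta> / sqrt (2 * (c * d))) + arctan (v / sqrt (2 * (c * d))))" for d
    define lo where "lo d = \<kappa> * (L d / (1 + 4 * \<epsilon>)) - sqrt d * B" for d
    define up where "up d = \<kappa> * (sqrt d * real M + \<Theta> / (1 - 4 * \<epsilon>)) + sqrt d * B" for d
    have vneg: "0 \<le> v" using h_trapped[OF x, of M] by (simp add: v_def)
    have sd: "((\<lambda>d. sqrt d) \<longlongrightarrow> 0) (at_right (0::real))"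
      using tendsto_real_sqrt[OF tendsto_ident_at, of 0 "{0<..}"] by simp
    have up: "(up \<longlongrightarrow> \<kappa> * \<Theta> / (1 - 4 * \<epsilon>)) (at_right 0)"
    proof -
      have "(up \<longlongrightarrow> \<kappa> * (0 * real M + \<Theta> / (1 - 4 * \<epsilon>)) + 0 * B) (at_right 0)"
        unfolding up_def using \<epsilon> by (intro tendsto_intros sd)
      then show ?thesis by simp
    qed
    have at: "((\<lambda>d. arctan (w / sqrt (2 * (c * d)))) \<longlongrightarrow> pi / 2) (at_right 0)" if w: "0 < w" for w
    proof (rule filterlim_compose[OF tendsto_arctan_at_top])
      have "((\<lambda>d. sqrt (2 * (c * d))) \<longlongrightarrow> sqrt (2 * (c * 0))) (at_right 0)"
        by (intro tendsto_intros)
      moreover have "\<forall>\<^sub>F d in at_right 0. 0 < sqrt (2 * (c * d))"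
        using eventually_at_right_less[of 0] by eventually_elim (use c in auto)
      ultimately have "filterlim (\<lambda>d. inverse (sqrt (2 * (c * d)))) at_top (at_right 0)"
        by (intro filterlim_inverse_at_top) auto
      then have "filterlim (\<lambda>d. w * inverse (sqrt (2 * (c * d)))) at_top (at_right 0)"
        using w by (intro filterlim_tendsto_pos_mult_at_top[OF tendsto_const])
      then show "filterlim (\<lambda>d. w / sqrt (2 * (c * d))) at_top (at_right 0)" by (simp add: divide_inverse)
    qed
    have Llim: "(L \<longlongrightarrow> \<Theta>) (at_right 0)"
    proof (cases "x < 0")
      case True
      then have "0 < v" using h_orbit_neg[OF x(1)] by (simp add: v_def)
      then have "(L \<longlongrightarrow> sqrt (2 / c) * (pi / 2 + pi / 2)) (at_right 0)"
        unfolding L_def using M\<eta> by (intro tendsto_intros at)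
      then show ?thesis using True by (simp add: \<Theta>_def \<theta>_def)
    next
      case False
      then have "v = 0" using x h_0[of x] by (simp add: v_def orb_zero)
      then have "(L \<longlongrightarrow> sqrt (2 / c) * (pi / 2 + arctan 0)) (at_right 0)"
        unfolding L_def using M\<eta> by (intro tendsto_intros at) auto
      then show ?thesis using False by (simp add: \<Theta>_def \<theta>_def)
    qed
    have lo: "(lo \<longlongrightarrow> \<kappa> * \<Theta> / (1 + 4 * \<epsilon>)) (at_right 0)"
    proof -
      have "(lo \<longlongrightarrow> \<kappa> * (\<Theta> / (1 + 4 * \<epsilon>)) - 0 * B) (at_right 0)"
        unfolding lo_def using \<epsilon> by (intro tendsto_intros sd Llim) auto
      then show ?thesis by simp
    qed
    have small: "\<forall>\<^sub>F d in at_right 0. c * d < z" if "0 < z" for z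
    proof -
      have "((\<lambda>d. c * d) \<longlongrightarrow> c * 0) (at_right 0)" by (intro tendsto_intros)
      then show ?thesis using that by (intro order_tendstoD(2)) auto
    qed
    have "0 < \<eta> / 4" using M\<eta> by simp
    have "\<forall>\<^sub>F d in at_right 0. lo d \<le> - (sqrt d * ln (free_energy x (h x + d))) \<and> - (sqrt d * ln (free_energy x (h x + d))) \<le> up d"
      using ev small[OF \<epsilon>(1)] small[OF \<open>0 < \<eta> / 4\<close>] eventually_at_right_less[of 0]
    proof eventually_elim
      case (elim d)
      define y where "y = h x + d"
      have d: "0 < d" and y: "0 < y" using elim h0 by (auto simp: y_def)
      have XM: "X x y M \<le> - v" using elim by (simp add: v_def y_def)
      have XM2: "X x (h x) M \<le> X x y M" using orb_mono(1)[of x "h x" x y M] x h0 d by (auto simp: y_def)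
      have esc: "\<exists>n. \<eta> < X x y n" using orbit_escapes[of x y] x d y by (auto simp: y_def)
      obtain N where N: "M < N" "\<eta> < X x y N" "X x y N \<le> 2 * \<eta>" "\<eta>\<^sup>2 / 10 \<le> Y x y N" "Y x y N \<le> g'"
        "(1 - 4 * \<epsilon>) * real (N - M) \<le> flow_time (c * d) (X x y N) - flow_time (c * d) (X x y M)"
        "flow_time (c * d) (X x y N) - flow_time (c * d) (X x y M) \<le> (1 + 4 * \<epsilon>) * real (N - M)"
        unfolding g'_def
        by (rule passage_time[of x y \<epsilon> \<eta> "c * d" M])
          (use x y \<epsilon> M\<eta> c d elim XM XM2 vneg esc in \<open>auto simp: y_def\<close>)
      define GN where "GN = free_energy (X x y N) (Y x y N)"
      have "g \<le> GN" unfolding g_def GN_def using N M\<eta> A_pos by (intro free_energy_mono) auto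
      moreover have "GN \<le> Y x y N" unfolding GN_def
        using N M\<eta> A_pos orbY_pos[OF x(1) y, of N] by (intro free_energy_tendsto) auto
      ultimately have GN: "0 < GN" "g \<le> GN" "GN \<le> g'" using g N by auto
      then have "ln g \<le> ln GN" "ln GN \<le> ln g'" using g by auto
      then have lnGN: "\<bar>ln GN\<bar> \<le> B" by (auto simp: B_def)
      have "free_energy x y = p ^ N * GN" unfolding GN_def using x y by (intro free_energy_shift) auto
      then have lnG: "ln (free_energy x y) = - \<kappa> * real N + ln GN" using GN p by (simp add: ln_mult ln_realpow \<kappa>_def)
      have ft: "sqrt d * flow_time (c * d) z = sqrt (2 / c) * arctan (z / sqrt (2 * (c * d)))" for z
      proof -
        have "sqrt d * sqrt (2 / (c * d)) = sqrt (d * (2 / (c * d)))" by (rule real_sqrt_mult[symmetric])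
        also have "d * (2 / (c * d)) = 2 / c" using d by simp
        finally show ?thesis by (simp add: flow_time_def mult.assoc[symmetric])
      qed
      define S where "S = sqrt d * (flow_time (c * d) (X x y N) - flow_time (c * d) (X x y M))"
      have S: "S = sqrt (2 / c) * (arctan (X x y N / sqrt (2 * (c * d))) - arctan (X x y M / sqrt (2 * (c * d))))"
        by (simp add: S_def right_diff_distrib ft)
      have q: "0 < sqrt (2 * (c * d))" using c d by simp
      have "L d \<le> S"
      proof -
        have "arctan (\<eta> / sqrt (2 * (c * d))) \<le> arctan (X x y N / sqrt (2 * (c * d)))"
          using N q by (intro arctan_monotone') (auto intro!: divide_right_mono)
        moreover have "arctan (X x y M / sqrt (2 * (c * d))) \<le> arctan (- (v / sqrt (2 * (c * d))))"
          using divide_right_mono[OF XM, of "sqrt (2 * (c * d))"] q by (intro arctan_monotone') auto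
        ultimately show ?thesis unfolding S L_def using c by (intro mult_left_mono) (auto simp: arctan_minus)
      qed
      have "S \<le> \<Theta>"
      proof -
        have "- arctan (X x y M / sqrt (2 * (c * d))) \<le> (if x < 0 then pi / 2 else 0)"
        proof (cases "x < 0")
          case True
          then show ?thesis using arctan_lbound[of "X x y M / sqrt (2 * (c * d))"] by simp
        next
          case False
          then have "0 \<le> X x y M" using XM2 x h_0[of x] by (simp add: orb_zero)
          then show ?thesis using False q by simp
        qed
        moreover have "arctan (X x y N / sqrt (2 * (c * d))) \<le> pi / 2" using arctan_ubound less_imp_le by blast
        ultimately have "arctan (X x y N / sqrt (2 * (c * d))) - arctan (X x y M / sqrt (2 * (c * d)))
            \<le> pi / 2 + (if x < 0 then pi / 2 else 0)" by linarith
        also have "\<dots> = \<theta>" by (simp add: \<theta>_def)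
        finally have "arctan (X x y N / sqrt (2 * (c * d))) - arctan (X x y M / sqrt (2 * (c * d))) \<le> \<theta>" .
        then show ?thesis unfolding S \<Theta>_def using c by (intro mult_left_mono) auto
      qed
      define K where "K = sqrt d * real (N - M)"
      have "sqrt d * ((1 - 4 * \<epsilon>) * real (N - M)) \<le> S" "S \<le> sqrt d * ((1 + 4 * \<epsilon>) * real (N - M))"
        unfolding S_def using N d by (auto intro!: mult_left_mono)
      then have "(1 - 4 * \<epsilon>) * K \<le> \<Theta>" "L d \<le> (1 + 4 * \<epsilon>) * K"
        using \<open>S \<le> \<Theta>\<close> \<open>L d \<le> S\<close> by (simp_all add: K_def mult.left_commute)
      then have K: "K \<le> \<Theta> / (1 - 4 * \<epsilon>)" "L d / (1 + 4 * \<epsilon>) \<le> K"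
        using \<epsilon> by (simp_all add: pos_le_divide_eq pos_divide_le_eq mult.commute)
      have KN: "sqrt d * real N = K + sqrt d * real M" using N(1) by (simp add: K_def of_nat_diff algebra_simps)
      have eq: "- (sqrt d * ln (free_energy x y)) = \<kappa> * (sqrt d * real N) - sqrt d * ln GN"
        by (simp add: lnG algebra_simps)
      have b: "sqrt d * ln GN \<le> sqrt d * B" "- (sqrt d * B) \<le> sqrt d * ln GN"
        using lnGN mult_left_mono[of "ln GN" B "sqrt d"] mult_left_mono[of "-B" "ln GN" "sqrt d"] d by auto
      have sM: "0 \<le> sqrt d * real M" using d by simp
      have "\<kappa> * (L d / (1 + 4 * \<epsilon>)) \<le> \<kappa> * (sqrt d * real N)"
        using K KN sM \<kappa> by (intro mult_left_mono) auto
      moreover have "\<kappa> * (sqrt d * real N) \<le> \<kappa> * (sqrt d * real M + \<Theta> / (1 - 4 * \<epsilon>))"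
        using K KN \<kappa> by (intro mult_left_mono) auto
      ultimately show ?case unfolding y_def[symmetric] eq lo_def up_def using b by linarith
    qed
    then show ?thesis using lo up by blast
  qed
  \<comment> \<open>the limits of \<open>lo\<close> and \<open>up\<close> are arbitrarily close to each other for small \<open>\<epsilon>\<close>\<close>
  have "((\<lambda>d. - (sqrt d * ln (free_energy x (h x + d)))) \<longlongrightarrow> \<kappa> * \<Theta>) (at_right 0)"
  proof (rule order_tendstoI)
    fix a assume a: "a < \<kappa> * \<Theta>"
    have "((\<lambda>\<epsilon>. \<kappa> * \<Theta> / (1 + 4 * \<epsilon>)) \<longlongrightarrow> \<kappa> * \<Theta> / (1 + 4 * 0)) (at_right 0)" by (intro tendsto_intros) auto
    then have "\<forall>\<^sub>F \<epsilon> in at_right 0. a < \<kappa> * \<Theta> / (1 + 4 * \<epsilon>)" using a by (intro order_tendstoD) auto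
    moreover have "\<forall>\<^sub>F \<epsilon> in at_right 0. \<epsilon> \<in> {0<..<1 / 20 :: real}" by (intro eventually_at_rightI[of 0 "1/20"]) auto
    ultimately have "\<forall>\<^sub>F \<epsilon> in at_right 0. a < \<kappa> * \<Theta> / (1 + 4 * \<epsilon>) \<and> \<epsilon> \<in> {0<..<1 / 20}" by eventually_elim auto
    then obtain \<epsilon> where \<epsilon>: "a < \<kappa> * \<Theta> / (1 + 4 * \<epsilon>)" "0 < \<epsilon>" "\<epsilon> \<le> 1 / 20"
      using eventually_happens'[of "at_right (0::real)"] by force
    obtain lo where lo: "(lo \<longlongrightarrow> \<kappa> * \<Theta> / (1 + 4 * \<epsilon>)) (at_right 0)"
      "\<forall>\<^sub>F d in at_right 0. lo d \<le> - (sqrt d * ln (free_energy x (h x + d)))"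
      using key[OF \<epsilon>(2,3)] by (auto simp: eventually_conj_iff)
    show "\<forall>\<^sub>F d in at_right 0. a < - (sqrt d * ln (free_energy x (h x + d)))"
      using order_tendstoD(1)[OF lo(1) \<epsilon>(1)] lo(2) by eventually_elim auto
  next
    fix a assume a: "\<kappa> * \<Theta> < a"
    have "((\<lambda>\<epsilon>. \<kappa> * \<Theta> / (1 - 4 * \<epsilon>)) \<longlongrightarrow> \<kappa> * \<Theta> / (1 - 4 * 0)) (at_right 0)" by (intro tendsto_intros) auto
    then have "\<forall>\<^sub>F \<epsilon> in at_right 0. \<kappa> * \<Theta> / (1 - 4 * \<epsilon>) < a" using a by (intro order_tendstoD) auto
    moreover have "\<forall>\<^sub>F \<epsilon> in at_right 0. \<epsilon> \<in> {0<..<1 / 20 :: real}" by (intro eventually_at_rightI[of 0 "1/20"]) auto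
    ultimately have "\<forall>\<^sub>F \<epsilon> in at_right 0. \<kappa> * \<Theta> / (1 - 4 * \<epsilon>) < a \<and> \<epsilon> \<in> {0<..<1 / 20}" by eventually_elim auto
    then obtain \<epsilon> where \<epsilon>: "\<kappa> * \<Theta> / (1 - 4 * \<epsilon>) < a" "0 < \<epsilon>" "\<epsilon> \<le> 1 / 20"
      using eventually_happens'[of "at_right (0::real)"] by force
    obtain up where up: "(up \<longlongrightarrow> \<kappa> * \<Theta> / (1 - 4 * \<epsilon>)) (at_right 0)"
      "\<forall>\<^sub>F d in at_right 0. - (sqrt d * ln (free_energy x (h x + d))) \<le> up d"
      using key[OF \<epsilon>(2,3)] by (auto simp: eventually_conj_iff)
    show "\<forall>\<^sub>F d in at_right 0. - (sqrt d * ln (free_energy x (h x + d))) < a"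
      using order_tendstoD(2)[OF up(1) \<epsilon>(1)] up(2) by eventually_elim auto
  qed
  from tendsto_minus[OF this] have "((\<lambda>d. sqrt d * ln (free_energy x (h x + d))) \<longlongrightarrow> - (\<kappa> * \<Theta>)) (at_right 0)" by simp
  then show thesis using \<kappa> \<Theta> by (intro that[of "\<kappa> * \<Theta>"]) auto
qed

end

section \<open>Generating functions of laws on the natural numbers\<close>

lemma integrable_power_pmf:
  assumes "\<bar>s\<bar> \<le> (1::real)" shows "integrable (measure_pmf q) (\<lambda>k. s ^ k)"
  by (rule measure_pmf.integrable_const_bound[of _ 1]) (use assms in \<open>auto simp: power_abs power_le_one\<close>)

lemma DR_phi_sums:
  assumes "\<bar>s\<bar> \<le> 1" shows "(\<lambda>n. pmf q n * s ^ n) sums DR_phi q s"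
proof -
  have "integrable (count_space UNIV) (\<lambda>n. pmf q n *\<^sub>R s ^ n)"
    using integrable_power_pmf[OF assms, of q] unfolding measure_pmf_eq_density
    by (subst (asm) integrable_density) auto
  then have "(\<lambda>n. pmf q n *\<^sub>R s ^ n) sums (\<integral>n. pmf q n *\<^sub>R s ^ n \<partial>count_space UNIV)"
    by (rule sums_integral_count_space_nat)
  also have "(\<integral>n. pmf q n *\<^sub>R s ^ n \<partial>count_space UNIV) = DR_phi q s"
    unfolding DR_phi_def measure_pmf_eq_density by (subst integral_density) auto
  finally show ?thesis by simp
qed

lemma DR_phi_nonneg: "0 \<le> s \<Longrightarrow> 0 \<le> DR_phi q s"
  unfolding DR_phi_def by (intro integral_nonneg_AE) auto

lemma DR_phi_le_1: assumes "0 \<le> s" "s \<le> 1" shows "DR_phi q s \<le> 1"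
proof -
  have "DR_phi q s \<le> (\<integral>k. 1 \<partial>measure_pmf q)"
    unfolding DR_phi_def using assms
    by (intro integral_mono integrable_power_pmf) (auto simp: power_le_one)
  then show ?thesis by simp
qed

lemma nn_integral_power_pmf:
  assumes "0 \<le> s" "s \<le> 1"
  shows "(\<integral>\<^sup>+k. ennreal (s ^ k) \<partial>measure_pmf q) = ennreal (DR_phi q s)"
  unfolding DR_phi_def using assms by (intro nn_integral_eq_integral integrable_power_pmf) auto

lemma DR_phi_bind:
  assumes "0 \<le> s" "s \<le> 1"
  shows "DR_phi (bind_pmf q f) s = (\<integral>x. DR_phi (f x) s \<partial>measure_pmf q)"
proof -
  have "ennreal (DR_phi (bind_pmf q f) s) = (\<integral>\<^sup>+x. ennreal (DR_phi (f x) s) \<partial>measure_pmf q)"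
    by (simp add: nn_integral_power_pmf[OF assms, symmetric] nn_integral_bind_pmf)
  also have "\<dots> = ennreal (\<integral>x. DR_phi (f x) s \<partial>measure_pmf q)"
    using DR_phi_nonneg[OF assms(1)] DR_phi_le_1[OF assms]
    by (intro nn_integral_eq_integral measure_pmf.integrable_const_bound[of _ 1]) auto
  finally show ?thesis
    using DR_phi_nonneg[OF assms(1)] by (subst (asm) ennreal_inj) (auto intro!: integral_nonneg_AE)
qed

lemma DR_phi_map: "DR_phi (map_pmf g q) s = (\<integral>k. s ^ g k \<partial>measure_pmf q)"
  by (simp add: DR_phi_def)

text \<open>The coefficients of the difference vanish by the usual argument: divide by the lowest power and let \<open>s\<close> tend
  to 0. Values in the open unit interval suffice, and there dividing by \<open>s\<close> is harmless.\<close>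

lemma DR_phi_inject:
  assumes eq: "\<And>s. 0 < s \<Longrightarrow> s < 1 \<Longrightarrow> DR_phi q s = DR_phi q' s"
  shows "q = q'"
proof (rule ccontr)
  assume "q \<noteq> q'"
  define a where "a n = pmf q n - pmf q' n" for n
  have ex: "\<exists>n. a n \<noteq> 0" using \<open>q \<noteq> q'\<close> by (auto simp: a_def intro: pmf_eqI)
  define n where "n = (LEAST n. a n \<noteq> 0)"
  have an: "a n \<noteq> 0" unfolding n_def using ex by (rule LeastI_ex)
  have a0: "a k = 0" if "k < n" for k using not_less_Least that unfolding n_def by blast
  have sums: "(\<lambda>k. a k * s ^ k) sums (DR_phi q s - DR_phi q' s)" if "\<bar>s\<bar> \<le> 1" for s
    using sums_diff[OF DR_phi_sums[OF that, of q] DR_phi_sums[OF that, of q']] by (simp add: a_def algebra_simps)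
  \<comment> \<open>the difference of the two series, divided by its lowest power\<close>
  define F where "F s = (\<Sum>k. a (k + n) * s ^ k)" for s
  have summ: "summable (\<lambda>k. a (k + n) * s ^ k)" if "\<bar>s\<bar> < 1" for s
  proof (cases "s = 0")
    case False
    have "summable (\<lambda>k. a (k + n) * s ^ (k + n))"
      using summable_ignore_initial_segment[OF sums_summable[OF sums[of s]], of n] that by auto
    then have "summable (\<lambda>k. s ^ n * (a (k + n) * s ^ k))" by (simp add: power_add mult_ac)
    then show ?thesis using False by (intro summable_mult_D[of "s ^ n" "\<lambda>k. a (k + n) * s ^ k"]) auto
  qed (auto intro: summable_finite[of "{0}"])
  have F0: "F s = 0" if "0 < s" "s < 1" for s
  proof -
    have "(\<lambda>k. a k * s ^ k) sums 0" using sums[of s] eq[of s] that by simp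
    then have "(\<lambda>k. a (k + n) * s ^ (k + n)) sums 0"
      using sums_split_initial_segment[of "\<lambda>k. a k * s ^ k" 0 n] a0 by simp
    then have "(\<lambda>k. (a (k + n) * s ^ k) * s ^ n) sums 0" by (simp add: power_add mult.assoc)
    moreover have "(\<lambda>k. (a (k + n) * s ^ k) * s ^ n) sums (F s * s ^ n)"
      unfolding F_def using summ[of s] that by (intro sums_mult2 summable_sums) auto
    ultimately have "F s * s ^ n = 0" using sums_unique2 by blast
    then show ?thesis using that by simp
  qed
  have "(F \<longlongrightarrow> a (0 + n)) (at 0)"
    by (rule powser_limit_0[of 1]) (use summ in \<open>auto simp: F_def intro: summable_sums\<close>)
  then have 1: "(F \<longlongrightarrow> a n) (at_right 0)" by (simp add: filterlim_at_split)
  have "\<forall>\<^sub>F s in at_right 0. s \<in> {0<..<1::real}" by (intro eventually_at_rightI[of 0 1]) auto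
  then have "\<forall>\<^sub>F s in at_right 0. F s = 0" by eventually_elim (use F0 in auto)
  then have "(F \<longlongrightarrow> 0) (at_right 0)" using tendsto_eventually by blast
  then show False using 1 an tendsto_unique[OF _ 1] by (metis trivial_limit_at_right_real)
qed

lemma DR_phi_geometric:
  assumes p: "0 < p" "p \<le> 1" and s: "0 \<le> s" "s \<le> 1"
  shows "DR_phi (geometric_pmf p) s = p / (1 - (1 - p) * s)"
proof -
  have "(1 - p) * s \<le> (1 - p) * 1" using p s by (intro mult_left_mono) auto
  then have "\<bar>(1 - p) * s\<bar> < 1" using p s by auto
  then have "(\<lambda>n. p * ((1 - p) * s) ^ n) sums (p * (1 / (1 - (1 - p) * s)))"
    by (intro sums_mult geometric_sums) auto
  moreover have "(\<lambda>n. pmf (geometric_pmf p) n * s ^ n) sums DR_phi (geometric_pmf p) s"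
    using s by (intro DR_phi_sums) auto
  ultimately show ?thesis using p by (simp add: power_mult_distrib mult_ac sums_unique2)
qed

lemma DR_phi_DR_R:
  assumes p: "0 < p" "p \<le> 1" and s: "0 \<le> s" "s \<le> 1"
  shows "DR_phi (DR_R p) s = p * s / (1 - (1 - p) * s)"
  unfolding DR_R_def DR_phi_map using DR_phi_geometric[OF assms] by (simp add: DR_phi_def)

section \<open>Linear fractional laws\<close>

text \<open>The positive part of a linear fractional law is a shifted geometric law, so the law is a mixture of it with
  a point mass at 0.\<close>

definition lf_pmf :: "real \<Rightarrow> real \<Rightarrow> nat pmf" where
  "lf_pmf \<alpha> \<beta> = bind_pmf (bernoulli_pmf (1 / (\<alpha> + \<beta>)))
     (\<lambda>B. if B then map_pmf Suc (geometric_pmf (\<alpha> / (\<alpha> + \<beta>))) else return_pmf 0)"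

lemma DR_phi_lf_pmf:
  assumes ab: "\<alpha> > 0" "\<beta> > 0" "\<alpha> + \<beta> \<ge> 1" and s: "0 \<le> s" "s \<le> 1"
  shows "DR_phi (lf_pmf \<alpha> \<beta>) s = 1 - (1 - s) / (\<alpha> + \<beta> * (1 - s))"
proof -
  define \<theta> where "\<theta> = \<alpha> / (\<alpha> + \<beta>)"
  have \<theta>: "0 < \<theta>" "\<theta> \<le> 1" using ab by (auto simp: \<theta>_def)
  have d: "\<alpha> + \<beta> * (1 - s) > 0" using ab s by (intro add_pos_nonneg) auto
  have 1: "1 - (1 - \<theta>) * s = (\<alpha> + \<beta> * (1 - s)) / (\<alpha> + \<beta>)" using ab by (simp add: \<theta>_def field_simps)
  have "DR_phi (map_pmf Suc (geometric_pmf \<theta>)) s = s * DR_phi (geometric_pmf \<theta>) s"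
    by (simp add: DR_phi_map) (simp add: DR_phi_def)
  also have "\<dots> = s * \<alpha> / (\<alpha> + \<beta> * (1 - s))"
    unfolding DR_phi_geometric[OF \<theta> s] 1 using ab d by (simp add: \<theta>_def)
  finally have 2: "DR_phi (map_pmf Suc (geometric_pmf \<theta>)) s = s * \<alpha> / (\<alpha> + \<beta> * (1 - s))" .
  have "DR_phi (lf_pmf \<alpha> \<beta>) s = s * \<alpha> / (\<alpha> + \<beta> * (1 - s)) * (1 / (\<alpha> + \<beta>)) + (1 - 1 / (\<alpha> + \<beta>))"
    unfolding lf_pmf_def DR_phi_bind[OF s] \<theta>_def[symmetric] using ab
    by (subst integral_bernoulli_pmf) (auto simp: 2, auto simp: DR_phi_def)
  also have "\<dots> = 1 - (1 - s) / (\<alpha> + \<beta> * (1 - s))"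
  proof -
    define D where "D = \<alpha> + \<beta> * (1 - s)"
    have D: "0 < D" using d by (simp add: D_def)
    have "(1 - s) * (\<alpha> + \<beta>) = D - s * \<alpha>" by (simp add: D_def algebra_simps)
    moreover have "(1 - s) / D = ((1 - s) * (\<alpha> + \<beta>)) / D * (1 / (\<alpha> + \<beta>))" using ab by simp
    ultimately have "(1 - s) / D = (D - s * \<alpha>) / D * (1 / (\<alpha> + \<beta>))" by simp
    also have "(D - s * \<alpha>) / D = 1 - s * \<alpha> / D" using D by (simp add: diff_divide_distrib)
    finally have "(1 - s) / D = 1 / (\<alpha> + \<beta>) - s * \<alpha> / D * (1 / (\<alpha> + \<beta>))"
      by (simp only: left_diff_distrib mult_1_left)
    then show ?thesis unfolding D_def[symmetric] by simp
  qed
  finally show ?thesis .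
qed

text \<open>The description of \<open>LF\<close> by its generating function is meaningful because \<open>lf_pmf\<close> realizes it and generating
  functions are injective.\<close>

lemma LF_eqI:
  assumes ab: "\<alpha> > 0" "\<beta> > 0" "\<alpha> + \<beta> \<ge> 1"
    and q: "\<And>s. 0 < s \<Longrightarrow> s < 1 \<Longrightarrow> DR_phi q s = 1 - (1 - s) / (\<alpha> + \<beta> * (1 - s))"
  shows "q = LF \<alpha> \<beta>"
proof -
  have "LF \<alpha> \<beta> = lf_pmf \<alpha> \<beta>"
    unfolding LF_def DR_phi_def[symmetric]
  proof (rule the_equality)
    show "\<forall>s\<in>{0..1}. DR_phi (lf_pmf \<alpha> \<beta>) s = 1 - (1 - s) / (\<alpha> + \<beta> * (1 - s))"
      using DR_phi_lf_pmf[OF ab] by auto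
    fix q assume "\<forall>s\<in>{0..1}. DR_phi q s = 1 - (1 - s) / (\<alpha> + \<beta> * (1 - s))"
    then show "q = lf_pmf \<alpha> \<beta>" using DR_phi_lf_pmf[OF ab] by (intro DR_phi_inject) auto
  qed
  moreover have "q = lf_pmf \<alpha> \<beta>" using DR_phi_lf_pmf[OF ab] q by (intro DR_phi_inject) auto
  ultimately show ?thesis by simp
qed

lemma DR_phi_LF:
  assumes ab: "\<alpha> > 0" "\<beta> > 0" "\<alpha> + \<beta> \<ge> 1" and s: "0 \<le> s" "s \<le> 1"
  shows "DR_phi (LF \<alpha> \<beta>) s = 1 - (1 - s) / (\<alpha> + \<beta> * (1 - s))"
  using LF_eqI[OF ab DR_phi_lf_pmf[OF ab]] DR_phi_lf_pmf[OF ab s] by auto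

lemma LF_mean:
  assumes ab: "\<alpha> > 0" "\<beta> > 0" "\<alpha> + \<beta> \<ge> 1"
  shows "measure_pmf.expectation (LF \<alpha> \<beta>) real = 1 / \<alpha>"
proof -
  define \<theta> where "\<theta> = \<alpha> / (\<alpha> + \<beta>)"
  have \<theta>: "0 < \<theta>" "\<theta> \<le> 1" using ab by (auto simp: \<theta>_def)
  have \<theta>2: "\<theta> \<in> {0<..1}" using \<theta> by auto
  have int: "integrable (measure_pmf (geometric_pmf \<theta>)) real"
    using integrable_real_geometric_pmf[OF \<theta>2] .
  have "(\<integral>\<^sup>+k. ennreal (real (Suc k)) \<partial>measure_pmf (geometric_pmf \<theta>)) =
      ennreal (\<integral>k. real (Suc k) \<partial>measure_pmf (geometric_pmf \<theta>))"
    using int by (intro nn_integral_eq_integral) auto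
  also have "(\<integral>k. real (Suc k) \<partial>measure_pmf (geometric_pmf \<theta>)) = 1 / \<theta>"
    using int expectation_geometric_pmf[OF \<theta>2] \<theta> by (simp add: field_simps)
  finally have 1: "(\<integral>\<^sup>+k. ennreal (real (Suc k)) \<partial>measure_pmf (geometric_pmf \<theta>)) = ennreal (1 / \<theta>)" .
  have "(\<integral>\<^sup>+k. ennreal (real k) \<partial>measure_pmf (lf_pmf \<alpha> \<beta>)) = ennreal (1 / \<theta>) * ennreal (1 / (\<alpha> + \<beta>))"
    unfolding lf_pmf_def nn_integral_bind_pmf \<theta>_def[symmetric] using ab
    by (subst nn_integral_bernoulli_pmf) (use 1 in \<open>auto simp del: of_nat_Suc\<close>)
  also have "\<dots> = ennreal (1 / \<alpha>)" using ab by (subst ennreal_mult[symmetric]) (auto simp: \<theta>_def)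
  finally have "(\<integral>k. real k \<partial>measure_pmf (lf_pmf \<alpha> \<beta>)) = 1 / \<alpha>"
    using ab by (subst integral_eq_nn_integral) auto
  then show ?thesis using LF_eqI[OF ab DR_phi_lf_pmf[OF ab]] by auto
qed

section \<open>One step of the model\<close>

primrec iid_sum_pmf :: "nat pmf \<Rightarrow> nat \<Rightarrow> nat pmf" where
  "iid_sum_pmf q 0 = return_pmf 0"
| "iid_sum_pmf q (Suc r) = bind_pmf (iid_sum_pmf q r) (\<lambda>t. map_pmf (\<lambda>a. t + a) q)"

lemma DR_phi_iid_sum:
  assumes "0 \<le> s" "s \<le> 1" shows "DR_phi (iid_sum_pmf q r) s = DR_phi q s ^ r"
proof (induction r)
  case (Suc r)
  have "DR_phi (map_pmf (\<lambda>a. t + a) q) s = s ^ t * DR_phi q s" for t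
    by (simp add: DR_phi_map power_add) (simp add: DR_phi_def)
  then have "DR_phi (iid_sum_pmf q (Suc r)) s = (\<integral>t. s ^ t * DR_phi q s \<partial>measure_pmf (iid_sum_pmf q r))"
    by (simp add: DR_phi_bind[OF assms])
  also have "\<dots> = DR_phi (iid_sum_pmf q r) s * DR_phi q s" by (simp add: DR_phi_def)
  finally show ?case using Suc by (simp add: mult.commute)
qed (simp add: DR_phi_def)

text \<open>Only the first \<open>r\<close> coordinates matter, so the infinite product is projected to a finite one; there the
  coordinates are integrated out one at a time.\<close>

lemma nn_integral_iid_sum:
  fixes q :: "nat pmf"
  defines "\<nu> \<equiv> distr (measure_pmf q) borel real"
  assumes [measurable]: "G \<in> borel_measurable borel"
  shows "(\<integral>\<^sup>+x. G (\<Sum>k=1..r. x k) \<partial>(\<Pi>\<^sub>M k\<in>{1::nat..}. \<nu>)) =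
    (\<integral>\<^sup>+t. G (real t) \<partial>measure_pmf (iid_sum_pmf q r))"
proof -
  interpret \<nu>: prob_space \<nu> unfolding \<nu>_def by (rule measure_pmf.prob_space_distr) simp
  have [measurable_cong]: "sets \<nu> = sets borel" by (simp add: \<nu>_def)
  interpret product_prob_space "\<lambda>_::nat. \<nu>" "{1..}" by standard
  have fin: "(\<integral>\<^sup>+x. G (\<Sum>k=1..r. x k) \<partial>(\<Pi>\<^sub>M k\<in>{1..r}. \<nu>)) =
      (\<integral>\<^sup>+t. G (real t) \<partial>measure_pmf (iid_sum_pmf q r))"
    if "G \<in> borel_measurable borel" for r and G :: "real \<Rightarrow> ennreal"
    using that
  proof (induction r arbitrary: G)
    case 0
    then show ?case by (simp add: PiM_empty nn_integral_count_space_finite)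
  next
    case (Suc r)
    note [measurable] = Suc.prems
    have ins: "{1..Suc r} = insert (Suc r) {1..r}" by auto
    have "(\<integral>\<^sup>+x. G (\<Sum>k=1..Suc r. x k) \<partial>(\<Pi>\<^sub>M k\<in>{1..Suc r}. \<nu>)) =
        (\<integral>\<^sup>+x. (\<integral>\<^sup>+y. G (\<Sum>k=1..Suc r. (x(Suc r := y)) k) \<partial>\<nu>) \<partial>(\<Pi>\<^sub>M k\<in>{1..r}. \<nu>))"
      unfolding ins by (subst product_nn_integral_insert) auto
    also have "\<dots> = (\<integral>\<^sup>+x. (\<integral>\<^sup>+y. G ((\<Sum>k=1..r. x k) + y) \<partial>\<nu>) \<partial>(\<Pi>\<^sub>M k\<in>{1..r}. \<nu>))"
      by (intro nn_integral_cong arg_cong[of _ _ G]) (auto intro!: sum.cong)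
    also have "\<dots> = (\<integral>\<^sup>+t. (\<integral>\<^sup>+y. G (real t + y) \<partial>\<nu>) \<partial>measure_pmf (iid_sum_pmf q r))"
      by (rule Suc.IH) measurable
    also have "\<dots> = (\<integral>\<^sup>+t. (\<integral>\<^sup>+a. G (real (t + a)) \<partial>measure_pmf q) \<partial>measure_pmf (iid_sum_pmf q r))"
      unfolding \<nu>_def by (subst nn_integral_distr) auto
    also have "\<dots> = (\<integral>\<^sup>+t. G (real t) \<partial>measure_pmf (iid_sum_pmf q (Suc r)))"
      by (simp add: nn_integral_bind_pmf)
    finally show ?case .
  qed
  have "(\<integral>\<^sup>+x. G (\<Sum>k=1..r. x k) \<partial>(\<Pi>\<^sub>M k\<in>{1..r}. \<nu>)) =
      (\<integral>\<^sup>+x. G (\<Sum>k=1..r. x k) \<partial>distr (\<Pi>\<^sub>M k\<in>{1..}. \<nu>) (\<Pi>\<^sub>M k\<in>{1..r}. \<nu>) (\<lambda>x. restrict x {1..r}))"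
    by (subst distr_PiM_restrict_finite) auto
  also have "\<dots> = (\<integral>\<^sup>+x. G (\<Sum>k=1..r. restrict x {1..r} k) \<partial>(\<Pi>\<^sub>M k\<in>{1..}. \<nu>))"
    by (subst nn_integral_distr) (auto intro!: measurable_restrict_subset)
  also have "\<dots> = (\<integral>\<^sup>+x. G (\<Sum>k=1..r. x k) \<partial>(\<Pi>\<^sub>M k\<in>{1..}. \<nu>))"
    by (intro nn_integral_cong arg_cong[of _ _ G] sum.cong) auto
  finally show ?thesis using fin[OF assms(2), of r] by simp
qed

text \<open>One step of the model on integer-valued laws. Truncated subtraction on the naturals is the positive part.\<close>

definition step_pmf :: "real \<Rightarrow> nat pmf \<Rightarrow> nat pmf \<Rightarrow> nat pmf" where
  "step_pmf p Z q = bind_pmf (bind_pmf (DR_R p) (iid_sum_pmf q)) (\<lambda>t. map_pmf (\<lambda>z. t - z) Z)"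

lemma emeasure_distr_eq_nn_integral:
  assumes "F \<in> measurable M N" "A \<in> sets N"
  shows "emeasure (distr M N F) A = (\<integral>\<^sup>+w. indicator A (F w) \<partial>M)"
proof -
  have "emeasure (distr M N F) A = (\<integral>\<^sup>+y. indicator A y \<partial>distr M N F)"
    using assms by (intro nn_integral_indicator[symmetric]) simp
  also have "\<dots> = (\<integral>\<^sup>+w. indicator A (F w) \<partial>M)" using assms by (intro nn_integral_distr) auto
  finally show ?thesis .
qed

text \<open>Fubini reduces the step to the law of the sum for a fixed number of summands.\<close>

lemma DR_step_distr:
  "DR_step p Z (distr (measure_pmf q) borel real) = distr (measure_pmf (step_pmf p Z q)) borel real"
proof (rule measure_eqI)
  define \<nu> where "\<nu> = distr (measure_pmf q) borel real"
  interpret \<nu>: prob_space \<nu> unfolding \<nu>_def by (rule measure_pmf.prob_space_distr) simp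
  have [measurable_cong]: "sets \<nu> = sets borel" by (simp add: \<nu>_def)
  interpret P: product_prob_space "\<lambda>_::nat. \<nu>" "{1..}" by standard
  interpret W: pair_prob_space "PiM {1::nat..} (\<lambda>_. \<nu>)" "measure_pmf Z" by standard
  show "sets (DR_step p Z (distr (measure_pmf q) borel real)) =
      sets (distr (measure_pmf (step_pmf p Z q)) borel real)" by (simp add: DR_step_def)
  fix A :: "real set" assume "A \<in> sets (DR_step p Z (distr (measure_pmf q) borel real))"
  then have A[measurable]: "A \<in> sets borel" by (simp add: DR_step_def)
  let ?M = "measure_pmf (DR_R p) \<Otimes>\<^sub>M ((\<Pi>\<^sub>M k\<in>{1::nat..}. \<nu>) \<Otimes>\<^sub>M measure_pmf Z)"
  let ?F = "\<lambda>(r, x, z). max 0 ((\<Sum>k=1..r. x k) - real z) :: real"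
  have F1[measurable]: "(\<lambda>(x, z). max 0 ((\<Sum>k=1..r. x k) - real z)) \<in>
      borel_measurable ((\<Pi>\<^sub>M k\<in>{1::nat..}. \<nu>) \<Otimes>\<^sub>M measure_pmf Z)" for r :: nat
    by measurable
  have "?F \<in> borel_measurable (count_space UNIV \<Otimes>\<^sub>M ((\<Pi>\<^sub>M k\<in>{1::nat..}. \<nu>) \<Otimes>\<^sub>M measure_pmf Z))"
    by (rule measurable_pair_measure_countable1) (use F1 in auto)
  then have F[measurable]: "?F \<in> borel_measurable ?M"
    by (subst measurable_cong_sets[OF sets_pair_measure_cong[OF sets_measure_pmf_count_space refl] refl])
  have "emeasure (DR_step p Z \<nu>) A = (\<integral>\<^sup>+w. indicator A (?F w) \<partial>?M)"
    unfolding DR_step_def by (rule emeasure_distr_eq_nn_integral[OF F A])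
  also have "\<dots> = (\<integral>\<^sup>+r. \<integral>\<^sup>+w. indicator A (?F (r, w)) \<partial>((\<Pi>\<^sub>M k\<in>{1::nat..}. \<nu>) \<Otimes>\<^sub>M measure_pmf Z) \<partial>measure_pmf (DR_R p))"
    by (rule W.P.nn_integral_fst[symmetric]) measurable
  also have "\<dots> = (\<integral>\<^sup>+r. \<integral>\<^sup>+x. \<integral>\<^sup>+z. indicator A (max 0 ((\<Sum>k=1..r. x k) - real z)) \<partial>measure_pmf Z
      \<partial>(\<Pi>\<^sub>M k\<in>{1::nat..}. \<nu>) \<partial>measure_pmf (DR_R p))"
  proof (intro nn_integral_cong)
    fix r
    have "(\<lambda>w. indicator A (?F (r, w)) :: ennreal) \<in> borel_measurable ((\<Pi>\<^sub>M k\<in>{1::nat..}. \<nu>) \<Otimes>\<^sub>M measure_pmf Z)"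
      using measurable_compose[OF F1[of r], of "indicator A :: real \<Rightarrow> ennreal" borel] by simp
    then show "(\<integral>\<^sup>+w. indicator A (?F (r, w)) \<partial>((\<Pi>\<^sub>M k\<in>{1::nat..}. \<nu>) \<Otimes>\<^sub>M measure_pmf Z)) =
      (\<integral>\<^sup>+x. \<integral>\<^sup>+z. indicator A (max 0 ((\<Sum>k=1..r. x k) - real z)) \<partial>measure_pmf Z \<partial>(\<Pi>\<^sub>M k\<in>{1::nat..}. \<nu>))"
      by (subst measure_pmf.nn_integral_fst[symmetric]) auto
  qed
  also have "\<dots> = (\<integral>\<^sup>+r. \<integral>\<^sup>+t. \<integral>\<^sup>+z. indicator A (max 0 (real t - real z)) \<partial>measure_pmf Z
      \<partial>measure_pmf (iid_sum_pmf q r) \<partial>measure_pmf (DR_R p))"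
  proof (intro nn_integral_cong)
    fix r
    have "(\<lambda>u. \<integral>\<^sup>+z. indicator A (max 0 (u - real z)) \<partial>measure_pmf Z) \<in> borel_measurable borel"
      by (intro measure_pmf.borel_measurable_nn_integral) measurable
    then show "(\<integral>\<^sup>+x. \<integral>\<^sup>+z. indicator A (max 0 ((\<Sum>k=1..r. x k) - real z)) \<partial>measure_pmf Z
          \<partial>(\<Pi>\<^sub>M k\<in>{1::nat..}. \<nu>)) =
        (\<integral>\<^sup>+t. \<integral>\<^sup>+z. indicator A (max 0 (real t - real z)) \<partial>measure_pmf Z \<partial>measure_pmf (iid_sum_pmf q r))"
      unfolding \<nu>_def by (rule nn_integral_iid_sum)
  qed
  also have "\<dots> = (\<integral>\<^sup>+t. indicator A (real t) \<partial>measure_pmf (step_pmf p Z q))"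
    
  proof -
    have "max 0 (real t - real z) = real (t - z)" for t z :: nat by (cases "z \<le> t") (auto simp: of_nat_diff)
    then show ?thesis by (simp add: step_pmf_def nn_integral_bind_pmf)
  qed
  also have "\<dots> = emeasure (distr (measure_pmf (step_pmf p Z q)) borel real) A"
    by (rule emeasure_distr_eq_nn_integral[symmetric]) auto
  finally show "emeasure (DR_step p Z (distr (measure_pmf q) borel real)) A =
    emeasure (distr (measure_pmf (step_pmf p Z q)) borel real) A" by (simp add: \<nu>_def)
qed

lemma DR_phi_pos: assumes "0 < s" "s \<le> 1" shows "0 < DR_phi q s"
proof -
  obtain n where "n \<in> set_pmf q" using set_pmf_not_empty[of q] by blast
  then have "0 < pmf q n * s ^ n" using assms by (simp add: pmf_positive)
  also have "\<dots> \<le> (\<Sum>k\<in>{n}. pmf q k * s ^ k)" by simp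
  also have "\<dots> \<le> DR_phi q s"
    using sum_le_suminf[of "\<lambda>k. pmf q k * s ^ k" "{n}"] sums_summable[OF DR_phi_sums[of s q]]
      sums_unique[OF DR_phi_sums[of s q]] assms by simp
  finally show ?thesis .
qed

section \<open>Invariance of the linear fractional family\<close>

text \<open>A geometric sum composes the generating function with the fractional linear map \<open>u \<mapsto> p u / (1 - (1 - p) u)\<close>, and
  fractional linear maps are closed under composition.\<close>

lemma LF_geometric_sum:
  assumes p: "0 < p" "p < 1" and ab: "\<alpha> > 0" "\<beta> > 0" "\<alpha> + \<beta> \<ge> 1"
  shows "bind_pmf (DR_R p) (iid_sum_pmf (LF \<alpha> \<beta>)) = LF (p * \<alpha>) (p * \<beta> + 1 - p)"
proof (rule LF_eqI)
  have "p * 1 \<le> p * (\<alpha> + \<beta>)" using p ab by (intro mult_left_mono) auto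
  then show "1 \<le> p * \<alpha> + (p * \<beta> + 1 - p)" by (simp add: algebra_simps)
  show "0 < p * \<beta> + 1 - p" using p ab add_pos_pos[of "p * \<beta>" "1 - p"] by (simp add: algebra_simps)
  fix s :: real assume s: "0 < s" "s < 1"
  define f where "f = DR_phi (LF \<alpha> \<beta>) s"
  define u where "u = 1 - s"
  define D where "D = \<alpha> + \<beta> * u"
  define E where "E = p * D + (1 - p) * u"
  have u: "0 < u" using s by (simp add: u_def)
  then have D: "0 < D" using ab by (simp add: D_def add_pos_pos)
  then have pos: "0 < u" "0 < D" "0 < E" using p u by (auto simp: E_def add_pos_pos)
  have f: "0 \<le> f" "f \<le> 1" using s by (auto simp: f_def DR_phi_nonneg DR_phi_le_1)
  have fD: "f = (D - u) / D" using s DR_phi_LF[OF ab, of s] pos by (simp add: f_def D_def u_def diff_divide_distrib)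
  have "DR_phi (bind_pmf (DR_R p) (iid_sum_pmf (LF \<alpha> \<beta>))) s = (\<integral>r. f ^ r \<partial>measure_pmf (DR_R p))"
    using s by (simp add: DR_phi_bind DR_phi_iid_sum f_def)
  also have "\<dots> = p * f / (1 - (1 - p) * f)" using DR_phi_DR_R[of p f] p f by (simp add: DR_phi_def)
  also have "1 - (1 - p) * f = E / D" using pos by (simp add: fD E_def field_simps)
  also have "p * f / (E / D) = (p * (D - u)) / E" using pos by (simp add: fD)
  also have "p * (D - u) = E - u" by (simp add: E_def algebra_simps)
  also have "(E - u) / E = 1 - u / E" using pos by (simp add: diff_divide_distrib)
  also have "E = p * \<alpha> + (p * \<beta> + 1 - p) * u" by (simp add: E_def D_def algebra_simps)
  finally show "DR_phi (bind_pmf (DR_R p) (iid_sum_pmf (LF \<alpha> \<beta>))) s =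
      1 - (1 - s) / (p * \<alpha> + (p * \<beta> + 1 - p) * (1 - s))" by (simp add: u_def)
qed (use p ab in auto)

text \<open>The tails of the law are \<open>P(Y \<ge> k) = \<rho>\<^bsup>k - 1\<^esup> / (\<alpha> + \<beta>)\<close> for \<open>k \<ge> 1\<close>; lowering \<open>Y\<close> by one multiplies them by
  \<open>\<rho>\<close>, which is the same as dividing both parameters by \<open>\<rho>\<close>.\<close>

lemma LF_pred:
  assumes ab: "\<alpha> > 0" "\<beta> > 0" "\<alpha> + \<beta> \<ge> 1"
  defines "\<rho> \<equiv> \<beta> / (\<alpha> + \<beta>)"
  shows "map_pmf (\<lambda>t. t - 1) (LF \<alpha> \<beta>) = LF (\<alpha> / \<rho>) (\<beta> / \<rho>)"
proof (rule LF_eqI)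
  have \<rho>: "0 < \<rho>" "\<rho> \<le> 1" using ab by (auto simp: \<rho>_def)
  show "0 < \<alpha> / \<rho>" "0 < \<beta> / \<rho>" using ab \<rho> by auto
  have "1 \<le> (\<alpha> + \<beta>) / \<rho>" using ab \<rho> by (simp add: pos_le_divide_eq)
  then show "1 \<le> \<alpha> / \<rho> + \<beta> / \<rho>" by (simp add: add_divide_distrib)
  fix s :: real assume s: "0 < s" "s < 1"
  define q where "q = LF \<alpha> \<beta>"
  define D where "D = \<alpha> + \<beta> * (1 - s)"
  have D: "0 < D" using ab s by (auto simp: D_def intro!: add_pos_pos)
  have "s * s ^ (t - 1) = s ^ t - (1 - s) * 0 ^ t" for t by (cases t) auto
  then have "s * DR_phi (map_pmf (\<lambda>t. t - 1) q) s = (\<integral>t. s ^ t - (1 - s) * 0 ^ t \<partial>measure_pmf q)"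
    by (simp add: DR_phi_map flip: integral_mult_right_zero)
  also have "\<dots> = DR_phi q s - (1 - s) * DR_phi q 0"
    unfolding DR_phi_def using s integrable_power_pmf[of s q] integrable_power_pmf[of 0 q]
    by (subst Bochner_Integration.integral_diff) auto
  also have "\<dots> = (1 - (1 - s) / D) - (1 - s) * (1 - 1 / (\<alpha> + \<beta>))"
    using s ab DR_phi_LF[OF ab, of s] DR_phi_LF[OF ab, of 0] by (simp add: q_def D_def)
  also have "\<dots> = s * (1 - (1 - s) * \<rho> / D)"
  proof -
    have "1 / D - 1 / (\<alpha> + \<beta>) = ((\<alpha> + \<beta>) - D) / (D * (\<alpha> + \<beta>))" using D ab by (simp add: diff_frac_eq)
    also have "(\<alpha> + \<beta>) - D = \<beta> * s" by (simp add: D_def algebra_simps)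
    finally have "1 / D - 1 / (\<alpha> + \<beta>) = s * \<rho> / D" by (simp add: \<rho>_def mult_ac)
    moreover have "(1 - (1 - s) / D) - (1 - s) * (1 - 1 / (\<alpha> + \<beta>)) = s - (1 - s) * (1 / D - 1 / (\<alpha> + \<beta>))"
      by (simp add: right_diff_distrib)
    ultimately show ?thesis by (simp add: right_diff_distrib)
  qed
  finally have "DR_phi (map_pmf (\<lambda>t. t - 1) q) s = 1 - (1 - s) * \<rho> / D" using s by simp
  also have "(1 - s) * \<rho> / D = (1 - s) / (\<alpha> / \<rho> + \<beta> / \<rho> * (1 - s))"
  proof -
    have "\<alpha> / \<rho> + \<beta> / \<rho> * (1 - s) = D / \<rho>" by (simp add: D_def add_divide_distrib)
    then show ?thesis using \<rho> by simp
  qed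
  finally show "DR_phi (map_pmf (\<lambda>t. t - 1) (LF \<alpha> \<beta>)) s = 1 - (1 - s) / (\<alpha> / \<rho> + \<beta> / \<rho> * (1 - s))"
    by (simp add: q_def)
qed

text \<open>The ratio \<open>\<rho>\<close> depends only on \<open>\<beta> / \<alpha>\<close>, so it is unaffected by \<open>LF_pred\<close> and the lemma can be iterated.\<close>

lemma LF_minus:
  assumes ab: "\<alpha> > 0" "\<beta> > 0" "\<alpha> + \<beta> \<ge> 1"
  defines "\<rho> \<equiv> \<beta> / (\<alpha> + \<beta>)"
  shows "map_pmf (\<lambda>t. t - z) (LF \<alpha> \<beta>) = LF (\<alpha> / \<rho> ^ z) (\<beta> / \<rho> ^ z)"
proof (induction z)
  case (Suc z)
  have \<rho>: "0 < \<rho>" "\<rho> \<le> 1" using ab by (auto simp: \<rho>_def)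
  have "1 \<le> (\<alpha> + \<beta>) / \<rho> ^ z" using ab \<rho> by (simp add: pos_le_divide_eq) (meson order_trans power_le_one less_imp_le)
  then have ge: "1 \<le> \<alpha> / \<rho> ^ z + \<beta> / \<rho> ^ z" by (simp add: add_divide_distrib)
  have r: "\<beta> / \<rho> ^ z / (\<alpha> / \<rho> ^ z + \<beta> / \<rho> ^ z) = \<rho>"
    using \<rho> by (simp add: add_divide_distrib[symmetric]) (simp add: \<rho>_def)
  have "map_pmf (\<lambda>t. t - Suc z) (LF \<alpha> \<beta>) = map_pmf (\<lambda>t. t - 1) (map_pmf (\<lambda>t. t - z) (LF \<alpha> \<beta>))"
    by (simp add: pmf.map_comp o_def)
  also have "\<dots> = LF (\<alpha> / \<rho> ^ z / \<rho>) (\<beta> / \<rho> ^ z / \<rho>)"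
    unfolding Suc using LF_pred[of "\<alpha> / \<rho> ^ z" "\<beta> / \<rho> ^ z"] ab \<rho> ge unfolding r by simp
  finally show ?case by (simp add: mult.commute)
qed simp

text \<open>Averaging the factor \<open>\<rho>\<^sup>z\<close> of \<open>LF_minus\<close> over the law of \<open>Z\<close> gives \<open>\<phi>(\<rho>)\<close>, because \<open>1 - E(s\<^sup>Y)\<close> depends linearly on the
  law.\<close>

lemma step_LF:
  fixes Z :: "nat pmf"
  assumes p: "0 < p" "p < 1" and ab: "\<alpha> > 0" "\<beta> > 0" "\<alpha> + \<beta> \<ge> 1"
  defines "\<alpha>' \<equiv> p * \<alpha>" and "\<beta>' \<equiv> p * \<beta> + 1 - p"
  defines "\<phi> \<equiv> DR_phi Z (\<beta>' / (\<alpha>' + \<beta>'))"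
  shows "step_pmf p Z (LF \<alpha> \<beta>) = LF (\<alpha>' / \<phi>) (\<beta>' / \<phi>)" "0 < \<phi>" "1 \<le> \<alpha>' / \<phi> + \<beta>' / \<phi>"
proof -
  have ab': "0 < \<alpha>'" "0 < \<beta>'" using p ab add_pos_pos[of "p * \<beta>" "1 - p"] by (auto simp: \<alpha>'_def \<beta>'_def algebra_simps)
  have "p * 1 \<le> p * (\<alpha> + \<beta>)" using p ab by (intro mult_left_mono) auto
  then have ge: "1 \<le> \<alpha>' + \<beta>'" by (simp add: \<alpha>'_def \<beta>'_def algebra_simps)
  define \<rho> where "\<rho> = \<beta>' / (\<alpha>' + \<beta>')"
  have \<rho>: "0 < \<rho>" "\<rho> \<le> 1" using ab' by (auto simp: \<rho>_def)
  show \<phi>: "0 < \<phi>" using DR_phi_pos[OF \<rho>] by (simp add: \<phi>_def \<rho>_def)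
  have \<phi>1: "\<phi> \<le> 1" using DR_phi_le_1[of \<rho> Z] \<rho> by (simp add: \<phi>_def \<rho>_def)
  have "1 \<le> (\<alpha>' + \<beta>') / \<phi>" using ge \<phi> \<phi>1 by (simp add: pos_le_divide_eq)
  then show ge': "1 \<le> \<alpha>' / \<phi> + \<beta>' / \<phi>" by (simp add: add_divide_distrib)
  have "step_pmf p Z (LF \<alpha> \<beta>) = bind_pmf (LF \<alpha>' \<beta>') (\<lambda>t. map_pmf (\<lambda>z. t - z) Z)"
    unfolding step_pmf_def LF_geometric_sum[OF p ab] by (simp add: \<alpha>'_def \<beta>'_def)
  also have "\<dots> = bind_pmf Z (\<lambda>z. map_pmf (\<lambda>t. t - z) (LF \<alpha>' \<beta>'))"
    unfolding map_pmf_def by (rule bind_commute_pmf)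
  also have "\<dots> = LF (\<alpha>' / \<phi>) (\<beta>' / \<phi>)"
  proof (rule LF_eqI[OF _ _ ge'])
    fix s :: real assume s: "0 < s" "s < 1"
    define D where "D = \<alpha>' + \<beta>' * (1 - s)"
    have D: "0 < D" using ab' s by (auto simp: D_def intro!: add_pos_pos)
    have "DR_phi (map_pmf (\<lambda>t. t - z) (LF \<alpha>' \<beta>')) s = 1 - (1 - s) / D * \<rho> ^ z" for z
    proof -
      have "1 \<le> (\<alpha>' + \<beta>') / \<rho> ^ z" using ge \<rho> by (simp add: pos_le_divide_eq) (meson order_trans power_le_one less_imp_le)
      then have "1 \<le> \<alpha>' / \<rho> ^ z + \<beta>' / \<rho> ^ z" by (simp add: add_divide_distrib)
      then have "DR_phi (map_pmf (\<lambda>t. t - z) (LF \<alpha>' \<beta>')) s = 1 - (1 - s) / (\<alpha>' / \<rho> ^ z + \<beta>' / \<rho> ^ z * (1 - s))"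
        unfolding LF_minus[OF ab' ge] \<rho>_def[symmetric] using ab' \<rho> s by (intro DR_phi_LF) auto
      also have "\<alpha>' / \<rho> ^ z + \<beta>' / \<rho> ^ z * (1 - s) = D / \<rho> ^ z" by (simp add: D_def add_divide_distrib)
      finally show ?thesis by simp
    qed
    then have "DR_phi (bind_pmf Z (\<lambda>z. map_pmf (\<lambda>t. t - z) (LF \<alpha>' \<beta>'))) s =
        (\<integral>z. 1 - (1 - s) / D * \<rho> ^ z \<partial>measure_pmf Z)" using s by (simp add: DR_phi_bind)
    also have "\<dots> = 1 - (1 - s) / D * \<phi>"
      unfolding \<phi>_def DR_phi_def \<rho>_def[symmetric] using integrable_power_pmf[of \<rho> Z] \<rho>
      by (subst Bochner_Integration.integral_diff) auto
    also have "(1 - s) / D * \<phi> = (1 - s) / (\<alpha>' / \<phi> + \<beta>' / \<phi> * (1 - s))"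
    proof -
      have "\<alpha>' / \<phi> + \<beta>' / \<phi> * (1 - s) = D / \<phi>" by (simp add: D_def add_divide_distrib)
      then show ?thesis using \<phi> by simp
    qed
    finally show "DR_phi (bind_pmf Z (\<lambda>z. map_pmf (\<lambda>t. t - z) (LF \<alpha>' \<beta>'))) s =
      1 - (1 - s) / (\<alpha>' / \<phi> + \<beta>' / \<phi> * (1 - s))" .
  qed (use ab' \<phi> in auto)
  finally show "step_pmf p Z (LF \<alpha> \<beta>) = LF (\<alpha>' / \<phi>) (\<beta>' / \<phi>)" .
qed

text \<open>In the coordinates \<open>x = \<beta> / \<alpha>\<close> and \<open>y = (1 - p) / (p \<alpha>)\<close> the map of \<open>step_LF\<close> becomes the planar recursion driven by
  \<open>\<psi>\<close>.\<close>

lemma DR_law_LF: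
  fixes Z :: "nat pmf"
  assumes p: "0 < p" "p < 1" and ab: "\<alpha> > 0" "\<beta> > 0" "\<alpha> + \<beta> \<ge> 1"
  defines "x n \<equiv> orbX (DR_psi p Z) (\<beta> / \<alpha>) ((1 - p) / (p * \<alpha>)) n"
    and "y n \<equiv> orbY (DR_psi p Z) (\<beta> / \<alpha>) ((1 - p) / (p * \<alpha>)) n"
  defines "a n \<equiv> (1 - p) / (p * y n)"
  shows "DR_law p Z (distr (measure_pmf (LF \<alpha> \<beta>)) borel real) n =
    distr (measure_pmf (LF (a n) (x n * a n))) borel real \<and>
    0 < x n \<and> 0 < y n \<and> 1 \<le> a n + x n * a n"
proof (induction n)
  case 0
  then show ?case using p ab by (simp add: x_def y_def a_def DR_law_def)
next
  case (Suc n)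
  then have IH: "DR_law p Z (distr (measure_pmf (LF \<alpha> \<beta>)) borel real) n =
      distr (measure_pmf (LF (a n) (x n * a n))) borel real" "0 < x n" "0 < y n" "1 \<le> a n + x n * a n" by auto
  have an: "0 < a n" using p IH by (simp add: a_def)
  define v where "v = x n + y n"
  have v: "0 < v" using IH by (simp add: v_def)
  define \<beta>' where "\<beta>' = p * (x n * a n) + 1 - p"
  have "1 - p = p * a n * y n" using p IH by (simp add: a_def)
  then have b': "\<beta>' = p * a n * v" by (simp add: \<beta>'_def v_def algebra_simps)
  define \<phi> where "\<phi> = DR_phi Z (\<beta>' / (p * a n + \<beta>'))"
  have "p * a n + \<beta>' = p * a n * (v + 1)" by (simp add: b' algebra_simps)
  then have "\<beta>' / (p * a n + \<beta>') = v / (v + 1)" using p an by (simp add: b')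
  then have \<phi>: "\<phi> = p * DR_psi p Z v" using p by (simp add: \<phi>_def DR_psi_def)
  note st = step_LF[OF p an mult_pos_pos[OF IH(2) an] IH(4), of Z, folded \<beta>'_def, folded \<phi>_def]
  have sx: "x (Suc n) = v" "y (Suc n) = y n * DR_psi p Z v"
    by (simp_all add: x_def y_def v_def orb_Suc)
  have psi: "0 < DR_psi p Z v" using st(2) \<phi> p by (simp add: zero_less_mult_iff)
  have a': "p * a n / \<phi> = a (Suc n)" "\<beta>' / \<phi> = x (Suc n) * a (Suc n)"
    using p IH psi by (auto simp: \<phi> sx a_def b' mult_ac)
  have "DR_law p Z (distr (measure_pmf (LF \<alpha> \<beta>)) borel real) (Suc n) =
      DR_step p Z (distr (measure_pmf (LF (a n) (x n * a n))) borel real)"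
    using IH(1) by (simp add: DR_law_def)
  also have "\<dots> = distr (measure_pmf (LF (a (Suc n)) (x (Suc n) * a (Suc n)))) borel real"
    unfolding DR_step_distr st(1) a' ..
  finally show ?case using st(3) a' sx v psi IH by auto
qed

lemma F_LF_eq:
  assumes p: "0 < p" "p < 1" and ab: "\<alpha> > 0" "\<beta> > 0" "\<alpha> + \<beta> \<ge> 1"
  shows "F_LF p Z \<alpha> \<beta> = lim (\<lambda>n. p ^ n * (p / (1 - p) * orbY (DR_psi p Z) (\<beta> / \<alpha>) ((1 - p) / (p * \<alpha>)) n))"
proof -
  define y where "y n = orbY (DR_psi p Z) (\<beta> / \<alpha>) ((1 - p) / (p * \<alpha>)) n" for n
  have "(\<integral>x. x \<partial>DR_law p Z (distr (measure_pmf (LF \<alpha> \<beta>)) borel real) n) = p / (1 - p) * y n" for n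
  proof -
    note law = DR_law_LF[OF p ab, of Z n]
    define a b where "a = (1 - p) / (p * y n)" and "b = orbX (DR_psi p Z) (\<beta> / \<alpha>) ((1 - p) / (p * \<alpha>)) n * a"
    have "0 < a" "0 < b" "1 \<le> a + b" and l: "DR_law p Z (distr (measure_pmf (LF \<alpha> \<beta>)) borel real) n =
        distr (measure_pmf (LF a b)) borel real"
      using law p by (auto simp: a_def b_def y_def)
    then have "(\<integral>x. x \<partial>DR_law p Z (distr (measure_pmf (LF \<alpha> \<beta>)) borel real) n) = 1 / a"
      unfolding l by (subst integral_distr) (auto simp: LF_mean)
    then show ?thesis by (simp add: a_def)
  qed
  then show ?thesis by (simp add: F_LF_def y_def)
qed

section \<open>The function psi\<close>

text \<open>\<open>D\<close> and \<open>E\<close> are the termwise derivatives of the power series. All coefficients of \<open>D\<close> are nonnegative, and one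
  of them is positive if the law has an atom at some \<open>k \<ge> 1\<close>.\<close>

lemma DR_phi_deriv:
  obtains D E where
    "\<And>s. \<bar>s\<bar> < 1 \<Longrightarrow> (DR_phi q has_real_derivative D s) (at s)"
    "\<And>s. \<bar>s\<bar> < 1 \<Longrightarrow> (D has_real_derivative E s) (at s)"
    "\<And>s. 0 < s \<Longrightarrow> s < 1 \<Longrightarrow> set_pmf q \<subseteq> {1..} \<Longrightarrow> 0 < D s"
proof -
  define c where "c = pmf q"
  define D where "D s = (\<Sum>n. diffs c n * s ^ n)" for s
  define E where "E s = (\<Sum>n. diffs (diffs c) n * s ^ n)" for s
  have s0: "summable (\<lambda>n. c n * s ^ n)" if "norm s < 1" for s
    using sums_summable[OF DR_phi_sums[of s q]] that by (simp add: c_def)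
  have s1: "summable (\<lambda>n. diffs c n * s ^ n)" if "norm s < 1" for s
    using termdiff_converges[of s 1 c] s0 that by blast
  have d0: "((\<lambda>s. \<Sum>n. c n * s ^ n) has_real_derivative D s) (at s)" if "norm s < 1" for s
    unfolding D_def by (rule termdiffs_strong'[of 1]) (use s0 that in auto)
  have d1: "(D has_real_derivative E s) (at s)" if "norm s < 1" for s
    unfolding D_def E_def by (rule termdiffs_strong'[of 1]) (use s1 that in auto)
  show thesis
  proof (rule that[of D E])
    fix s :: real assume s: "\<bar>s\<bar> < 1"
    show "(D has_real_derivative E s) (at s)" using d1 s by simp
    show "(DR_phi q has_real_derivative D s) (at s)"
    proof (rule DERIV_cong_ev[OF refl _ refl, THEN iffD1, OF _ d0])
      have "\<forall>\<^sub>F t in nhds s. t \<in> {-1<..<1}" using s by (intro eventually_nhds_in_open) auto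
      then show "\<forall>\<^sub>F t in nhds s. (\<Sum>n. c n * t ^ n) = DR_phi q t"
        by eventually_elim (auto simp: c_def intro!: sums_unique[symmetric] DR_phi_sums)
    qed (use s in auto)
  next
    fix s :: real assume s: "0 < s" "s < 1" and q: "set_pmf q \<subseteq> {1..}"
    obtain n where n: "n \<in> set_pmf q" using set_pmf_not_empty[of q] by blast
    then obtain k where k: "n = Suc k" using q by (cases n) auto
    have "0 < diffs c k * s ^ k" using n s by (auto simp: diffs_def c_def k pmf_positive)
    moreover have "0 \<le> diffs c m * s ^ m" for m using s by (auto simp: diffs_def c_def)
    ultimately show "0 < D s" unfolding D_def using s1[of s] s by (intro suminf_pos2[of _ k]) auto
  qed
qed

lemma DR_phi_le_self:
  assumes q: "set_pmf q \<subseteq> {1..}" and s: "0 \<le> s" "s \<le> 1"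
  shows "DR_phi q s \<le> s"
proof -
  have "DR_phi q s \<le> (\<integral>k. s \<partial>measure_pmf q)"
    unfolding DR_phi_def
  proof (intro integral_mono_AE)
    show "AE k in measure_pmf q. s ^ k \<le> s"
    proof (rule AE_pmfI)
      fix k assume "k \<in> set_pmf q"
      then have "1 \<le> k" using q by auto
      then show "s ^ k \<le> s" using power_decreasing[of 1 k s] s by simp
    qed
  qed (use s in \<open>auto intro: integrable_power_pmf\<close>)
  then show ?thesis by simp
qed

text \<open>A finite partial sum of the weights already exceeds \<open>p\<close>, and finite sums are continuous at 1.\<close>

lemma DR_phi_near_1:
  assumes p: "p < 1" obtains s where "0 < s" "s < 1" "p < DR_phi q s"
proof -
  have "(\<lambda>n. pmf q n) sums 1" using DR_phi_sums[of 1 q] by (simp add: DR_phi_def)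
  then have "(\<lambda>n. \<Sum>k<n. pmf q k) \<longlonglongrightarrow> 1" by (simp add: sums_def)
  then have "\<forall>\<^sub>F n in sequentially. p < (\<Sum>k<n. pmf q k)" using p by (intro order_tendstoD) auto
  then obtain n where n: "p < (\<Sum>k<n. pmf q k)" by (auto simp: eventually_sequentially)
  have "((\<lambda>s. \<Sum>k<n. pmf q k * s ^ k) \<longlongrightarrow> (\<Sum>k<n. pmf q k * 1 ^ k)) (at_left 1)"
    by (intro tendsto_intros)
  then have "\<forall>\<^sub>F s in at_left 1. p < (\<Sum>k<n. pmf q k * s ^ k)" using n by (intro order_tendstoD) auto
  moreover have "\<forall>\<^sub>F s in at_left 1. s \<in> {0<..<1 :: real}" by (intro eventually_at_leftI[of 0]) auto
  ultimately have "\<forall>\<^sub>F s in at_left 1. p < (\<Sum>k<n. pmf q k * s ^ k) \<and> s \<in> {0<..<1}" by eventually_elim auto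
  then obtain s where s: "p < (\<Sum>k<n. pmf q k * s ^ k)" "0 < s" "s < 1"
    using eventually_happens'[of "at_left (1::real)"] by force
  have "(\<Sum>k<n. pmf q k * s ^ k) \<le> DR_phi q s"
    using sum_le_suminf[of "\<lambda>k. pmf q k * s ^ k" "{..<n}"] sums_summable[OF DR_phi_sums[of s q]]
      sums_unique[OF DR_phi_sums[of s q]] s by simp
  then show thesis using that s by auto
qed

lemma DR_phi_cont: "continuous_on {0<..<1} (DR_phi q)"
proof -
  obtain D E where D: "\<And>s. \<bar>s\<bar> < 1 \<Longrightarrow> (DR_phi q has_real_derivative D s) (at s)"
    using DR_phi_deriv[of q] by metis
  show ?thesis by (intro continuous_at_imp_continuous_on ballI DERIV_isCont[OF D]) auto
qed

lemma DR_psi_deriv: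
  assumes p: "0 < p" and Z: "set_pmf Z \<subseteq> {1..}"
  obtains D E where
    "\<And>x. 0 < x \<Longrightarrow> (DR_psi p Z has_real_derivative D x) (at x)"
    "\<And>x. 0 < x \<Longrightarrow> (D has_real_derivative E x) (at x)"
    "\<And>x. 0 < x \<Longrightarrow> 0 < D x"
proof -
  obtain D E where
    D: "\<And>s. \<bar>s\<bar> < 1 \<Longrightarrow> (DR_phi Z has_real_derivative D s) (at s)"
    and E: "\<And>s. \<bar>s\<bar> < 1 \<Longrightarrow> (D has_real_derivative E s) (at s)"
    and pos: "\<And>s. 0 < s \<Longrightarrow> s < 1 \<Longrightarrow> 0 < D s"
    using DR_phi_deriv[of Z] Z by metis
  define g where "g x = x / (x + 1 :: real)" for x
  have g01: "0 < g x" "g x < 1" "\<bar>g x\<bar> < 1" if "0 < x" for x using that by (auto simp: g_def)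
  have g: "(g has_real_derivative 1 / (x + 1)\<^sup>2) (at x)" if "0 < x" for x
    unfolding g_def using that by (auto intro!: derivative_eq_intros simp: power2_eq_square field_simps)
  define D' where "D' x = 1 / p * (D (g x) * (1 / (x + 1)\<^sup>2))" for x
  have 1: "(DR_psi p Z has_real_derivative D' x) (at x)" if "0 < x" for x
  proof -
    have "((\<lambda>x. DR_phi Z (g x)) has_real_derivative D (g x) * (1 / (x + 1)\<^sup>2)) (at x)"
      by (rule DERIV_chain2[OF D g]) (use g01 that in auto)
    from DERIV_cmult[OF this, of "1 / p"] show ?thesis by (simp add: D'_def DR_psi_def[abs_def] g_def[abs_def])
  qed
  have "\<exists>e. (D' has_real_derivative e) (at x)" if x: "0 < x" for x
  proof -
    have "((\<lambda>x. D (g x)) has_real_derivative E (g x) * (1 / (x + 1)\<^sup>2)) (at x)"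
      by (rule DERIV_chain2[OF E g]) (use g01 x in auto)
    moreover have "((\<lambda>x. 1 / (x + 1)\<^sup>2) has_real_derivative - (2 * (x + 1)) / ((x + 1)\<^sup>2 * (x + 1)\<^sup>2)) (at x)"
      using x by (auto intro!: derivative_eq_intros)
    ultimately show ?thesis unfolding D'_def using DERIV_cmult[OF DERIV_mult] by blast
  qed
  then obtain E' where "\<And>x. 0 < x \<Longrightarrow> (D' has_real_derivative E' x) (at x)" by metis
  moreover have "0 < D' x" if "0 < x" for x
    unfolding D'_def using p that pos[OF g01(1,2)[OF that]] by (intro mult_pos_pos) auto
  ultimately show thesis using 1 that[of D'] by blast
qed

lemma DR_psi_mono:
  assumes p: "0 < p" and Z: "set_pmf Z \<subseteq> {1..}" and x: "0 < x" "x < y"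
  shows "DR_psi p Z x < DR_psi p Z y"
proof -
  obtain D E where D: "\<And>x. 0 < x \<Longrightarrow> (DR_psi p Z has_real_derivative D x) (at x)"
    "\<And>x. 0 < x \<Longrightarrow> 0 < D x"
    using DR_psi_deriv[OF p Z] by metis
  show ?thesis
  proof (rule DERIV_pos_imp_increasing[OF x(2)])
    fix z assume "x \<le> z"
    then show "\<exists>d. (DR_psi p Z has_real_derivative d) (at z) \<and> 0 < d"
      using D(1)[of z] D(2)[of z] x by (intro exI[of _ "D z"]) auto
  qed
qed

lemma DR_psi_bounds:
  assumes p: "0 < p" and x: "0 < x"
  shows "0 < DR_psi p Z x" "DR_psi p Z x \<le> 1 / p"
proof -
  have "0 < x / (x + 1)" "x / (x + 1) \<le> 1" using x by auto
  then show "0 < DR_psi p Z x" "DR_psi p Z x \<le> 1 / p"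
    using DR_phi_pos[of "x / (x + 1)" Z] DR_phi_le_1[of "x / (x + 1)" Z] p
    by (auto simp: DR_psi_def divide_le_cancel)
qed

text \<open>Existence is the intermediate value theorem for \<open>\<phi>\<close> on \<open>[p / 2, s]\<close>, where \<open>\<phi>(p / 2) \<le> p / 2\<close> and \<open>s\<close> comes
  from \<open>DR_phi_near_1\<close>; uniqueness is strict monotonicity of \<open>\<psi>\<close>.\<close>

lemma DR_xi:
  assumes p: "0 < p" "p < 1" and Z: "set_pmf Z \<subseteq> {1..}"
  shows "0 < DR_xi p Z" "DR_psi p Z (DR_xi p Z) = 1"
proof -
  obtain s where s: "0 < s" "s < 1" "p < DR_phi Z s" using DR_phi_near_1[OF p(2)] by blast
  have lo: "DR_phi Z (p / 2) < p" using DR_phi_le_self[OF Z, of "p / 2"] p by simp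
  have "p / 2 < s"
  proof (rule ccontr)
    assume "\<not> p / 2 < s"
    then have "DR_phi Z s \<le> p / 2" using DR_phi_le_self[OF Z, of s] s by simp
    then show False using s p by simp
  qed
  moreover have "continuous_on {p / 2..s} (DR_phi Z)"
    by (rule continuous_on_subset[OF DR_phi_cont]) (use p s in auto)
  ultimately obtain t where t: "p / 2 \<le> t" "t \<le> s" "DR_phi Z t = p"
    using IVT'[of "DR_phi Z" "p / 2" p s] lo s by auto
  define x where "x = t / (1 - t)"
  have t01: "0 < t" "t < 1" using t s p by auto
  have x: "0 < x" using t01 by (simp add: x_def)
  have "x / (x + 1) = t" using t01 by (simp add: x_def field_simps)
  then have psi: "DR_psi p Z x = 1" using t p by (simp add: DR_psi_def)
  have uniq: "x' = x" if "0 < x'" "DR_psi p Z x' = 1" for x'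
  proof (rule ccontr)
    assume "x' \<noteq> x"
    then consider "x < x'" | "x' < x" by linarith
    then show False
      using DR_psi_mono[OF p(1) Z, of x x'] DR_psi_mono[OF p(1) Z, of x' x] x psi that by cases auto
  qed
  have "DR_xi p Z = x" unfolding DR_xi_def by (rule the_equality) (use x psi uniq in blast)+
  then show "0 < DR_xi p Z" "DR_psi p Z (DR_xi p Z) = 1" using x psi by auto
qed

section \<open>Growth under the logarithmic moment condition\<close>

text \<open>If \<open>a \<ge> 1\<close>, about \<open>ln a / - ln \<mu>\<close> of the terms are equal to 1; the remaining ones form a geometric series. In the induction
  \<open>a\<close> is replaced by \<open>a \<mu>\<close>, which lowers the logarithm by exactly the amount that pays for the first term.\<close>

lemma sum_min_geometric_le:
  fixes \<mu> a :: real
  assumes \<mu>: "0 < \<mu>" "\<mu> < 1" and a: "0 < a"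
  shows "(\<Sum>k<n. min 1 (a * \<mu> ^ k)) \<le> 1 + 1 / (1 - \<mu>) + max 0 (ln a) / - ln \<mu>"
  using a
proof (induction n arbitrary: a)
  case 0
  have "0 \<le> max 0 (ln a) / - ln \<mu>" "0 \<le> 1 / (1 - \<mu>)" using \<mu> by (intro divide_nonneg_nonneg; simp)+
  then show ?case unfolding lessThan_0 sum.empty by linarith
next
  case (Suc n)
  have L: "0 < - ln \<mu>" using \<mu> by simp
  have mx: "0 \<le> max 0 (ln a) / - ln \<mu>" using L by (intro divide_nonneg_pos) auto
  show ?case
  proof (cases "a \<le> 1")
    case True
    have "(\<Sum>k<Suc n. min 1 (a * \<mu> ^ k)) \<le> (\<Sum>k<Suc n. \<mu> ^ k)"
    proof (intro sum_mono)
      fix k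
      have "a * \<mu> ^ k \<le> 1 * \<mu> ^ k" using True \<mu> by (intro mult_right_mono) auto
      then show "min 1 (a * \<mu> ^ k) \<le> \<mu> ^ k" by simp
    qed
    also have "\<dots> = (1 - \<mu> ^ Suc n) / (1 - \<mu>)" using \<mu> by (subst sum_gp_strict) auto
    also have "\<dots> \<le> 1 / (1 - \<mu>)" using \<mu> by (intro divide_right_mono) auto
    also have "\<dots> \<le> 1 + 1 / (1 - \<mu>) + max 0 (ln a) / - ln \<mu>" using mx by linarith
    finally show ?thesis .
  next
    case False
    have "(\<Sum>k<Suc n. min 1 (a * \<mu> ^ k)) = min 1 a + (\<Sum>k<n. min 1 (a * \<mu> * \<mu> ^ k))"
      by (subst sum.lessThan_Suc_shift) (simp add: mult_ac)
    also have "\<dots> \<le> 1 + (\<Sum>k<n. min 1 (a * \<mu> * \<mu> ^ k))" by simp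
    also have "(\<Sum>k<n. min 1 (a * \<mu> * \<mu> ^ k)) \<le> 1 / (1 - \<mu>) + max 0 (ln a) / - ln \<mu>"
    proof (cases "a * \<mu> \<le> 1")
      case True
      have "(\<Sum>k<n. min 1 (a * \<mu> * \<mu> ^ k)) \<le> (\<Sum>k<n. \<mu> ^ k)"
      proof (intro sum_mono)
        fix k
        have "a * \<mu> * \<mu> ^ k \<le> 1 * \<mu> ^ k" using True \<mu> by (intro mult_right_mono) auto
        then show "min 1 (a * \<mu> * \<mu> ^ k) \<le> \<mu> ^ k" by simp
      qed
      also have "\<dots> = (1 - \<mu> ^ n) / (1 - \<mu>)" using \<mu> by (subst sum_gp_strict) auto
      also have "\<dots> \<le> 1 / (1 - \<mu>)" using \<mu> by (intro divide_right_mono) auto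
      also have "\<dots> \<le> 1 / (1 - \<mu>) + max 0 (ln a) / - ln \<mu>" using mx by linarith
      finally show ?thesis .
    next
      case big: False
      have "0 < a * \<mu>" using \<mu> Suc.prems by simp
      from Suc.IH[OF this] have "(\<Sum>k<n. min 1 (a * \<mu> * \<mu> ^ k)) \<le> 1 + 1 / (1 - \<mu>) + ln (a * \<mu>) / - ln \<mu>"
        using big by simp
      also have "ln (a * \<mu>) = ln a + ln \<mu>" using \<mu> Suc.prems by (simp add: ln_mult)
      also have "(ln a + ln \<mu>) / - ln \<mu> = ln a / - ln \<mu> - 1" using L by (simp add: add_divide_distrib)
      finally show ?thesis using False by simp
    qed
    finally show ?thesis by simp
  qed
qed

text \<open>\<open>1 - \<phi>(s\<^sub>n)\<close> is the mean of \<open>1 - s\<^sub>n\<^sup>Z\<close>, which is at most \<open>min 1 (c Z \<mu>\<^sup>n)\<close>. Summing over \<open>n\<close> first gives a constant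
  plus a multiple of \<open>ln Z\<close>, so the logarithmic moment is what makes the sum finite.\<close>

lemma DR_phi_defect_summable:
  assumes Z: "set_pmf Z \<subseteq> {1..}" and Zlog: "integrable (measure_pmf Z) (\<lambda>k. ln (real k))"
    and \<mu>: "0 < \<mu>" "\<mu> < 1" and c: "0 < c"
    and s: "\<And>n. 0 \<le> s n" "\<And>n. s n \<le> 1" "\<And>n. 1 - s n \<le> c * \<mu> ^ n"
  shows "summable (\<lambda>n. 1 - DR_phi Z (s n))"
proof (rule summableI_nonneg_bounded)
  show "0 \<le> 1 - DR_phi Z (s n)" for n using DR_phi_le_1[OF s(1,2), of Z n] by simp
  \<comment> \<open>the integrable majorant of the sum over \<open>n\<close>\<close>
  define b where "b k = 1 + 1 / (1 - \<mu>) + (ln (real k) + \<bar>ln c\<bar>) / - ln \<mu>" for k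
  have L: "0 < - ln \<mu>" using \<mu> by simp
  fix N
  have int: "integrable (measure_pmf Z) (\<lambda>k. 1 - s n ^ k)" for n
    using integrable_power_pmf[of "s n" Z] s[of n] by auto
  have "(\<Sum>n<N. 1 - DR_phi Z (s n)) = (\<Sum>n<N. \<integral>k. 1 - s n ^ k \<partial>measure_pmf Z)"
    using integrable_power_pmf[of _ Z] s unfolding DR_phi_def
    by (intro sum.cong refl) (subst Bochner_Integration.integral_diff, auto)
  also have "\<dots> = (\<integral>k. (\<Sum>n<N. 1 - s n ^ k) \<partial>measure_pmf Z)"
    by (rule Bochner_Integration.integral_sum[symmetric]) (rule int)
  also have "\<dots> \<le> (\<integral>k. b k \<partial>measure_pmf Z)"
  proof (rule integral_mono_AE)
    show "integrable (measure_pmf Z) (\<lambda>k. \<Sum>n<N. 1 - s n ^ k)" using int by auto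
    show "integrable (measure_pmf Z) b" unfolding b_def using Zlog by auto
    show "AE k in measure_pmf Z. (\<Sum>n<N. 1 - s n ^ k) \<le> b k"
    proof (rule AE_pmfI)
      fix k assume "k \<in> set_pmf Z"
      then have k: "1 \<le> k" using Z by auto
      have "(\<Sum>n<N. 1 - s n ^ k) \<le> (\<Sum>n<N. min 1 (real k * c * \<mu> ^ n))"
      proof (intro sum_mono min.boundedI)
        fix n
        show "1 - s n ^ k \<le> 1" using s(1) by simp
        have "1 + real k * (s n - 1) \<le> (1 + (s n - 1)) ^ k" using s(1)[of n] by (intro Bernoulli_inequality) auto
        then have "1 - s n ^ k \<le> real k * (1 - s n)" by (simp add: algebra_simps)
        also have "\<dots> \<le> real k * (c * \<mu> ^ n)" using s(3) by (intro mult_left_mono) auto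
        finally show "1 - s n ^ k \<le> real k * c * \<mu> ^ n" by simp
      qed
      also have "\<dots> \<le> 1 + 1 / (1 - \<mu>) + max 0 (ln (real k * c)) / - ln \<mu>"
        using k c by (intro sum_min_geometric_le \<mu>) auto
      also have "\<dots> \<le> b k"
      proof -
        have "max 0 (ln (real k * c)) \<le> ln (real k) + \<bar>ln c\<bar>" using k c by (simp add: ln_mult)
        then have "max 0 (ln (real k * c)) / - ln \<mu> \<le> (ln (real k) + \<bar>ln c\<bar>) / - ln \<mu>"
          using L by (intro divide_right_mono) auto
        then show ?thesis by (simp add: b_def)
      qed
      finally show "(\<Sum>n<N. 1 - s n ^ k) \<le> b k" .
    qed
  qed
  finally show "(\<Sum>n<N. 1 - DR_phi Z (s n)) \<le> (\<integral>k. b k \<partial>measure_pmf Z)" .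
qed

text \<open>From an index on at which the remaining defects sum to less than 1/2, the sequence keeps at least half of its
  value.\<close>

lemma positive_limit_of_summable_defects:
  fixes w d :: "nat \<Rightarrow> real"
  assumes w0: "\<And>n. 0 < w n" and w: "\<And>n. w (Suc n) = w n * (1 - d n)"
    and d: "\<And>n. 0 \<le> d n" "summable d"
  shows "\<exists>g>0. w \<longlonglongrightarrow> g"
proof -
  have "decseq w"
  proof (rule decseq_SucI)
    fix n show "w (Suc n) \<le> w n" using d(1)[of n] w0[of n] by (simp add: w mult_left_le)
  qed
  then obtain g where g: "w \<longlonglongrightarrow> g" using decseq_convergent[of w 0] w0 less_imp_le by metis
  have "(\<lambda>n. \<Sum>i. d (i + n)) \<longlonglongrightarrow> 0" using suminf_exist_split2[OF d(2)] by simp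
  then have "\<forall>\<^sub>F n in sequentially. (\<Sum>i. d (i + n)) < 1 / 2" by (intro order_tendstoD) auto
  then obtain N where N: "(\<Sum>i. d (i + N)) < 1 / 2" by (auto simp: eventually_sequentially)
  have d1: "d n \<le> 1" for n
  proof (rule ccontr)
    assume "\<not> d n \<le> 1"
    then have "w n * (1 - d n) < 0" using w0[of n] by (intro mult_pos_neg) auto
    then show False using w0[of "Suc n"] by (simp add: w)
  qed
  have S: "(\<Sum>i<n. d (i + N)) \<le> 1 / 2" for n
    using sum_le_suminf[of "\<lambda>i. d (i + N)" "{..<n}"] N d summable_ignore_initial_segment[OF d(2), of N] by auto
  have *: "w N * (1 - (\<Sum>i<n. d (i + N))) \<le> w (n + N)" for n
  proof (induction n)
    case (Suc n)
    define S where "S = (\<Sum>i<n. d (i + N))"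
    have "0 \<le> S" unfolding S_def by (intro sum_nonneg d)
    then have "1 - (S + d (n + N)) \<le> (1 - S) * (1 - d (n + N))" using d(1)[of "n + N"] by (simp add: algebra_simps)
    then have "w N * (1 - (S + d (n + N))) \<le> w N * ((1 - S) * (1 - d (n + N)))"
      using w0[of N] by (intro mult_left_mono) auto
    also have "\<dots> = (w N * (1 - S)) * (1 - d (n + N))" by simp
    also have "\<dots> \<le> w (n + N) * (1 - d (n + N))"
      using Suc d1[of "n + N"] by (intro mult_right_mono) (auto simp: S_def)
    finally show ?case by (simp add: w S_def)
  qed simp
  have "w N / 2 \<le> w (n + N)" for n
  proof -
    have "w N * (1 / 2) \<le> w N * (1 - (\<Sum>i<n. d (i + N)))" using S[of n] w0[of N] by (intro mult_left_mono) auto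
    then show ?thesis using *[of n] by simp
  qed
  then have "w N / 2 \<le> g" using LIMSEQ_le_const[OF LIMSEQ_ignore_initial_segment[OF g, of N]] by blast
  then show ?thesis using g w0[of N] by (intro exI[of _ g]) auto
qed

text \<open>To the right of \<open>\<xi>\<close> the multiplier is at least \<open>\<psi>(x) > 1\<close>, so \<open>x\<^sub>n\<close> grows geometrically and the factors
  \<open>p \<psi>(x\<^sub>n) = \<phi>(s\<^sub>n)\<close> approach 1 fast enough.\<close>

lemma DR_psi_growth:
  assumes p: "0 < p" "p < 1" and Z: "set_pmf Z \<subseteq> {1..}"
    and Zlog: "integrable (measure_pmf Z) (\<lambda>k. ln (real k))"
    and x: "DR_xi p Z < x" and y: "0 < y"
  shows "\<exists>g>0. (\<lambda>n. p ^ n * orbY (DR_psi p Z) x y n) \<longlonglongrightarrow> g"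
proof -
  define f where "f = DR_psi p Z"
  define l where "l = f x"
  have x0: "0 < x" using DR_xi(1)[OF p Z] x by simp
  have l: "1 < l" using DR_psi_mono[OF p(1) Z DR_xi(1)[OF p Z] x] DR_xi(2)[OF p Z] by (simp add: l_def f_def)
  have fl: "l \<le> f z" if "x \<le> z" for z
    using DR_psi_mono[OF p(1) Z x0, of z] that by (cases "x = z") (auto simp: l_def f_def)
  have grow: "x \<le> orbX f x y n \<and> y * l ^ n \<le> orbY f x y n" for n
  proof (induction n)
    case (Suc n)
    have y0: "0 < y * l ^ n" using y l by simp
    then have u: "x \<le> orbX f x y n + orbY f x y n" using Suc by linarith
    have "y * l ^ n * l \<le> orbY f x y n * f (orbX f x y n + orbY f x y n)"
      using Suc y0 l fl[OF u] by (intro mult_mono) auto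
    then show ?case using u by (simp add: orb_Suc mult_ac)
  qed simp
  define v where "v n = orbX f x y n + orbY f x y n" for n
  define s where "s n = v n / (v n + 1)" for n
  have ylpos: "0 < y * l ^ n" for n using y l by simp
  have v: "y * l ^ n \<le> v n" "0 < v n" for n using grow[of n] x0 ylpos[of n] by (auto simp: v_def)
  define w where "w n = p ^ n * orbY f x y n" for n
  have "\<exists>g>0. w \<longlonglongrightarrow> g"
  proof (rule positive_limit_of_summable_defects[of w "\<lambda>n. 1 - DR_phi Z (s n)"])
    fix n
    show "0 < w n" using grow[of n] ylpos[of n] p by (simp add: w_def)
    have "DR_phi Z (s n) = p * f (v n)" using p by (simp add: f_def DR_psi_def s_def)
    then show "w (Suc n) = w n * (1 - (1 - DR_phi Z (s n)))" by (simp add: w_def orb_Suc v_def mult_ac)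
    show "0 \<le> 1 - DR_phi Z (s n)" using DR_phi_le_1[of "s n" Z] v(2)[of n] by (simp add: s_def)
  next
    show "summable (\<lambda>n. 1 - DR_phi Z (s n))"
    proof (rule DR_phi_defect_summable[OF Z Zlog, of "1 / l" "1 / y"])
      fix n
      show "0 \<le> s n" "s n \<le> 1" using v(2)[of n] by (auto simp: s_def)
      have "1 - s n = 1 / (v n + 1)" using v(2)[of n] by (simp add: s_def field_simps)
      also have "\<dots> \<le> 1 / (y * l ^ n)" using v[of n] ylpos[of n] by (intro divide_left_mono) auto
      also have "\<dots> = 1 / y * (1 / l) ^ n" by (simp add: power_one_over field_simps)
      finally show "1 - s n \<le> 1 / y * (1 / l) ^ n" .
    qed (use l y in auto)
  qed
  then show ?thesis by (simp add: w_def[abs_def] f_def)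
qed

section \<open>Normalization at the fixed point\<close>

text \<open>By the mean value theorem it suffices that \<open>f' - 1\<close> is \<open>O(x)\<close>, which follows from differentiability of \<open>f'\<close> at the
  single point 0.\<close>

lemma quadratic_remainder:
  fixes f f' :: "real \<Rightarrow> real"
  assumes \<rho>: "0 < \<rho>" and f: "\<And>x. \<bar>x\<bar> < \<rho> \<Longrightarrow> (f has_real_derivative f' x) (at x)"
    and f'0: "f' 0 = 1" and f': "(f' has_real_derivative e) (at 0)"
  shows "\<exists>C r. r > 0 \<and> (\<forall>x y. \<bar>x\<bar> \<le> r \<longrightarrow> \<bar>y\<bar> \<le> r \<longrightarrow>
           \<bar>f x - f y - (x - y)\<bar> \<le> C * max \<bar>x\<bar> \<bar>y\<bar> * \<bar>x - y\<bar>)"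
proof -
  define C where "C = \<bar>e\<bar> + 1"
  have "((\<lambda>x. \<bar>(f' x - f' 0) / (x - 0)\<bar>) \<longlongrightarrow> \<bar>e\<bar>) (at 0)"
    using f' unfolding has_field_derivative_iff by (intro tendsto_rabs) 
  then have "\<forall>\<^sub>F x in at 0. \<bar>(f' x - 1) / x\<bar> < C" using f'0 by (intro order_tendstoD) (auto simp: C_def)
  then obtain r where r: "r > 0" "\<And>x. x \<noteq> 0 \<Longrightarrow> \<bar>x\<bar> < r \<Longrightarrow> \<bar>(f' x - 1) / x\<bar> < C"
    by (auto simp: eventually_at dist_real_def)
  have lin: "\<bar>f' x - 1\<bar> \<le> C * \<bar>x\<bar>" if "\<bar>x\<bar> < r" for x
    using r(2)[of x] that f'0 by (cases "x = 0") (auto simp: abs_divide field_simps)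
  define r' where "r' = min (r / 2) (\<rho> / 2)"
  have r': "0 < r'" "r' < r" "r' < \<rho>" using r \<rho> by (auto simp: r'_def)
  have main: "\<bar>f x - f y - (x - y)\<bar> \<le> C * max \<bar>x\<bar> \<bar>y\<bar> * \<bar>x - y\<bar>"
    if xy: "x < y" "\<bar>x\<bar> \<le> r'" "\<bar>y\<bar> \<le> r'" for x y
  proof -
    obtain z where z: "x < z" "z < y" "f y - f x = (y - x) * f' z"
      using MVT2[OF xy(1), of f f'] f xy r' by fastforce
    have zm: "\<bar>z\<bar> \<le> max \<bar>x\<bar> \<bar>y\<bar>" using z by auto
    have "f x - f y - (x - y) = - ((y - x) * (f' z - 1))" using z(3) by (simp add: algebra_simps)
    then have "\<bar>f x - f y - (x - y)\<bar> = \<bar>f' z - 1\<bar> * \<bar>x - y\<bar>" by (simp add: abs_mult abs_minus_commute)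
    also have "\<dots> \<le> (C * \<bar>z\<bar>) * \<bar>x - y\<bar>" using lin[of z] zm xy r' by (intro mult_right_mono) auto
    also have "\<dots> \<le> C * max \<bar>x\<bar> \<bar>y\<bar> * \<bar>x - y\<bar>" using zm by (intro mult_right_mono mult_left_mono) (auto simp: C_def)
    finally show ?thesis .
  qed
  have "\<bar>f x - f y - (x - y)\<bar> \<le> C * max \<bar>x\<bar> \<bar>y\<bar> * \<bar>x - y\<bar>" if "\<bar>x\<bar> \<le> r'" "\<bar>y\<bar> \<le> r'" for x y
  proof (cases x y rule: linorder_cases)
    case greater
    have "\<bar>f x - f y - (x - y)\<bar> = \<bar>f y - f x - (y - x)\<bar>" by linarith
    then show ?thesis using main[OF greater that(2,1)] by (simp only: max.commute[of "\<bar>y\<bar>"] abs_minus_commute[of y])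
  qed (use main that in auto)
  then show ?thesis using r' by blast
qed

text \<open>Affine conjugation between the original and the normalized recursion.\<close>

lemma orb_rescale:
  assumes k: "k \<noteq> 0"
  shows "orbX (\<lambda>z. f (z / k + a)) (k * (x - a)) (k * y) n = k * (orbX f x y n - a)"
    "orbY (\<lambda>z. f (z / k + a)) (k * (x - a)) (k * y) n = k * orbY f x y n"
proof -
  have "orbX (\<lambda>z. f (z / k + a)) (k * (x - a)) (k * y) n = k * (orbX f x y n - a) \<and>
    orbY (\<lambda>z. f (z / k + a)) (k * (x - a)) (k * y) n = k * orbY f x y n"
  proof (induction n)
    case (Suc n)
    have "(k * (orbX f x y n - a) + k * orbY f x y n) / k + a = orbX f x y n + orbY f x y n"
      using k by (simp add: field_simps)
    then show ?case unfolding orb_Suc Suc[THEN conjunct1] Suc[THEN conjunct2] by (simp add: algebra_simps)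
  qed auto
  then show "orbX (\<lambda>z. f (z / k + a)) (k * (x - a)) (k * y) n = k * (orbX f x y n - a)"
    "orbY (\<lambda>z. f (z / k + a)) (k * (x - a)) (k * y) n = k * orbY f x y n" by auto
qed

lemma DR_dpsi_xi:
  assumes p: "0 < p" "p < 1" and Z: "set_pmf Z \<subseteq> {1..}"
  shows "0 < DR_dpsi_xi p Z"
proof -
  obtain D E where D: "\<And>x. 0 < x \<Longrightarrow> (DR_psi p Z has_real_derivative D x) (at x)"
    "\<And>x. 0 < x \<Longrightarrow> 0 < D x"
    using DR_psi_deriv[OF p(1) Z] by metis
  have "DR_dpsi_xi p Z = D (DR_xi p Z)"
    unfolding DR_dpsi_xi_def using D(1)[OF DR_xi(1)[OF p Z]] by (rule DERIV_imp_deriv)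
  then show ?thesis using D(2)[OF DR_xi(1)[OF p Z]] by simp
qed

text \<open>The normalization makes both \<open>\<Psi>(0)\<close> and \<open>\<Psi>'(0)\<close> equal to 1, so that the origin is the parabolic fixed point.\<close>

lemma DR_Psi_parabolic_growth:
  assumes p: "0 < p" "p < 1" and Z: "set_pmf Z \<subseteq> {1..}"
    and Zlog: "integrable (measure_pmf Z) (\<lambda>k. ln (real k))"
  shows "parabolic_growth (DR_Psi p Z) (DR_dpsi_xi p Z * DR_xi p Z) p"
proof -
  define k \<xi> where "k = DR_dpsi_xi p Z" and "\<xi> = DR_xi p Z"
  have k: "0 < k" using DR_dpsi_xi[OF p Z] by (simp add: k_def)
  have \<xi>: "0 < \<xi>" "DR_psi p Z \<xi> = 1" using DR_xi[OF p Z] by (auto simp: \<xi>_def)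
  have Psi: "DR_Psi p Z = (\<lambda>z. DR_psi p Z (z / k + \<xi>))" by (simp add: DR_Psi_def[abs_def] k_def \<xi>_def)
  obtain D E where D: "\<And>x. 0 < x \<Longrightarrow> (DR_psi p Z has_real_derivative D x) (at x)"
    and E: "\<And>x. 0 < x \<Longrightarrow> (D has_real_derivative E x) (at x)"
    using DR_psi_deriv[OF p(1) Z] by metis
  have kD: "D \<xi> = k" unfolding k_def DR_dpsi_xi_def using D[OF \<xi>(1)] by (simp add: \<xi>_def DERIV_imp_deriv)
  have pos: "0 < z / k + \<xi>" if "- (k * \<xi>) < z" for z
    using that k by (simp add: field_simps)
  have lin: "((\<lambda>z. z / k + \<xi>) has_real_derivative 1 / k) (at z)" for z
    using k by (auto intro!: derivative_eq_intros)
  have DP: "(DR_Psi p Z has_real_derivative D (z / k + \<xi>) * (1 / k)) (at z)" if "- (k * \<xi>) < z" for z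
    unfolding Psi using DERIV_chain2[OF D lin] pos[OF that] by auto
  have growth: "\<exists>g>0. (\<lambda>n. p ^ n * orbY (DR_Psi p Z) x y n) \<longlonglongrightarrow> g" if xy: "0 < x" "0 < y" for x y
  proof -
    have "DR_xi p Z < x / k + \<xi>" "0 < y / k" using xy k by (auto simp: \<xi>_def)
    then obtain g where g: "g > 0" "(\<lambda>n. p ^ n * orbY (DR_psi p Z) (x / k + \<xi>) (y / k) n) \<longlonglongrightarrow> g"
      using DR_psi_growth[OF p Z Zlog] by blast
    have "orbY (DR_Psi p Z) x y n = k * orbY (DR_psi p Z) (x / k + \<xi>) (y / k) n" for n
      using orb_rescale(2)[of k "DR_psi p Z" \<xi> "x / k + \<xi>" "y / k" n] k by (simp add: Psi)
    then have "(\<lambda>n. p ^ n * orbY (DR_Psi p Z) x y n) = (\<lambda>n. k * (p ^ n * orbY (DR_psi p Z) (x / k + \<xi>) (y / k) n))"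
      by auto
    moreover have "(\<lambda>n. k * (p ^ n * orbY (DR_psi p Z) (x / k + \<xi>) (y / k) n)) \<longlonglongrightarrow> k * g"
      by (intro tendsto_intros g)
    ultimately show ?thesis using k g(1) by (intro exI[of _ "k * g"]) auto
  qed
  show ?thesis
    unfolding k_def[symmetric] \<xi>_def[symmetric]
  proof
    show "0 < k * \<xi>" using k \<xi> by simp
    show "strict_mono_on {- (k * \<xi>)<..} (DR_Psi p Z)"
      unfolding Psi using k pos by (intro strict_mono_onI DR_psi_mono[OF p(1) Z]) (auto simp: divide_strict_right_mono)
    show "0 < DR_Psi p Z z" "DR_Psi p Z z \<le> 1 / p" if "- (k * \<xi>) < z" for z
      using DR_psi_bounds[OF p(1) pos[OF that]] by (auto simp: Psi)
    show "DR_Psi p Z 0 = 1" using \<xi> by (simp add: Psi)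
    show "\<exists>D. (DR_Psi p Z has_real_derivative D) (at z)" if "- (k * \<xi>) < z" for z using DP[OF that] by blast
    show "\<exists>C r. 0 < r \<and> (\<forall>x y. \<bar>x\<bar> \<le> r \<longrightarrow> \<bar>y\<bar> \<le> r \<longrightarrow>
        \<bar>DR_Psi p Z x - DR_Psi p Z y - (x - y)\<bar> \<le> C * max \<bar>x\<bar> \<bar>y\<bar> * \<bar>x - y\<bar>)"
    proof (rule quadratic_remainder)
      show "0 < k * \<xi>" using k \<xi> by simp
      show "(DR_Psi p Z has_real_derivative D (z / k + \<xi>) * (1 / k)) (at z)" if "\<bar>z\<bar> < k * \<xi>" for z
        using that by (intro DP) auto
      show "D (0 / k + \<xi>) * (1 / k) = 1" using kD k by simp
      have "((\<lambda>z. D (z / k + \<xi>)) has_real_derivative E (0 / k + \<xi>) * (1 / k)) (at 0)"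
        by (rule DERIV_chain2[OF E lin]) (use \<xi> in simp)
      then show "((\<lambda>z. D (z / k + \<xi>) * (1 / k)) has_real_derivative E (0 / k + \<xi>) * (1 / k) * (1 / k)) (at 0)"
        by (rule DERIV_cmult_right)
    qed
  qed (use p growth in auto)
qed

section \<open>Critical curve and free energy\<close>

theorem theorem2p6:
  fixes p :: real and Z :: "nat pmf"
  assumes p: "0 < p" "p < 1"
    and Z_pos: "set_pmf Z \<subseteq> {1..}"
    and Z_log: "integrable (measure_pmf Z) (\<lambda>k. ln (real k))"
  shows "\<exists>h. DR_h p Z h \<and> (\<forall>h'. DR_h p Z h' \<longrightarrow> (\<forall>x\<in>DR_I p Z. h' x = h x)) \<and>
    (\<forall>\<alpha> \<beta>. \<alpha> > 0 \<longrightarrow> \<beta> > 0 \<longrightarrow> \<alpha> + \<beta> \<ge> 1 \<longrightarrow>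
      (h (DR_dpsi_xi p Z * (\<beta> / \<alpha> - DR_xi p Z)) < DR_dpsi_xi p Z * ((1 - p) / (p * \<alpha>))
        \<longleftrightarrow> F_LF p Z \<alpha> \<beta> > 0)) \<and>
    (\<forall>\<alpha> \<beta>. \<alpha> > 0 \<longrightarrow> \<beta> > 0 \<longrightarrow> \<alpha> + \<beta> \<ge> 1 \<longrightarrow> \<beta> / \<alpha> \<le> DR_xi p Z \<longrightarrow>
      h (DR_dpsi_xi p Z * (\<beta> / \<alpha> - DR_xi p Z))
        < DR_dpsi_xi p Z * ((1 - p) / (p * \<alpha>)) * (\<alpha> + \<beta>) \<longrightarrow>
      gamma_star p Z \<alpha> \<beta>
        = p * \<alpha> * h (DR_dpsi_xi p Z * (\<beta> / \<alpha> - DR_xi p Z)) / (DR_dpsi_xi p Z * (1 - p)) \<and>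
      gamma_star p Z \<alpha> \<beta> \<in> {0..<\<alpha> + \<beta>} \<and>
      (\<exists>C>0. ((\<lambda>\<gamma>. (\<gamma> - gamma_star p Z \<alpha> \<beta>) powr (1 / 2) * ln (F_LF p Z (\<alpha> / \<gamma>) (\<beta> / \<gamma>)))
                \<longlongrightarrow> - C) (at_right (gamma_star p Z \<alpha> \<beta>))))"
proof -
  define k \<xi> where "k = DR_dpsi_xi p Z" and "\<xi> = DR_xi p Z"
  have k: "0 < k" using DR_dpsi_xi[OF p Z_pos] by (simp add: k_def)
  interpret parabolic_growth "DR_Psi p Z" "k * \<xi>" p
    unfolding k_def \<xi>_def by (rule DR_Psi_parabolic_growth[OF p Z_pos Z_log])
  have Psi: "DR_Psi p Z = (\<lambda>z. DR_psi p Z (z / k + \<xi>))" by (simp add: DR_Psi_def[abs_def] k_def \<xi>_def)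
  have I: "DR_I p Z = {- (k * \<xi>)<..}" by (simp add: DR_I_def k_def \<xi>_def)
  define c where "c = p / ((1 - p) * k)"
  have c: "0 < c" using p k by (simp add: c_def)
  have inI: "- (k * \<xi>) < k * (\<beta> / \<alpha> - \<xi>)" if "0 < \<alpha>" "0 < \<beta>" for \<alpha> \<beta> :: real
    using that k by (simp add: right_diff_distrib)
  have F: "F_LF p Z \<alpha> \<beta> = c * free_energy (k * (\<beta> / \<alpha> - \<xi>)) (k * ((1 - p) / (p * \<alpha>)))"
    if ab: "\<alpha> > 0" "\<beta> > 0" "\<alpha> + \<beta> \<ge> 1" for \<alpha> \<beta>
  proof -
    define x y where "x = \<beta> / \<alpha>" and "y = (1 - p) / (p * \<alpha>)"
    have "(\<lambda>n. c * (p ^ n * Y (k * (x - \<xi>)) (k * y) n)) \<longlonglongrightarrow> c * free_energy (k * (x - \<xi>)) (k * y)"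
      using inI[OF ab(1,2)] ab p k by (intro tendsto_intros free_energy_tendsto) (auto simp: x_def y_def)
    moreover have "c * (p ^ n * Y (k * (x - \<xi>)) (k * y) n) = p ^ n * (p / (1 - p) * orbY (DR_psi p Z) x y n)" for n
      using orb_rescale(2)[of k "DR_psi p Z" \<xi> x y n] k by (simp add: Psi c_def)
    ultimately show ?thesis unfolding F_LF_eq[OF p ab] by (simp add: x_def y_def limI)
  qed
  have h_curve: "DR_h p Z h"
    unfolding DR_h_def I
  proof (intro conjI)
    show "h \<in> {- (k * \<xi>)<..} \<rightarrow> {0..}" using h_nonneg by auto
    show "antimono_on {- (k * \<xi>)<..} h" using h_antimono by (intro monotone_onI) auto
    show "\<exists>L. L-lipschitz_on {- (k * \<xi>)<..} h" using h_lipschitz by blast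
  qed (use h_0 h_functional h_asymp in auto)
  have h_unique: "g x = h x" if g: "DR_h p Z g" and x: "x \<in> DR_I p Z" for g x
  proof (cases "x \<le> 0")
    case True
    obtain L where L: "L-lipschitz_on {- (k * \<xi>)<..} g" using g by (auto simp: DR_h_def I)
    show ?thesis
    proof (rule invariant_curve_unique)
      show "continuous_on {- (k * \<xi>)<..} g" using L by (rule lipschitz_on_continuous_on)
      show "\<forall>\<^sub>F x in at_left 0. g x \<noteq> 0"
      proof -
        have "g \<sim>[at_left 0] (\<lambda>x. x\<^sup>2 / 2)" using g by (simp add: DR_h_def)
        then have "\<forall>\<^sub>F x in at_left 0. g x = 0 \<longleftrightarrow> x\<^sup>2 / 2 = 0" by (rule asymp_equiv_eventually_zeros)
        moreover have "\<forall>\<^sub>F x in at_left 0. x \<in> {-1<..<0::real}" by (intro eventually_at_leftI[of "-1"]) auto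
        ultimately show ?thesis by eventually_elim auto
      qed
      show "g x' \<le> g x" if "- (k * \<xi>) < x" "x \<le> x'" for x x'
        using g that by (auto simp: DR_h_def I monotone_on_def)
    qed (use g x True in \<open>auto simp: DR_h_def I\<close>)
  next
    case False
    then show ?thesis using g h_0[of x] by (auto simp: DR_h_def)
  qed
  have pos_iff: "h (k * (\<beta> / \<alpha> - \<xi>)) < k * ((1 - p) / (p * \<alpha>)) \<longleftrightarrow> F_LF p Z \<alpha> \<beta> > 0"
    if ab: "\<alpha> > 0" "\<beta> > 0" "\<alpha> + \<beta> \<ge> 1" for \<alpha> \<beta>
    unfolding F[OF ab] using free_energy_pos_iff[OF inI[OF ab(1,2)], of "k * ((1 - p) / (p * \<alpha>))"] c p k ab
    by (simp add: zero_less_mult_iff)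
  have crit: "gamma_star p Z \<alpha> \<beta> = p * \<alpha> * h (k * (\<beta> / \<alpha> - \<xi>)) / (k * (1 - p)) \<and>
      gamma_star p Z \<alpha> \<beta> \<in> {0..<\<alpha> + \<beta>} \<and>
      (\<exists>C>0. ((\<lambda>\<gamma>. (\<gamma> - gamma_star p Z \<alpha> \<beta>) powr (1 / 2) * ln (F_LF p Z (\<alpha> / \<gamma>) (\<beta> / \<gamma>)))
                \<longlongrightarrow> - C) (at_right (gamma_star p Z \<alpha> \<beta>)))"
    if ab: "\<alpha> > 0" "\<beta> > 0" "\<alpha> + \<beta> \<ge> 1" and le: "\<beta> / \<alpha> \<le> \<xi>"
      and hl: "h (k * (\<beta> / \<alpha> - \<xi>)) < k * ((1 - p) / (p * \<alpha>)) * (\<alpha> + \<beta>)" for \<alpha> \<beta>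
  proof -
    define x where "x = k * (\<beta> / \<alpha> - \<xi>)"
    \<comment> \<open>replacing the parameters by \<open>(\<alpha> / \<gamma>, \<beta> / \<gamma>)\<close> leaves \<open>x\<close> fixed and puts the starting height at \<open>s * \<gamma>\<close>\<close>
    define s where "s = k * ((1 - p) / (p * \<alpha>))"
    define g where "g = h x / s"
    have x: "- (k * \<xi>) < x" "x \<le> 0" using inI[OF ab(1,2)] le k by (auto simp: x_def mult_nonneg_nonpos)
    have s: "0 < s" using k p ab by (simp add: s_def)
    have "h x < s * (\<alpha> + \<beta>)" using hl by (simp only: x_def s_def)
    then have g: "0 \<le> g" "g < \<alpha> + \<beta>"
      using h_nonneg[OF x(1)] s by (simp_all add: g_def pos_divide_less_eq mult.commute)
    have g_eq: "g = p * \<alpha> * h x / (k * (1 - p))" by (simp add: g_def s_def)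
    have ab\<gamma>: "0 < \<alpha> / \<gamma>" "0 < \<beta> / \<gamma>" "1 \<le> \<alpha> / \<gamma> + \<beta> / \<gamma>" if "\<gamma> \<in> {0<..\<alpha> + \<beta>}" for \<gamma>
      using that ab by (auto simp: add_divide_distrib[symmetric])
    have arg: "\<beta> / \<gamma> / (\<alpha> / \<gamma>) = \<beta> / \<alpha>" "k * ((1 - p) / (p * (\<alpha> / \<gamma>))) = s * \<gamma>" if "\<gamma> \<in> {0<..\<alpha> + \<beta>}" for \<gamma>
      using that ab by (auto simp: s_def)
    have F\<gamma>: "F_LF p Z (\<alpha> / \<gamma>) (\<beta> / \<gamma>) = c * free_energy x (s * \<gamma>)" if "\<gamma> \<in> {0<..\<alpha> + \<beta>}" for \<gamma>
      unfolding F[OF ab\<gamma>[OF that]] arg[OF that] x_def ..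
    have iff: "F_LF p Z (\<alpha> / \<gamma>) (\<beta> / \<gamma>) > 0 \<longleftrightarrow> g < \<gamma>" if "\<gamma> \<in> {0<..\<alpha> + \<beta>}" for \<gamma>
      unfolding pos_iff[OF ab\<gamma>[OF that], symmetric] arg[OF that] x_def[symmetric] g_def
      using s by (simp add: pos_divide_less_eq mult.commute)
    have "{\<gamma>\<in>{0<..\<alpha> + \<beta>}. F_LF p Z (\<alpha> / \<gamma>) (\<beta> / \<gamma>) > 0} = {g<..\<alpha> + \<beta>}"
      using iff g by auto
    then have gs: "gamma_star p Z \<alpha> \<beta> = g" unfolding gamma_star_def using g by simp
    obtain C where C: "C > 0" "((\<lambda>d. sqrt d * ln (free_energy x (h x + d))) \<longlongrightarrow> - C) (at_right 0)"
      using log_free_energy_asymp[OF x] by blast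
    have sub: "filterlim (\<lambda>\<gamma>. s * (\<gamma> - g)) (at_right 0) (at_right g)"
    proof -
      have "((\<lambda>\<gamma>. s * (\<gamma> - g)) \<longlongrightarrow> s * (g - g)) (at_right g)" by (intro tendsto_intros)
      moreover have "\<forall>\<^sub>F \<gamma> in at_right g. s * (\<gamma> - g) \<in> {0<..} \<and> s * (\<gamma> - g) \<noteq> 0"
        using eventually_at_right_less[of g] by eventually_elim (use s in auto)
      ultimately show ?thesis by (auto simp: filterlim_at)
    qed
    have "((\<lambda>\<gamma>. sqrt (s * (\<gamma> - g)) * ln (free_energy x (h x + s * (\<gamma> - g)))) \<longlongrightarrow> - C) (at_right g)"
      using filterlim_compose[OF C(2) sub] .
    moreover have "((\<lambda>\<gamma>. sqrt (\<gamma> - g) * ln c) \<longlongrightarrow> sqrt (g - g) * ln c) (at_right g)" by (intro tendsto_intros)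
    ultimately have lim: "((\<lambda>\<gamma>. sqrt (\<gamma> - g) * ln c + 1 / sqrt s * (sqrt (s * (\<gamma> - g)) * ln (free_energy x (h x + s * (\<gamma> - g)))))
        \<longlongrightarrow> sqrt (g - g) * ln c + 1 / sqrt s * - C) (at_right g)" by (intro tendsto_intros)
    have "\<forall>\<^sub>F \<gamma> in at_right g. \<gamma> \<in> {g<..<\<alpha> + \<beta>}" using g by (intro eventually_at_rightI[of g "\<alpha> + \<beta>"]) auto
    then have "\<forall>\<^sub>F \<gamma> in at_right g.
        sqrt (\<gamma> - g) * ln c + 1 / sqrt s * (sqrt (s * (\<gamma> - g)) * ln (free_energy x (h x + s * (\<gamma> - g)))) =
        (\<gamma> - g) powr (1 / 2) * ln (F_LF p Z (\<alpha> / \<gamma>) (\<beta> / \<gamma>))"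
    proof eventually_elim
      case (elim \<gamma>)
      have \<gamma>: "\<gamma> \<in> {0<..\<alpha> + \<beta>}" using elim g by auto
      have eq: "h x + s * (\<gamma> - g) = s * \<gamma>" using s by (simp add: g_def algebra_simps)
      have "0 < c * free_energy x (s * \<gamma>)" using iff[OF \<gamma>] elim F\<gamma>[OF \<gamma>] by auto
      then have "0 < free_energy x (s * \<gamma>)" using c by (simp add: zero_less_mult_iff)
      then have "ln (F_LF p Z (\<alpha> / \<gamma>) (\<beta> / \<gamma>)) = ln c + ln (free_energy x (s * \<gamma>))"
        using c by (simp add: F\<gamma>[OF \<gamma>] ln_mult)
      moreover have "1 / sqrt s * sqrt (s * (\<gamma> - g)) = sqrt (\<gamma> - g)" using s by (simp add: real_sqrt_mult)
      ultimately show ?case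
        using elim unfolding eq by (simp add: powr_half_sqrt distrib_left mult.assoc[symmetric])
    qed
    from Lim_transform_eventually[OF lim this]
    have "((\<lambda>\<gamma>. (\<gamma> - g) powr (1 / 2) * ln (F_LF p Z (\<alpha> / \<gamma>) (\<beta> / \<gamma>))) \<longlongrightarrow> - (C / sqrt s)) (at_right g)"
      by simp
    moreover have "0 < C / sqrt s" using C s by simp
    ultimately show ?thesis unfolding gs using g g_eq by (auto simp: x_def)
  qed
  show ?thesis
    unfolding k_def[symmetric] \<xi>_def[symmetric]
    using h_curve h_unique pos_iff crit by (intro exI[of _ h] conjI) blast+
qed

end
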